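(* There exist a compact metric space $X$, an atomless probability measure $\mu\in\mathcal P(X)$, and a bounded Lipschitz cost $C:X\times X\to[0,\infty)$ for which the entropic minimisers $P_\varepsilon\in\Pi(\mu,\mu)$ do not converge weakly as $\varepsilon\downarrow0$, and such that every optimal plan (every minimiser of $P\mapsto\int C\,dP$ over $\Pi(\mu,\mu)$) is singular with respect to $\mu\otimes\mu$. Moreover, for $a\in(0,1)$ and $\beta\in(0,\infty)\setminus\{1\}$, in the dyadic Cantor-group construction described in the context (with parameters $a,\beta$, with $X=G$ and entropic minimisers $P_\varepsilon\in\Pi(\mu,\mu)$), $$\mathrm{Clust}(P_\varepsilon)=\{P_w:w\in\mathcal W\},\qquad P_w=wP_0+(1-w)P_{t_0},$$ where $\mathcal W=\mathrm{Clust}(w_\varepsilon)$ is a non-degenerate compact interval in $[0,1]$, and this interval contains the two distinct weights $$w^\pm=\frac{\sqrt{(1+e^{-1})(1+e^{-\beta})}}{\sqrt{(1+e^{-1})(1+e^{-\beta})}+\sqrt{(1+e^{-(1\pm a)})(1+e^{-\beta(1\pm a)})}},\qquad w^-<w^+ .$$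
   Context: General notation. $\Pi(\mu,\nu)$ is the set of couplings of $\mu,\nu$. $\mathrm{KL}(P\|M)=\int\log(dP/dM)\,dP$ if $P\ll M$, and $+\infty$ otherwise. The entropic minimiser $P_\varepsilon$ ($\varepsilon>0$) is the unique minimiser over $\Pi(\mu,\mu)$ of $F_\varepsilon(P)=\int C\,dP+\varepsilon\,\mathrm{KL}(P\|\mu\otimes\mu)$. For a family $(z_\varepsilon)_{\varepsilon>0}$ in a metrisable space, $\mathrm{Clust}(z_\varepsilon)$ is the set of $z$ such that $z_{\varepsilon_n}\to z$ for some sequence $\varepsilon_n\downarrow0$ (weak convergence is used for measures). Products of metric spaces carry the maximum product metric. Dyadic Cantor-group construction. Fix $a\in(0,1)$ and $\beta\in(0,\infty)\setminus\{1\}$. Let $G=\{0,1\}^{\mathbb N}$, $\mathbb N=\{1,2,\dots\}$, with coordinatewise addition modulo $2$ and the metric $d(s,s)=0$, $d(s,t)=2^{-n(s,t)}$ for $s\ne t$, where $n(s,t)=\min\{k\ge1:s_k\ne t_k\}$. Let $\mu=(\frac12\delta_0+\frac12\delta_1)^{\otimes\mathbb N}$ and $t_0=(1,0,0,\dots)$. For $n\ge2$ let $\alpha_n=e^{-2^n}$, and $L_n=1+a$ if $n$ is even, $L_n=1-a$ if $n$ is odd. For $t\in G$ let $m(t)=\min\{k\ge2:t_k=1\}$ ($=\infty$ if $t_k=0$ for all $k\ge2$). Define $W(t)=0$ if $t\in\{0,t_0\}$; $W(t)=\alpha_{m(t)}$ if $t_1=0$, $t\neq0$; $W(t)=\alpha_{m(t)}L_{m(t)}$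 if $t_1=1$, $t\ne t_0$. Let $\gamma(x)=1$ if $x_1=0$ and $\gamma(x)=\beta$ if $x_1=1$. The cost is $C(x,y)=\gamma(x)W(y-x)$ on $G\times G$, and both marginals are $\mu$. The graph couplings are $P_0=(\mathrm{Id},\mathrm{Id})_\#\mu$ and $P_{t_0}=(\mathrm{Id},T_{t_0})_\#\mu$ with $T_{t_0}(x)=x+t_0$. Scalar weight. With $U_i=\{t\in G:t_1=i\}$ for $i\in\{0,1\}$, let $I_i(\varepsilon)=\int_{U_i}e^{-W(t)/\varepsilon}\,\mu(dt)$ and $J_i(\varepsilon)=\int_{U_i}e^{-\beta W(t)/\varepsilon}\,\mu(dt)$; set $A_\varepsilon=\sqrt{I_0(\varepsilon)J_0(\varepsilon)}$, $B_\varepsilon=\sqrt{I_1(\varepsilon)J_1(\varepsilon)}$, and $w_\varepsilon=A_\varepsilon/(A_\varepsilon+B_\varepsilon)\in(0,1)$. *)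

theory Defs
  imports "HOL-Probability.Probability" "HOL-Library.Z2" "HOL-Library.Function_Algebras"
begin

section \<open>Measures on topological spaces\<close>

definition borel_of :: "'a topology \<Rightarrow> 'a measure" where
  "borel_of T = sigma (topspace T) {U. openin T U}"

definition prob_measures :: "'a topology \<Rightarrow> 'a measure set" where
  "prob_measures T = {Q. prob_space Q \<and> sets Q = sets (borel_of T)}"

definition weak_limit ::
  "'a topology \<Rightarrow> ('i \<Rightarrow> 'a measure) \<Rightarrow> 'a measure \<Rightarrow> 'i filter \<Rightarrow> bool" where
  "weak_limit T z Q F \<longleftrightarrow> Q \<in> prob_measures T \<and>
     (\<forall>f. continuous_map T euclideanreal f \<and> bounded (f ` topspace T) \<longrightarrow>
        ((\<lambda>i. \<integral>x. f x \<partial>(z i)) \<longlongrightarrow> (\<integral>x. f x \<partial>Q)) F)"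

text \<open>The first argument is the notion of sequential convergence: \<open>LIMSEQ\<close> for real
  families, weak convergence for families of measures.\<close>

definition Clust :: "((nat \<Rightarrow> 'b) \<Rightarrow> 'b \<Rightarrow> bool) \<Rightarrow> (real \<Rightarrow> 'b) \<Rightarrow> 'b set" where
  "Clust conv z =
     {x. \<exists>e :: nat \<Rightarrow> real. (\<forall>n. 0 < e n) \<and> decseq e \<and> e \<longlonglongrightarrow> 0 \<and> conv (\<lambda>n. z (e n)) x}"

definition atomless :: "'a measure \<Rightarrow> bool" where
  "atomless M \<longleftrightarrow> (\<forall>A\<in>sets M. 0 < emeasure M A \<longrightarrow>
     (\<exists>B\<in>sets M. B \<subseteq> A \<and> 0 < emeasure M B \<and> emeasure M B < emeasure M A))"

definition mutually_singular :: "'a measure \<Rightarrow> 'a measure \<Rightarrow> bool" where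
  "mutually_singular P M \<longleftrightarrow> sets P = sets M \<and>
     (\<exists>N\<in>sets M. emeasure P N = 0 \<and> emeasure M (space M - N) = 0)"

definition mix_measure :: "real \<Rightarrow> 'a measure \<Rightarrow> 'a measure \<Rightarrow> 'a measure" where
  "mix_measure w M N = measure_of (space M) (sets M)
     (\<lambda>A. ennreal w * emeasure M A + ennreal (1 - w) * emeasure N A)"

lemma sets_mix_measure [simp]: "sets (mix_measure w M N) = sets M"
  by (simp add: mix_measure_def)

lemma emeasure_mix_measure:
  assumes "sets N = sets M" "A \<in> sets M"
  shows "emeasure (mix_measure w M N) A = ennreal w * emeasure M A + ennreal (1 - w) * emeasure N A"
  unfolding mix_measure_def
proof (rule emeasure_measure_of_sigma)
  show "sigma_algebra (space M) (sets M)" ..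
  show "positive (sets M) (\<lambda>A. ennreal w * emeasure M A + ennreal (1 - w) * emeasure N A)"
    by (simp add: positive_def)
  show "countably_additive (sets M) (\<lambda>A. ennreal w * emeasure M A + ennreal (1 - w) * emeasure N A)"
  proof (rule countably_additiveI)
    fix F :: "nat \<Rightarrow> 'a set"
    assume F: "range F \<subseteq> sets M" "disjoint_family F"
    then have "(\<Sum>i. emeasure M (F i)) = emeasure M (\<Union>i. F i)"
      "(\<Sum>i. emeasure N (F i)) = emeasure N (\<Union>i. F i)"
      using assms(1) by (auto intro!: suminf_emeasure)
    then show "(\<Sum>i. ennreal w * emeasure M (F i) + ennreal (1 - w) * emeasure N (F i)) =
      ennreal w * emeasure M (\<Union>i. F i) + ennreal (1 - w) * emeasure N (\<Union>i. F i)"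
      by (simp flip: suminf_add)
  qed
qed (use assms in auto)

section \<open>Entropic and unregularised optimal transport\<close>

definition couplings :: "'a measure \<Rightarrow> 'b measure \<Rightarrow> ('a \<times> 'b) measure set" where
  "couplings \<mu> \<nu> = {P. sets P = sets (\<mu> \<Otimes>\<^sub>M \<nu>) \<and> distr P \<mu> fst = \<mu> \<and> distr P \<nu> snd = \<nu>}"

text \<open>For probability measures with \<open>P\<close> absolutely continuous with respect to \<open>M\<close>, the negative
  part of \<open>ln (dP/dM)\<close> is \<open>P\<close>-integrable, so non-integrability means that the integral
  is \<open>\<infinity>\<close>. The library's \<open>KL_divergence b M P\<close> takes the reference measure first.\<close>

definition KL :: "'a measure \<Rightarrow> 'a measure \<Rightarrow> ereal" where
  "KL P M =
     (if absolutely_continuous M P \<and> integrable P (entropy_density (exp 1) M P)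
      then ereal (KL_divergence (exp 1) M P) else \<infinity>)"

definition entropic_cost :: "('a \<times> 'a \<Rightarrow> real) \<Rightarrow> 'a measure \<Rightarrow> real \<Rightarrow> ('a \<times> 'a) measure \<Rightarrow> ereal" where
  "entropic_cost C \<mu> \<epsilon> P = ereal (\<integral>z. C z \<partial>P) + ereal \<epsilon> * KL P (\<mu> \<Otimes>\<^sub>M \<mu>)"

text \<open>The minimiser over couplings exists and is unique when \<open>\<mu>\<close> is a Borel probability measure
  on a compact metric space, \<open>C\<close> is continuous and \<open>\<epsilon> > 0\<close>; without a unique minimiser the value is unspecified.\<close>

definition entropic_minimiser :: "('a \<times> 'a \<Rightarrow> real) \<Rightarrow> 'a measure \<Rightarrow> real \<Rightarrow> ('a \<times> 'a) measure" where
  "entropic_minimiser C \<mu> \<epsilon> =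
     (THE P. is_arg_min (entropic_cost C \<mu> \<epsilon>) (\<lambda>P. P \<in> couplings \<mu> \<mu>) P)"

definition optimal_plan :: "('a \<times> 'a \<Rightarrow> real) \<Rightarrow> 'a measure \<Rightarrow> ('a \<times> 'a) measure \<Rightarrow> bool" where
  "optimal_plan C \<mu> P \<longleftrightarrow> is_arg_min (\<lambda>P. \<integral>z. C z \<partial>P) (\<lambda>P. P \<in> couplings \<mu> \<mu>) P"

text \<open>The product carries the maximum metric, which is not the library's \<open>prod_metric\<close>;
  both induce \<open>prod_topology\<close>.\<close>

definition bounded_Lipschitz_cost :: "'a metric \<Rightarrow> ('a \<times> 'a \<Rightarrow> real) \<Rightarrow> bool" where
  "bounded_Lipschitz_cost X C \<longleftrightarrow>
     (\<forall>z \<in> mspace X \<times> mspace X. 0 \<le> C z) \<and>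
     bounded (C ` (mspace X \<times> mspace X)) \<and>
     (\<exists>L. \<forall>x \<in> mspace X. \<forall>y \<in> mspace X. \<forall>x' \<in> mspace X. \<forall>y' \<in> mspace X.
        \<bar>C (x, y) - C (x', y')\<bar> \<le> L * max (mdist X x x') (mdist X y y'))"

section \<open>The dyadic Cantor group\<close>

text \<open>Group operations are the pointwise ones on functions into the field \<open>bit\<close>. Coordinates in the
  construction are numbered from 1, hence the shift in \<open>coord\<close>. As \<open>cantor\<close> has the cardinality of the
  continuum, every compact metric space is isometric to some \<open>X :: cantor metric\<close> (with
  arbitrary carrier and distance), so existence of a compact metric space is expressed over
  that type.\<close>

type_synonym cantor = "nat \<Rightarrow> bit"

definition coord :: "cantor \<Rightarrow> nat \<Rightarrow> bit" where
  "coord s k = s (k - 1)"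

definition cantor_dist :: "cantor \<Rightarrow> cantor \<Rightarrow> real" where
  "cantor_dist s t = (if s = t then 0 else (1/2) ^ (LEAST k. 1 \<le> k \<and> coord s k \<noteq> coord t k))"

lemma cantor_dist_le:
  "cantor_dist s t \<le> (1/2) ^ n \<longleftrightarrow> (\<forall>k. 1 \<le> k \<and> k < n \<longrightarrow> coord s k = coord t k)"
proof (cases "s = t")
  case False
  define m where "m = (LEAST k. 1 \<le> k \<and> coord s k \<noteq> coord t k)"
  obtain i where "s i \<noteq> t i" using False by auto
  then have ex: "1 \<le> Suc i \<and> coord s (Suc i) \<noteq> coord t (Suc i)" by (simp add: coord_def)
  have m: "1 \<le> m \<and> coord s m \<noteq> coord t m"
    unfolding m_def using ex by (rule LeastI)
  have less: "k < m \<Longrightarrow> \<not> (1 \<le> k \<and> coord s k \<noteq> coord t k)" for k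
    unfolding m_def by (rule not_less_Least)
  have "cantor_dist s t \<le> (1/2) ^ n \<longleftrightarrow> n \<le> m"
    using False by (simp add: cantor_dist_def m_def power_decreasing_iff)
  also have "\<dots> \<longleftrightarrow> (\<forall>k. 1 \<le> k \<and> k < n \<longrightarrow> coord s k = coord t k)"
    using m less by (meson not_le order_less_le_trans)
  finally show ?thesis .
qed (simp add: cantor_dist_def)

lemma Metric_space_cantor: "Metric_space UNIV cantor_dist"
proof
  fix x y z :: cantor
  show nn: "0 \<le> cantor_dist x y" for x y by (simp add: cantor_dist_def)
  show "cantor_dist x y = cantor_dist y x"
    by (simp add: cantor_dist_def eq_commute)
  show "cantor_dist x y = 0 \<longleftrightarrow> x = y" by (simp add: cantor_dist_def)
  show "cantor_dist x z \<le> cantor_dist x y + cantor_dist y z"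
  proof (cases "x = y \<or> y = z")
    case True
    then show ?thesis using nn by (auto simp: cantor_dist_def)
  next
    case False
    then obtain n p where np: "cantor_dist x y = (1/2) ^ n" "cantor_dist y z = (1/2) ^ p"
      unfolding cantor_dist_def by metis
    have "\<forall>k. 1 \<le> k \<and> k < n \<longrightarrow> coord x k = coord y k"
      "\<forall>k. 1 \<le> k \<and> k < p \<longrightarrow> coord y k = coord z k"
      using cantor_dist_le np by (metis order_refl)+
    then have "\<forall>k. 1 \<le> k \<and> k < min n p \<longrightarrow> coord x k = coord z k" by simp
    then have "cantor_dist x z \<le> (1/2) ^ min n p" by (simp only: cantor_dist_le)
    also have "\<dots> \<le> (1/2) ^ n + (1/2) ^ p" by (simp add: min_def)
    finally show ?thesis by (simp add: np)
  qed
qed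

definition cantor_metric :: "cantor metric" where
  "cantor_metric = metric (UNIV, cantor_dist)"

lemma mspace_cantor_metric [simp]: "mspace cantor_metric = UNIV"
  and mdist_cantor_metric [simp]: "mdist cantor_metric = cantor_dist"
  by (simp_all add: cantor_metric_def Metric_space.mspace_metric Metric_space.mdist_metric
      Metric_space_cantor)

definition haar :: "cantor measure" where
  "haar = PiM UNIV (\<lambda>_. uniform_count_measure (UNIV :: bit set))"

definition t0 :: cantor where
  "t0 = (\<lambda>i. if i = 0 then 1 else 0)"

definition alpha :: "nat \<Rightarrow> real" where
  "alpha n = exp (- (2 ^ n))"

definition Lfac :: "real \<Rightarrow> nat \<Rightarrow> real" where
  "Lfac a n = (if even n then 1 + a else 1 - a)"

text \<open>Only used for \<open>t \<notin> {0, t0}\<close>, where some coordinate beyond the first equals 1.\<close>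

definition mfirst :: "cantor \<Rightarrow> nat" where
  "mfirst t = (LEAST k. 2 \<le> k \<and> coord t k = 1)"

definition Wfun :: "real \<Rightarrow> cantor \<Rightarrow> real" where
  "Wfun a t = (if t \<in> {0, t0} then 0
     else if coord t 1 = 0 then alpha (mfirst t)
     else alpha (mfirst t) * Lfac a (mfirst t))"

definition gam :: "real \<Rightarrow> cantor \<Rightarrow> real" where
  "gam \<beta> x = (if coord x 1 = 0 then 1 else \<beta>)"

definition cantor_cost :: "real \<Rightarrow> real \<Rightarrow> cantor \<times> cantor \<Rightarrow> real" where
  "cantor_cost a \<beta> = (\<lambda>(x, y). gam \<beta> x * Wfun a (y - x))"

definition graph_coupling :: "cantor \<Rightarrow> (cantor \<times> cantor) measure" where
  "graph_coupling t = distr haar (haar \<Otimes>\<^sub>M haar) (\<lambda>x. (x, x + t))"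

definition P_mix :: "real \<Rightarrow> (cantor \<times> cantor) measure" where
  "P_mix w = mix_measure w (graph_coupling 0) (graph_coupling t0)"

definition I_int :: "real \<Rightarrow> bit \<Rightarrow> real \<Rightarrow> real" where
  "I_int a i \<epsilon> = (LINT t:{t. coord t 1 = i}|haar. exp (- Wfun a t / \<epsilon>))"

definition J_int :: "real \<Rightarrow> real \<Rightarrow> bit \<Rightarrow> real \<Rightarrow> real" where
  "J_int a \<beta> i \<epsilon> = (LINT t:{t. coord t 1 = i}|haar. exp (- \<beta> * Wfun a t / \<epsilon>))"

definition weight :: "real \<Rightarrow> real \<Rightarrow> real \<Rightarrow> real" where
  "weight a \<beta> \<epsilon> =
     (let A = sqrt (I_int a 0 \<epsilon> * J_int a \<beta> 0 \<epsilon>);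
          B = sqrt (I_int a 1 \<epsilon> * J_int a \<beta> 1 \<epsilon>)
      in A / (A + B))"

text \<open>\<open>limit_weight \<beta> a\<close> and \<open>limit_weight \<beta> (- a)\<close> are the weights usually written
  \<open>w\<close> with superscript plus and minus.\<close>

definition limit_weight :: "real \<Rightarrow> real \<Rightarrow> real" where
  "limit_weight \<beta> c =
     sqrt ((1 + exp (- 1)) * (1 + exp (- \<beta>))) /
       (sqrt ((1 + exp (- 1)) * (1 + exp (- \<beta>))) +
        sqrt ((1 + exp (- (1 + c))) * (1 + exp (- \<beta> * (1 + c)))))"

end

theory Submission
  imports Defs
begin

text \<open>The cost vanishes exactly on the graphs of \<open>x \<mapsto> x\<close> and \<open>x \<mapsto> x + t0\<close>. So every mixture of the two graph
couplings is optimal, every optimal plan is carried by two graphs and hence singular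
(\<open>optimal_plan_singular\<close>), and the entropy has to choose among the mixtures. Its choice depends on \<open>\<epsilon>\<close>
and never settles.

The minimiser is explicit. The cost depends on \<open>x\<close> only through \<open>y - x\<close> and the first coordinate of
\<open>x\<close>, and Haar measure is translation invariant, so finding potentials \<open>\<phi>(x) + \<psi>(y)\<close> amounts to
scaling the two by two matrix with rows \<open>(I\<^sub>0, I\<^sub>1)\<close> and \<open>(J\<^sub>1, J\<^sub>0)\<close> to a doubly stochastic one. The
diagonal entry \<open>w\<close> of the result is determined by the cross-ratio, which is preserved:
\<open>w\<^sup>2 / (1 - w)\<^sup>2 = I\<^sub>0 J\<^sub>0 / (I\<^sub>1 J\<^sub>1)\<close>, and this is the scalar weight. The resulting \<open>gibbs_plan\<close> draws
\<open>y - x\<close> from a normalised Boltzmann measure on the half around \<open>0\<close> with probability \<open>w\<close> and on the half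
around \<open>t0\<close> with probability \<open>1 - w\<close>. By the Gibbs variational principle a coupling with a density of
this exponential form is the unique minimiser (\<open>entropic_minimiser_gibbs\<close>,
\<open>entropic_minimiser_eq_gibbs_plan\<close>).

As \<open>\<epsilon>\<close> tends to 0, the Boltzmann measures concentrate at \<open>0\<close> and at \<open>t0\<close> (\<open>gibbs_average_tendsto\<close>), so
the minimisers converge along a sequence as soon as the weights do, with limit \<open>P_mix w\<close>
(\<open>gibbs_plan_weak_limit\<close>). Conversely the weight is the mass of a clopen set. Thus the cluster set of the
minimisers is the image of the cluster set of the weights (\<open>Clust_minimiser\<close>), which is a compact
interval because the weight is continuous in \<open>\<epsilon>\<close> (\<open>Clust_interval\<close>).

The interval is non-degenerate because of the separation of scales in \<open>\<alpha>\<^sub>n = exp (- (2 ^ n))\<close>. At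
\<open>\<epsilon> = \<alpha>\<^sub>n\<close>, points with \<open>m(t) < n\<close> contribute nothing in the limit, points with \<open>m(t) > n\<close> contribute
their full mass, and the shell \<open>m(t) = n\<close>, which has the same mass, contributes the factor
\<open>exp (- \<kappa>)\<close> or \<open>exp (- \<kappa> L\<^sub>n)\<close> according to the half (\<open>scaled_partition_fn_bounds\<close>). As \<open>L\<^sub>n\<close> alternates
between \<open>1 + a\<close> and \<open>1 - a\<close>, the weights along even and odd \<open>n\<close> have the two different limits
\<open>limit_weight \<beta> a\<close> and \<open>limit_weight \<beta> (- a)\<close> (\<open>weight_tendsto\<close>).\<close>

section \<open>The Gibbs variational principle\<close>

lemma gibbs_density:
  fixes h :: "'a \<Rightarrow> real"
  assumes M: "prob_space M" and h [measurable]: "h \<in> borel_measurable M" and B: "\<And>x. \<bar>h x\<bar> \<le> B"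
    and R: "R = density M (\<lambda>x. exp (h x))" "prob_space R"
  shows "absolutely_continuous M R" "integrable R (entropy_density (exp 1) M R)"
    "KL_divergence (exp 1) M R = (\<integral>x. h x \<partial>R)"
proof -
  interpret M: prob_space M by fact
  interpret R: prob_space R by fact
  interpret I: information_space M "exp 1" by unfold_locales simp
  have [measurable_cong]: "sets R = sets M" by (simp add: R)
  show ac: "absolutely_continuous M R"
    unfolding R by (rule absolutely_continuousI_density) simp
  have "AE x in M. ennreal (exp (h x)) = RN_deriv M R x"
    by (rule M.RN_deriv_unique) (simp_all add: R)
  then have "AE x in R. ennreal (exp (h x)) = RN_deriv M R x"
    unfolding R by (subst AE_density) auto
  then have eq: "AE x in R. entropy_density (exp 1) M R x = h x"
  proof eventually_elim
    case (elim x)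
    then show ?case
      by (simp add: entropy_density_def elim[symmetric] log_def)
  qed
  have inth: "integrable R h"
    by (rule R.integrable_const_bound[where B=B]) (use B in \<open>auto simp: real_norm_def\<close>)
  show "integrable R (entropy_density (exp 1) M R)"
    by (subst integrable_cong_AE[OF _ _ eq]) (use inth in auto)
  show "KL_divergence (exp 1) M R = (\<integral>x. h x \<partial>R)"
    unfolding KL_divergence_def by (rule integral_cong_AE[OF _ _ eq]) auto
qed

text \<open>Writing \<open>N\<close> and \<open>R\<close> relative to \<open>M\<close>, the chain rule gives \<open>KL(N | R) = KL(N | M) - \<integral>h dN\<close>: the
logarithm of \<open>dR/dM\<close> is the bounded function \<open>h\<close>, so it may be split off whenever \<open>KL(N | M)\<close> is
finite. Both claims are then nonnegativity of \<open>KL(N | R)\<close> and its case of equality.\<close>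

lemma gibbs_variational:
  fixes h :: "'a \<Rightarrow> real"
  assumes M: "prob_space M" and h [measurable]: "h \<in> borel_measurable M" and B: "\<And>x. \<bar>h x\<bar> \<le> B"
    and R: "R = density M (\<lambda>x. exp (h x))" "prob_space R"
    and N: "prob_space N" "sets N = sets M" "absolutely_continuous M N"
      "integrable N (entropy_density (exp 1) M N)"
  shows "(\<integral>x. h x \<partial>N) \<le> KL_divergence (exp 1) M N"
    and "KL_divergence (exp 1) M N = (\<integral>x. h x \<partial>N) \<Longrightarrow> N = R"
proof -
  interpret M: prob_space M by fact
  interpret R: prob_space R by fact
  interpret N: prob_space N by fact
  interpret I: information_space R "exp 1" by unfold_locales simp
  have [measurable_cong]: "sets R = sets M" by (simp add: R)
  note N(2)[measurable_cong]
  obtain D where D [measurable]: "D \<in> borel_measurable M"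
    and RN: "AE x in M. RN_deriv M N x = ennreal (D x)"
    and pos: "AE x in N. 0 < D x" and D0: "\<And>x. 0 \<le> D x"
    using M.real_RN_deriv[OF N.finite_measure_axioms N(3,2)] by auto
  have ND: "N = density M (\<lambda>x. ennreal (D x))"
  proof -
    have "N = density M (RN_deriv M N)"
      using N by (simp add: M.density_RN_deriv)
    also have "\<dots> = density M D"
      using RN by (auto intro!: density_cong)
    finally show ?thesis .
  qed
  define q where "q x = D x / exp (h x)" for x
  have q [measurable]: "q \<in> borel_measurable M" unfolding q_def by measurable
  have q0: "0 \<le> q x" for x using D0 by (simp add: q_def)
  (* q is dN/dR *)
  have NR: "N = density R q"
    unfolding R ND using q0 D0
    by (subst density_density_eq) (auto intro!: density_cong simp: q_def simp flip: ennreal_mult)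
  have eq: "AE x in N. ln (q x) = entropy_density (exp 1) M N x - h x"
    using pos absolutely_continuous_AE[OF N(2,3) RN]
    by eventually_elim
      (simp add: q_def entropy_density_def log_def ln_div)
  have inth: "integrable N h"
    by (rule N.integrable_const_bound[where B=B]) (use B in \<open>auto simp: real_norm_def\<close>)
  have intq: "integrable N (\<lambda>x. ln (q x))"
    by (subst integrable_cong_AE[OF _ _ eq]) (use inth N(4) in auto)
  have int: "integrable R (\<lambda>x. q x * log (exp 1) (q x))"
    using intq q0 unfolding NR
    by (subst (asm) integrable_real_density) (auto simp: log_def)
  have "KL_divergence (exp 1) R N = (\<integral>x. q x * log (exp 1) (q x) \<partial>R)"
    unfolding NR using q0 by (intro R.KL_density) auto
  also have "\<dots> = (\<integral>x. ln (q x) \<partial>N)"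
    unfolding NR using q0 by (subst integral_real_density) (auto simp: log_def)
  also have "\<dots> = (\<integral>x. entropy_density (exp 1) M N x - h x \<partial>N)"
    by (rule integral_cong_AE[OF _ _ eq]) auto
  also have "\<dots> = KL_divergence (exp 1) M N - (\<integral>x. h x \<partial>N)"
    unfolding KL_divergence_def using inth N(4) by simp
  finally have KL: "KL_divergence (exp 1) R N = KL_divergence (exp 1) M N - (\<integral>x. h x \<partial>N)" .
  have "0 \<le> KL_divergence (exp 1) R N"
    using I.KL_nonneg[OF _ _ _ int] N(1) q0 unfolding NR by auto
  then show "(\<integral>x. h x \<partial>N) \<le> KL_divergence (exp 1) M N" using KL by simp
  assume "KL_divergence (exp 1) M N = (\<integral>x. h x \<partial>N)"
  then have "KL_divergence (exp 1) R N = 0" using KL by simp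
  then show "N = R"
    using I.KL_eq_0_iff_eq[OF _ _ _ int] N(1) q0 unfolding NR by auto
qed

lemma prob_space_coupling:
  assumes "prob_space \<mu>" "P \<in> couplings \<mu> \<nu>"
  shows "prob_space P"
proof -
  have [measurable_cong]: "sets P = sets (\<mu> \<Otimes>\<^sub>M \<nu>)" and d: "distr P \<mu> fst = \<mu>"
    using assms(2) by (auto simp: couplings_def)
  have "fst \<in> measurable P \<mu>" by measurable
  moreover have "prob_space (distr P \<mu> fst)" using assms(1) d by simp
  ultimately show ?thesis using prob_space_distrD by blast
qed

text \<open>On couplings the terms \<open>\<phi>(x)\<close> and \<open>\<psi>(y)\<close> integrate to constants, so with
\<open>h = \<phi> \<oplus> \<psi> - C / \<epsilon>\<close> the entropic cost equals a constant plus \<open>\<epsilon>\<close> times the gap in the Gibbs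
variational principle. A coupling of this exponential form is therefore the unique minimiser.\<close>

lemma entropic_minimiser_gibbs:
  fixes C :: "'a \<times> 'a \<Rightarrow> real"
  assumes \<mu>: "prob_space \<mu>" and \<epsilon>: "\<epsilon> > 0"
    and C [measurable]: "C \<in> borel_measurable (\<mu> \<Otimes>\<^sub>M \<mu>)" and C_bound: "\<And>z. \<bar>C z\<bar> \<le> c"
    and \<phi> [measurable]: "\<phi> \<in> borel_measurable \<mu>" and \<phi>_bound: "\<And>x. \<bar>\<phi> x\<bar> \<le> p"
    and \<psi> [measurable]: "\<psi> \<in> borel_measurable \<mu>" and \<psi>_bound: "\<And>x. \<bar>\<psi> x\<bar> \<le> q"
    and R_def: "R = density (\<mu> \<Otimes>\<^sub>M \<mu>) (\<lambda>z. exp (\<phi> (fst z) + \<psi> (snd z) - C z / \<epsilon>))"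
    and R: "R \<in> couplings \<mu> \<mu>"
  shows "entropic_minimiser C \<mu> \<epsilon> = R"
proof -
  interpret \<mu>: prob_space \<mu> by fact
  interpret MM: pair_prob_space \<mu> \<mu> by unfold_locales
  let ?M = "\<mu> \<Otimes>\<^sub>M \<mu>"
  define h where "h z = \<phi> (fst z) + \<psi> (snd z) - C z / \<epsilon>" for z
  have h [measurable]: "h \<in> borel_measurable ?M" unfolding h_def by measurable
  have h_bound: "\<bar>h z\<bar> \<le> p + q + c / \<epsilon>" for z
  proof -
    have "\<bar>C z / \<epsilon>\<bar> \<le> c / \<epsilon>" using C_bound[of z] \<epsilon> by (simp add: divide_right_mono)
    then show ?thesis using \<phi>_bound[of "fst z"] \<psi>_bound[of "snd z"] unfolding h_def by linarith
  qed
  define k where "k = (\<integral>x. \<phi> x \<partial>\<mu>) + (\<integral>x. \<psi> x \<partial>\<mu>)"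
  have R_h: "R = density ?M (\<lambda>z. exp (h z))" by (simp add: R_def h_def)
  have MP: "prob_space ?M" by unfold_locales
  have RP: "prob_space R" using prob_space_coupling[OF \<mu> R] .
  note var = gibbs_variational[OF MP h h_bound R_h RP]
  have int_h: "(\<integral>z. h z \<partial>P) = k - (\<integral>z. C z \<partial>P) / \<epsilon>" if P: "P \<in> couplings \<mu> \<mu>" for P
  proof -
    interpret P: prob_space P using prob_space_coupling[OF \<mu> P] .
    have [measurable_cong]: "sets P = sets ?M"
      and d: "distr P \<mu> fst = \<mu>" "distr P \<mu> snd = \<mu>" using P by (auto simp: couplings_def)
    have "integrable P (\<lambda>z. \<phi> (fst z))" "integrable P (\<lambda>z. \<psi> (snd z))" "integrable P C"
      by (rule P.integrable_const_bound[where B=p] P.integrable_const_bound[where B=q]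
          P.integrable_const_bound[where B=c];
        use \<phi>_bound \<psi>_bound C_bound in \<open>auto\<close>)+
    then have "(\<integral>z. h z \<partial>P) =
      (\<integral>z. \<phi> (fst z) \<partial>P) + (\<integral>z. \<psi> (snd z) \<partial>P) - (\<integral>z. C z \<partial>P) / \<epsilon>"
      unfolding h_def by simp
    also have "(\<integral>z. \<phi> (fst z) \<partial>P) = (\<integral>x. \<phi> x \<partial>distr P \<mu> fst)"
      by (subst integral_distr) auto
    also have "(\<integral>z. \<psi> (snd z) \<partial>P) = (\<integral>x. \<psi> x \<partial>distr P \<mu> snd)"
      by (subst integral_distr) auto
    finally show ?thesis by (simp add: d k_def)
  qed
  have cost_R: "entropic_cost C \<mu> \<epsilon> R = ereal (\<epsilon> * k)"
    using gibbs_density[OF MP h h_bound R_h RP] int_h[OF R] \<epsilon>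
    by (simp add: entropic_cost_def KL_def right_diff_distrib)
  have lower: "ereal (\<epsilon> * k) \<le> entropic_cost C \<mu> \<epsilon> P"
    and eq: "entropic_cost C \<mu> \<epsilon> P = ereal (\<epsilon> * k) \<Longrightarrow> P = R" if P: "P \<in> couplings \<mu> \<mu>" for P
  proof -
    have sP: "sets P = sets ?M" using P by (auto simp: couplings_def)
    have PP: "prob_space P" using prob_space_coupling[OF \<mu> P] .
    have "ereal (\<epsilon> * k) \<le> entropic_cost C \<mu> \<epsilon> P \<and> (entropic_cost C \<mu> \<epsilon> P = ereal (\<epsilon> * k) \<longrightarrow> P = R)"
    proof (cases "absolutely_continuous ?M P \<and> integrable P (entropy_density (exp 1) ?M P)")
      case True
      then have cost: "entropic_cost C \<mu> \<epsilon> P =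
          ereal ((\<integral>z. C z \<partial>P) + \<epsilon> * KL_divergence (exp 1) ?M P)"
        by (simp add: entropic_cost_def KL_def)
      have "k - (\<integral>z. C z \<partial>P) / \<epsilon> \<le> KL_divergence (exp 1) ?M P"
        using var(1)[OF PP sP] True int_h[OF P] by simp
      then have le: "\<epsilon> * (k - (\<integral>z. C z \<partial>P) / \<epsilon>) \<le> \<epsilon> * KL_divergence (exp 1) ?M P"
        using \<epsilon> by (intro mult_left_mono) auto
      have "P = R" if "(\<integral>z. C z \<partial>P) + \<epsilon> * KL_divergence (exp 1) ?M P = \<epsilon> * k"
      proof -
        have "KL_divergence (exp 1) ?M P = k - (\<integral>z. C z \<partial>P) / \<epsilon>"
          using that \<epsilon> by (simp add: field_simps)
        then show ?thesis using var(2)[OF PP sP] True int_h[OF P] by simp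
      qed
      then show ?thesis using le \<epsilon> by (auto simp: cost algebra_simps)
    qed (use \<epsilon> in \<open>auto simp: entropic_cost_def KL_def\<close>)
    then show "ereal (\<epsilon> * k) \<le> entropic_cost C \<mu> \<epsilon> P"
      and "entropic_cost C \<mu> \<epsilon> P = ereal (\<epsilon> * k) \<Longrightarrow> P = R" by auto
  qed
  show ?thesis unfolding entropic_minimiser_def
  proof (rule the_equality)
    show "is_arg_min (entropic_cost C \<mu> \<epsilon>) (\<lambda>P. P \<in> couplings \<mu> \<mu>) R"
      using R lower by (auto simp: is_arg_min_def cost_R not_less)
    fix P assume "is_arg_min (entropic_cost C \<mu> \<epsilon>) (\<lambda>P. P \<in> couplings \<mu> \<mu>) P"
    then have "P \<in> couplings \<mu> \<mu>" "entropic_cost C \<mu> \<epsilon> P \<le> ereal (\<epsilon> * k)"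
      using R by (auto simp: is_arg_min_def not_less simp flip: cost_R)
    then show "P = R" using lower eq by (meson antisym)
  qed
qed

section \<open>Cylinders and the topology of the Cantor group\<close>

definition cyl :: "nat \<Rightarrow> cantor \<Rightarrow> cantor set" where
  "cyl n c = {t. \<forall>k<n. t k = c k}"

text \<open>The empty set is added so that the family is closed under intersections.\<close>

definition cylinders :: "cantor set set" where
  "cylinders = insert {} {cyl n c | n c. True}"

abbreviation (input) cantor_top :: "cantor topology" where
  "cantor_top \<equiv> mtopology_of cantor_metric"

abbreviation (input) cantor_top2 :: "(cantor \<times> cantor) topology" where
  "cantor_top2 \<equiv> prod_topology cantor_top cantor_top"

lemma UNIV_bit: "(UNIV :: bit set) = {0, 1}"
  by (auto intro: bit.exhaust)

lemma finite_UNIV_bit [simp]: "finite (UNIV :: bit set)"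
  by (simp add: UNIV_bit)

lemma bit_add_self [simp]: "(b :: bit) + b = 0"
  by (cases b) simp_all

lemma bit_add_eq_iff: "(a :: bit) + b = c \<longleftrightarrow> a = c + b"
  by (cases a; cases b; cases c) simp_all

lemma cantor_add_self [simp]: "(s :: cantor) + s = 0"
  by (simp add: fun_eq_iff)

lemma cantor_diff_eq_add: "(s :: cantor) - t = t + s"
  by (simp add: fun_eq_iff add.commute)

lemma cantor_add_add [simp]: "(s :: cantor) + (s + t) = t"
  by (simp flip: add.assoc)

lemma cyl_self [simp]: "c \<in> cyl n c"
  by (simp add: cyl_def)

lemma cyl_0 [simp]: "cyl 0 c = UNIV"
  by (simp add: cyl_def)

lemma cyl_eq: "x \<in> cyl n c \<Longrightarrow> cyl n x = cyl n c"
  by (auto simp: cyl_def)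

lemma cyl_mono: "m \<le> n \<Longrightarrow> cyl n c \<subseteq> cyl m c"
  by (auto simp: cyl_def)

lemma Int_stable_cylinders: "Int_stable cylinders"
proof (rule Int_stableI)
  fix A B assume AB: "A \<in> cylinders" "B \<in> cylinders"
  show "A \<inter> B \<in> cylinders"
  proof (cases "A \<inter> B = {}")
    case False
    then obtain x where x: "x \<in> A" "x \<in> B" by auto
    obtain m c n d where *: "A = cyl m c" "B = cyl n d"
      using AB x by (auto simp: cylinders_def)
    then have "A \<inter> B = cyl (max m n) x"
      using x by (auto simp: cyl_def max_def split: if_splits)
    then show ?thesis unfolding cylinders_def by blast
  qed (simp add: cylinders_def)
qed

lemma countable_cylinders: "countable cylinders"
proof -
  have "{cyl n c | n c. True} \<subseteq> (\<lambda>xs. {t. map t [0..<length xs] = xs}) ` lists UNIV"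
  proof safe
    fix n c
    have "cyl n c = {t. map t [0..<length (map c [0..<n])] = map c [0..<n]}"
      by (auto simp: cyl_def)
    then show "cyl n c \<in> (\<lambda>xs. {t. map t [0..<length xs] = xs}) ` lists UNIV"
      by blast
  qed
  moreover have "countable (lists (UNIV :: bit set))"
    by (intro countable_lists countable_finite) simp
  ultimately show ?thesis
    unfolding cylinders_def by (meson countable_image countable_insert countable_subset)
qed

text \<open>The closed ball of radius \<open>2\<close> to the power \<open>-(n+1)\<close> is the cylinder of the first \<open>n\<close> coordinates, so
topological questions become questions about cylinders.\<close>

lemma openin_cantor: "openin cantor_top U \<longleftrightarrow> (\<forall>x\<in>U. \<exists>n. cyl n x \<subseteq> U)"
proof -
  interpret Metric_space UNIV cantor_dist by (rule Metric_space_cantor)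
  have top: "cantor_top = mtopology"
    by (simp add: cantor_metric_def mtopology_of)
  have mcball: "mcball x ((1/2) ^ Suc n) = cyl n x" for x n
  proof -
    have "(\<forall>k. 1 \<le> k \<and> k < Suc n \<longrightarrow> coord x k = coord y k) \<longleftrightarrow> (\<forall>k<n. y k = x k)" for y
    proof safe
      fix k assume *: "\<forall>k. 1 \<le> k \<and> k < Suc n \<longrightarrow> coord x k = coord y k" "k < n"
      from *(1)[rule_format, of "Suc k"] *(2) show "y k = x k" by (simp add: coord_def)
    qed (auto simp: coord_def)
    then show ?thesis unfolding mcball_def cantor_dist_le cyl_def by auto
  qed
  show ?thesis unfolding top openin_mtopology_mcball
  proof safe
    fix x assume "x \<in> U" "\<forall>x. x \<in> U \<longrightarrow> (\<exists>r>0. mcball x r \<subseteq> U)"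
    then obtain r where r: "0 < r" "mcball x r \<subseteq> U" by blast
    obtain n where n: "(1/2 :: real) ^ n < r"
      using real_arch_pow_inv[OF r(1), of "1/2"] by auto
    have "(1/2 :: real) ^ Suc n \<le> r" using n r(1) unfolding power_Suc by linarith
    then have "cyl n x \<subseteq> mcball x r" unfolding mcball[symmetric]
      by (rule mcball_subset_concentric)
    then show "\<exists>n. cyl n x \<subseteq> U" using r by blast
  next
    fix x assume "x \<in> U" "\<forall>x\<in>U. \<exists>n. cyl n x \<subseteq> U"
    then obtain n where "cyl n x \<subseteq> U" by blast
    then show "\<exists>r>0. mcball x r \<subseteq> U"
      unfolding mcball[symmetric] by (intro exI[of _ "(1/2) ^ Suc n"]) simp
  qed auto
qed

lemma topspace_cantor [simp]: "topspace cantor_top = UNIV"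
  by simp

lemma openin_cyl: "openin cantor_top (cyl n c)"
  unfolding openin_cantor using cyl_eq by blast

lemma openin_Compl_cyl: "openin cantor_top (- cyl n c)"
  unfolding openin_cantor
proof (intro ballI)
  fix x assume "x \<in> - cyl n c"
  then have "cyl n x \<subseteq> - cyl n c"
    by (auto simp: cyl_def)
  then show "\<exists>m. cyl m x \<subseteq> - cyl n c" by blast
qed

lemma openin_cantor2:
  "openin cantor_top2 U \<longleftrightarrow> (\<forall>(x, y)\<in>U. \<exists>n. cyl n x \<times> cyl n y \<subseteq> U)"
proof
  assume U: "openin cantor_top2 U"
  have "\<exists>n. cyl n x \<times> cyl n y \<subseteq> U" if xy: "(x, y) \<in> U" for x y
  proof -
    obtain V W where VW: "openin cantor_top V" "openin cantor_top W" "x \<in> V" "y \<in> W" "V \<times> W \<subseteq> U"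
      using U[unfolded openin_prod_topology_alt, rule_format, OF xy] by metis
    obtain m n where mn: "cyl m x \<subseteq> V" "cyl n y \<subseteq> W"
      using VW(1-4) unfolding openin_cantor by metis
    have "cyl (max m n) x \<subseteq> V" "cyl (max m n) y \<subseteq> W"
      using mn cyl_mono[of m "max m n" x] cyl_mono[of n "max m n" y] by auto
    then show ?thesis using VW(5) by (intro exI[of _ "max m n"]) (meson Sigma_mono subset_trans)
  qed
  then show "\<forall>(x, y)\<in>U. \<exists>n. cyl n x \<times> cyl n y \<subseteq> U" by auto
next
  assume U: "\<forall>(x, y)\<in>U. \<exists>n. cyl n x \<times> cyl n y \<subseteq> U"
  show "openin cantor_top2 U"
    unfolding openin_prod_topology_alt
  proof (intro allI impI)
    fix x y assume "(x, y) \<in> U"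
    then obtain n where "cyl n x \<times> cyl n y \<subseteq> U" using U by auto
    then show "\<exists>V W. openin cantor_top V \<and> openin cantor_top W \<and> x \<in> V \<and> y \<in> W \<and> V \<times> W \<subseteq> U"
      by (intro exI[of _ "cyl n x"] exI[of _ "cyl n y"]) (simp add: openin_cyl)
  qed
qed

lemma open_is_countable_Union:
  assumes "openin cantor_top U"
  shows "\<exists>\<C>. countable \<C> \<and> \<C> \<subseteq> cylinders \<and> U = \<Union>\<C>"
proof (intro exI conjI)
  show "countable {A \<in> cylinders. A \<subseteq> U}"
    using countable_cylinders by (rule countable_subset[rotated]) auto
  have "x \<in> \<Union>{A \<in> cylinders. A \<subseteq> U}" if x: "x \<in> U" for x
  proof -
    obtain n where "cyl n x \<subseteq> U" using assms x unfolding openin_cantor by blast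
    moreover have "cyl n x \<in> cylinders" by (auto simp: cylinders_def)
    ultimately show ?thesis using cyl_self by blast
  qed
  then show "U = \<Union>{A \<in> cylinders. A \<subseteq> U}" by blast
qed auto

lemma open2_is_countable_Union:
  assumes "openin cantor_top2 U"
  shows "\<exists>\<C>. countable \<C> \<and> \<C> \<subseteq> cylinders \<times> cylinders \<and> U = (\<Union>(A, B)\<in>\<C>. A \<times> B)"
proof (intro exI conjI)
  let ?C = "{(A, B) \<in> cylinders \<times> cylinders. A \<times> B \<subseteq> U}"
  show "countable ?C"
    using countable_SIGMA[OF countable_cylinders, of "\<lambda>_. cylinders"] countable_cylinders
    by (rule_tac countable_subset[of _ "cylinders \<times> cylinders"]) auto
  have "z \<in> (\<Union>(A, B)\<in>?C. A \<times> B)" if z: "z \<in> U" for z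
  proof -
    obtain n where "cyl n (fst z) \<times> cyl n (snd z) \<subseteq> U"
      using assms z unfolding openin_cantor2 by (cases z) auto
    moreover have "cyl n c \<in> cylinders" for c by (auto simp: cylinders_def)
    moreover have "z \<in> cyl n (fst z) \<times> cyl n (snd z)" by (cases z) simp
    ultimately show ?thesis by blast
  qed
  then show "U = (\<Union>(A, B)\<in>?C. A \<times> B)" by blast
qed auto

text \<open>Every metrically open set is open in the product of discrete topologies, which is compact by
Tychonoff's theorem; compactness passes to the coarser topology.\<close>

lemma compact_space_cantor: "compact_space cantor_top"
proof -
  let ?P = "product_topology (\<lambda>_. discrete_topology (UNIV :: bit set)) (UNIV :: nat set)"
  have "compact_space ?P"
    unfolding compact_space_product_topology by (simp add: compact_space_discrete_topology)
  moreover have finer: "openin ?P U" if U: "openin cantor_top U" for U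
    unfolding openin_product_topology_alt
  proof (intro ballI)
    fix x assume "x \<in> U"
    then obtain n where n: "cyl n x \<subseteq> U" using U unfolding openin_cantor by auto
    define V where "V k = (if k < n then {x k} else UNIV)" for k
    have "finite {k. V k \<noteq> UNIV}"
      by (rule finite_subset[of _ "{..<n}"]) (auto simp: V_def)
    moreover have "x \<in> Pi\<^sub>E UNIV V"
      by (simp add: V_def PiE_iff)
    moreover have "Pi\<^sub>E UNIV V \<subseteq> cyl n x"
    proof
      fix y assume y: "y \<in> Pi\<^sub>E UNIV V"
      have "y k = x k" if "k < n" for k
        using PiE_mem[OF y, of k] that by (simp add: V_def)
      then show "y \<in> cyl n x" by (simp add: cyl_def)
    qed
    ultimately show "\<exists>V. finite {i \<in> UNIV. V i \<noteq> topspace (discrete_topology UNIV)} \<and>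
        (\<forall>i\<in>UNIV. openin (discrete_topology UNIV) (V i)) \<and> x \<in> Pi\<^sub>E UNIV V \<and> Pi\<^sub>E UNIV V \<subseteq> U"
      using n by (intro exI[of _ V] conjI) (simp_all add: subset_trans[OF _ n])
  qed
  moreover have top: "topspace ?P = UNIV"
    unfolding topspace_product_topology by simp
  ultimately have cpt: "\<forall>\<U>. (\<forall>U\<in>\<U>. openin ?P U) \<and> UNIV \<subseteq> \<Union>\<U> \<longrightarrow>
      (\<exists>\<F>. finite \<F> \<and> \<F> \<subseteq> \<U> \<and> UNIV \<subseteq> \<Union>\<F>)"
    unfolding compact_space_alt by (simp only: top)
  show ?thesis
    unfolding compact_space_alt topspace_cantor
  proof (intro allI impI)
    fix \<U> assume "(\<forall>U\<in>\<U>. openin cantor_top U) \<and> UNIV \<subseteq> \<Union>\<U>"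
    then show "\<exists>\<F>. finite \<F> \<and> \<F> \<subseteq> \<U> \<and> UNIV \<subseteq> \<Union>\<F>"
      using finer by (intro cpt[rule_format]) blast
  qed
qed

section \<open>Haar measure\<close>

lemma space_haar [simp]: "space haar = UNIV"
  by (simp add: haar_def space_PiM space_uniform_count_measure)

lemma product_prob_space_haar:
  "product_prob_space (\<lambda>_ :: nat. uniform_count_measure (UNIV :: bit set))"
proof -
  interpret prob_space "uniform_count_measure (UNIV :: bit set)"
    by (rule prob_space_uniform_count_measure) auto
  show ?thesis ..
qed

lemma prob_space_haar: "prob_space haar"
  unfolding haar_def
  by (rule prob_space_PiM, rule prob_space_uniform_count_measure) auto

interpretation haar: prob_space haar by (rule prob_space_haar)
interpretation haar2: pair_prob_space haar haar by unfold_locales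

lemma measurable_haar_coord [measurable]: "(\<lambda>t. t k) \<in> measurable haar (count_space UNIV)"
proof -
  have "(\<lambda>t. t k) \<in> measurable haar (uniform_count_measure (UNIV :: bit set))"
    unfolding haar_def by (rule measurable_component_singleton) simp
  then show ?thesis
    by (simp only: measurable_cong_sets[OF refl sets_uniform_count_measure_count_space])
qed

lemma measurable_haarI:
  assumes "\<And>k. (\<lambda>x. f x k) \<in> measurable M (count_space UNIV)"
  shows "f \<in> measurable M haar"
proof -
  have "(\<lambda>x k. f x k) \<in> measurable M haar" unfolding haar_def
  proof (rule measurable_PiM_single')
    fix k show "(\<lambda>x. f x k) \<in> measurable M (uniform_count_measure (UNIV :: bit set))"
      using assms[of k]
      by (simp only: measurable_cong_sets[OF refl sets_uniform_count_measure_count_space])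
  qed (simp add: space_uniform_count_measure)
  then show ?thesis by simp
qed

lemma emeasure_uniform_bit: "emeasure (uniform_count_measure (UNIV :: bit set)) {b} = ennreal (1/2)"
proof -
  have "card (UNIV :: bit set) = 2" by (simp add: UNIV_bit)
  then show ?thesis by (subst emeasure_uniform_count_measure) simp_all
qed

lemma emeasure_cyl: "emeasure haar (cyl n c) = ennreal ((1/2) ^ n)"
proof -
  interpret product_prob_space "\<lambda>_ :: nat. uniform_count_measure (UNIV :: bit set)" UNIV
    by (rule product_prob_space_haar)
  have "emeasure haar {t \<in> space haar. \<forall>k\<in>{..<n}. t k \<in> {c k}} =
      (\<Prod>k\<in>{..<n}. emeasure (uniform_count_measure (UNIV :: bit set)) {c k})"
    unfolding haar_def by (rule emeasure_PiM_Collect) (auto simp: sets_uniform_count_measure)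
  also have "\<dots> = (\<Prod>k\<in>{..<n}. ennreal (1/2))"
    by (intro prod.cong refl emeasure_uniform_bit)
  also have "\<dots> = ennreal ((1/2) ^ n)"
    by (simp only: prod_constant card_lessThan) (rule ennreal_power, simp)
  finally show ?thesis by (simp add: cyl_def Ball_def)
qed

lemma measure_cyl: "measure haar (cyl n c) = (1/2) ^ n"
  by (simp add: measure_def emeasure_cyl)

lemma sets_cyl [measurable]: "cyl n c \<in> sets haar"
proof -
  have "cyl n c = {t \<in> space haar. \<forall>k<n. t k = c k}" by (simp add: cyl_def)
  also have "\<dots> \<in> sets haar" by measurable
  finally show ?thesis .
qed

lemma cylinders_sets: "cylinders \<subseteq> sets haar"
  by (auto simp: cylinders_def)

lemma openin_cantor_sets: "openin cantor_top U \<Longrightarrow> U \<in> sets haar"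
  using open_is_countable_Union[of U] cylinders_sets
  by (auto intro!: sets.countable_Union)

lemma sets_haar: "sets haar = sigma_sets UNIV cylinders"
proof
  show "sigma_sets UNIV cylinders \<subseteq> sets haar"
    using sets.sigma_sets_subset[OF cylinders_sets] by simp
  have sp: "space (sigma UNIV cylinders) = UNIV" "sets (sigma UNIV cylinders) = sigma_sets UNIV cylinders"
    by auto
  have "(\<lambda>t. t) \<in> measurable (sigma UNIV cylinders) haar"
  proof (rule measurable_haarI)
    fix k
    have "(\<lambda>t :: cantor. t k) -` {b} \<in> sets (sigma UNIV cylinders)" for b
    proof -
      have "openin cantor_top ((\<lambda>t. t k) -` {b})" unfolding openin_cantor
      proof (intro ballI)
        fix x :: cantor assume "x \<in> (\<lambda>t. t k) -` {b}"
        then have "cyl (Suc k) x \<subseteq> (\<lambda>t. t k) -` {b}" by (auto simp: cyl_def)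
        then show "\<exists>n. cyl n x \<subseteq> (\<lambda>t. t k) -` {b}" by blast
      qed
      then obtain \<C> where \<C>: "countable \<C>" "\<C> \<subseteq> cylinders" "(\<lambda>t. t k) -` {b} = \<Union>\<C>"
        by (metis open_is_countable_Union)
      have "\<C> \<subseteq> sets (sigma UNIV cylinders)"
        unfolding sp using \<C>(2) sigma_sets.Basic by (metis subset_iff)
      then show ?thesis unfolding \<C>(3) by (rule sets.countable_Union[OF \<C>(1)])
    qed
    then show "(\<lambda>t :: cantor. t k) \<in> measurable (sigma UNIV cylinders) (count_space UNIV)"
      by (subst measurable_count_space_eq2) (simp_all only: sp finite_UNIV_bit, simp_all)
  qed
  from measurable_sets[OF this] show "sets haar \<subseteq> sigma_sets UNIV cylinders"
    unfolding sp vimage_ident Int_UNIV_right by (rule subsetI)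
qed

lemma sets_borel_of: "sets (borel_of T) = sigma_sets (topspace T) {U. openin T U}"
  unfolding borel_of_def by (rule sets_measure_of) (auto dest: openin_subset)

lemma sets_haar_borel: "sets haar = sets (borel_of cantor_top)"
  unfolding sets_borel_of
proof
  show "sets haar \<subseteq> sigma_sets (topspace cantor_top) {U. openin cantor_top U}"
    unfolding sets_haar topspace_cantor
    by (rule sigma_sets_mono') (auto simp: cylinders_def openin_cyl)
  show "sigma_sets (topspace cantor_top) {U. openin cantor_top U} \<subseteq> sets haar"
    using sets.sigma_sets_subset[of "{U. openin cantor_top U}" haar] openin_cantor_sets by auto
qed

definition rectangles :: "(cantor \<times> cantor) set set" where
  "rectangles = {A \<times> B | A B. A \<in> cylinders \<and> B \<in> cylinders}"

lemma Int_stable_rectangles: "Int_stable rectangles"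
  unfolding rectangles_def
  using Int_stable_cylinders by (intro Int_stableI) (auto simp: Times_Int_Times Int_stable_def, blast)

lemma UNIV_cylinders: "UNIV \<in> cylinders"
  unfolding cylinders_def using cyl_0 by blast

lemma UNIV_rectangles: "UNIV \<in> rectangles"
  unfolding rectangles_def using UNIV_cylinders UNIV_Times_UNIV by blast

lemma sets_haar2: "sets (haar \<Otimes>\<^sub>M haar) = sigma_sets UNIV rectangles"
proof -
  have "sets (sigma UNIV cylinders \<Otimes>\<^sub>M sigma UNIV cylinders) =
      sets (sigma (UNIV \<times> UNIV) rectangles)"
    unfolding rectangles_def
    by (subst sets_pair_eq[where Ea = cylinders and Eb = cylinders and Ca = "{UNIV}" and Cb = "{UNIV}"])
      (auto simp: UNIV_cylinders intro: arg_cong)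
  also have "sets (sigma UNIV cylinders \<Otimes>\<^sub>M sigma UNIV cylinders) = sets (haar \<Otimes>\<^sub>M haar)"
    by (intro sets_pair_measure_cong) (auto simp: sets_haar)
  finally show ?thesis by simp
qed

lemma openin_cantor2_sets:
  assumes "openin cantor_top2 U" shows "U \<in> sets (haar \<Otimes>\<^sub>M haar)"
proof -
  obtain \<C> where \<C>: "countable \<C>" "\<C> \<subseteq> cylinders \<times> cylinders" "U = (\<Union>(A, B)\<in>\<C>. A \<times> B)"
    using open2_is_countable_Union[OF assms] by blast
  show ?thesis unfolding \<C>(3)
    using \<C>(1,2) cylinders_sets by (intro sets.countable_UN') (auto intro!: pair_measureI)
qed

lemma sets_haar2_borel: "sets (haar \<Otimes>\<^sub>M haar) = sets (borel_of cantor_top2)"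
  unfolding sets_borel_of
proof
  show "sets (haar \<Otimes>\<^sub>M haar) \<subseteq> sigma_sets (topspace cantor_top2) {U. openin cantor_top2 U}"
    unfolding sets_haar2 topspace_prod_topology topspace_cantor UNIV_Times_UNIV
    by (rule sigma_sets_mono')
      (auto simp: cylinders_def rectangles_def openin_cyl openin_prod_Times_iff)
  show "sigma_sets (topspace cantor_top2) {U. openin cantor_top2 U} \<subseteq> sets (haar \<Otimes>\<^sub>M haar)"
    using sets.sigma_sets_subset[of "{U. openin cantor_top2 U}" "haar \<Otimes>\<^sub>M haar"] openin_cantor2_sets
    by (auto simp: space_pair_measure)
qed

lemma continuous_measurable_cantor:
  assumes "continuous_map cantor_top euclideanreal f" shows "f \<in> borel_measurable haar"
proof (rule borel_measurableI)
  fix S :: "real set" assume "open S"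
  then have "openin cantor_top {x \<in> topspace cantor_top. f x \<in> S}"
    by (intro openin_continuous_map_preimage[OF assms]) auto
  then show "f -` S \<inter> space haar \<in> sets haar"
    using openin_cantor_sets by (simp add: vimage_def)
qed

lemma continuous_measurable_cantor2:
  assumes "continuous_map cantor_top2 euclideanreal f"
  shows "f \<in> borel_measurable (haar \<Otimes>\<^sub>M haar)"
proof (rule borel_measurableI)
  fix S :: "real set" assume "open S"
  then have "openin cantor_top2 {x \<in> topspace cantor_top2. f x \<in> S}"
    by (intro openin_continuous_map_preimage[OF assms]) auto
  then show "f -` S \<inter> space (haar \<Otimes>\<^sub>M haar) \<in> sets (haar \<Otimes>\<^sub>M haar)"
    using openin_cantor2_sets by (simp add: vimage_def space_pair_measure)
qed

lemma measurable_haar_add [measurable (raw)]: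
  assumes [measurable]: "f \<in> measurable M haar" "g \<in> measurable M haar"
  shows "(\<lambda>x. f x + g x) \<in> measurable M haar"
  by (rule measurable_haarI) (simp, measurable)

lemma measurable_haar_diff [measurable (raw)]:
  assumes [measurable]: "f \<in> measurable M haar" "g \<in> measurable M haar"
  shows "(\<lambda>x. f x - g x) \<in> measurable M haar"
  unfolding cantor_diff_eq_add by measurable

text \<open>A translation permutes the cylinders of each length, and these all have the same mass.\<close>

lemma haar_translate: "distr haar haar (\<lambda>x. x + t) = haar"
proof (rule measure_eqI_generator_eq[OF Int_stable_cylinders, where \<Omega> = UNIV and A = "\<lambda>_. UNIV"])
  fix X assume "X \<in> cylinders"
  moreover have "emeasure (distr haar haar (\<lambda>x. x + t)) (cyl n c) = emeasure haar (cyl n c)" for n c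
  proof -
    have "(\<lambda>x. x + t) -` cyl n c = cyl n (c + t)"
      by (auto simp: cyl_def bit_add_eq_iff)
    then show ?thesis by (simp add: emeasure_distr emeasure_cyl)
  qed
  ultimately show "emeasure (distr haar haar (\<lambda>x. x + t)) X = emeasure haar X"
    by (auto simp: cylinders_def)
qed (auto simp: sets_haar UNIV_cylinders emeasure_distr haar.emeasure_eq_measure)

lemma null_singleton_haar: "{c} \<in> null_sets haar"
proof -
  have "{c} = (\<Inter>n. cyl n c)" by (auto simp: cyl_def fun_eq_iff)
  then have s: "{c} \<in> sets haar" by auto
  have "measure haar {c} \<le> (1/2) ^ n" for n
    using haar.finite_measure_mono[of "{c}" "cyl n c"] by (simp add: measure_cyl)
  moreover have "(\<lambda>n. (1/2 :: real) ^ n) \<longlonglongrightarrow> 0" by (rule LIMSEQ_realpow_zero) auto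
  ultimately have "measure haar {c} \<le> 0" by (meson LIMSEQ_le_const)
  then show ?thesis using s
    by (auto simp: null_sets_def haar.emeasure_eq_measure measure_le_0_iff)
qed

text \<open>If a set \<open>A\<close> had no proper part of intermediate measure, then for each \<open>k\<close> one of its two halves given by
the \<open>k\<close>-th coordinate would be null; what survives the removal of all these halves is at most one
point, which is null too.\<close>

lemma atomless_haar: "atomless haar"
  unfolding atomless_def
proof (intro ballI impI, rule ccontr)
  fix A assume A [measurable]: "A \<in> sets haar" and pos: "0 < emeasure haar A"
    and no: "\<not> (\<exists>B\<in>sets haar. B \<subseteq> A \<and> 0 < emeasure haar B \<and> emeasure haar B < emeasure haar A)"
  let ?H = "\<lambda>k b. {t \<in> A. t k = b}"
  have H [measurable]: "?H k b \<in> sets haar" for k b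
  proof -
    have "{t \<in> space haar. t \<in> A \<and> t k = b} \<in> sets haar" by measurable
    then show ?thesis by simp
  qed
  have "\<exists>b. measure haar (?H k b) = 0" for k
  proof (rule ccontr)
    assume "\<nexists>b. measure haar (?H k b) = 0"
    then have p: "0 < measure haar (?H k b)" for b by (simp add: zero_less_measure_iff)
    have H01: "?H k 0 \<union> ?H k 1 = A" "?H k 0 \<inter> ?H k 1 = {}" by auto
    have "measure haar A = measure haar (?H k 0) + measure haar (?H k 1)"
      using haar.finite_measure_Union[OF H H H01(2)] unfolding H01(1) .
    then have "measure haar (?H k 0) < measure haar A" using p[of 1] by simp
    then have "emeasure haar (?H k 0) < emeasure haar A" "0 < emeasure haar (?H k 0)"
      using p[of 0] by (simp_all add: haar.emeasure_eq_measure ennreal_less_iff)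
    moreover have "?H k 0 \<subseteq> A" by auto
    ultimately show False using no H[of k 0] by blast
  qed
  then obtain b where b: "\<And>k. measure haar (?H k (b k)) = 0" by metis
  let ?c = "\<lambda>k. b k + 1"
  have "A \<subseteq> {?c} \<union> (\<Union>k. ?H k (b k))"
  proof
    fix t assume "t \<in> A"
    have "t = ?c" if "\<forall>k. t k \<noteq> b k"
    proof
      fix k show "t k = b k + 1" using that[rule_format, of k] by (cases "t k"; cases "b k") auto
    qed
    then show "t \<in> {?c} \<union> (\<Union>k. ?H k (b k))" using \<open>t \<in> A\<close> by auto
  qed
  moreover have "{?c} \<union> (\<Union>k. ?H k (b k)) \<in> null_sets haar"
    using b null_singleton_haar
    by (intro null_sets.Un null_sets_UN) (auto simp: null_sets_def haar.emeasure_eq_measure)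
  ultimately have "A \<in> null_sets haar" using null_sets_subset A by blast
  then show False using pos by (auto simp: null_sets_def)
qed

lemma haar_prob_measure: "haar \<in> prob_measures cantor_top"
  by (simp add: prob_measures_def prob_space_haar sets_haar_borel)

section \<open>Weak limits tested on clopen sets\<close>

lemma continuous_map_indicator:
  assumes "openin T A" "openin T (topspace T - A)"
  shows "continuous_map T euclideanreal (indicator A)"
  unfolding continuous_map
proof (intro conjI allI impI)
  fix U :: "real set"
  have "A \<subseteq> topspace T" using openin_subset[OF assms(1)] .
  then have "{x \<in> topspace T. indicator A x \<in> U} =
     (if (1 :: real) \<in> U then A else {}) \<union> (if (0 :: real) \<in> U then topspace T - A else {})"
    by (auto simp: indicator_def)
  moreover have "openin T (if (1 :: real) \<in> U then A else {})"
    "openin T (if (0 :: real) \<in> U then topspace T - A else {})"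
    using assms by (simp_all only: openin_empty split: if_split) simp_all
  ultimately show "openin T {x \<in> topspace T. indicator A x \<in> U}"
    by (simp only: openin_Un)
qed simp

lemma weak_limitD:
  assumes "weak_limit T z Q F" "continuous_map T euclideanreal f" "bounded (f ` topspace T)"
  shows "((\<lambda>i. \<integral>x. f x \<partial>(z i)) \<longlongrightarrow> (\<integral>x. f x \<partial>Q)) F"
  using assms by (simp add: weak_limit_def)

text \<open>The indicator of a clopen set is continuous, hence an admissible test function.\<close>

lemma weak_limit_clopen:
  assumes "weak_limit T z Q F" "openin T A" "openin T (topspace T - A)"
  shows "((\<lambda>i. \<integral>x. indicator A x \<partial>(z i)) \<longlongrightarrow> measure Q A) F"
proof -
  have bdd: "bounded (indicator A ` topspace T :: real set)"
    by (rule bounded_subset[of "{0, 1}"]) (auto simp: indicator_def)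
  have sQ: "sets Q = sigma_sets (topspace T) {U. openin T U}"
    using assms(1) unfolding weak_limit_def prob_measures_def sets_borel_of by simp
  have "((\<lambda>i. \<integral>x. indicator A x \<partial>(z i)) \<longlongrightarrow> (\<integral>x. indicator A x \<partial>Q :: real)) F"
    by (rule weak_limitD[OF assms(1) continuous_map_indicator[OF assms(2,3)] bdd])
  moreover have "A \<in> sets Q"
    unfolding sQ using assms(2) by (intro sigma_sets.Basic) simp
  ultimately show ?thesis using sets.sets_into_space[of A Q] by (simp add: Int_absorb2)
qed

lemma clopen_rectangle:
  assumes "A \<in> rectangles" shows "openin cantor_top2 A" "openin cantor_top2 (- A)"
proof -
  obtain B C where BC: "A = B \<times> C" "B \<in> cylinders" "C \<in> cylinders"
    using assms by (auto simp: rectangles_def)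
  have o: "openin cantor_top D" "openin cantor_top (- D)" if "D \<in> cylinders" for D
    using that openin_cyl openin_Compl_cyl openin_topspace[of cantor_top]
    unfolding cylinders_def topspace_cantor by auto
  show "openin cantor_top2 A" unfolding BC(1) using o BC by (simp add: openin_prod_Times_iff)
  have "- A = (- B) \<times> UNIV \<union> UNIV \<times> (- C)" unfolding BC(1) by auto
  moreover have "openin cantor_top2 ((- B) \<times> UNIV)" "openin cantor_top2 (UNIV \<times> (- C))"
    using o BC(2,3) openin_topspace[of cantor_top]
    unfolding openin_prod_Times_iff topspace_cantor by simp_all
  ultimately show "openin cantor_top2 (- A)" by (metis openin_Un)
qed

text \<open>Rectangles of cylinders are clopen, so their masses are determined by the limit, and they form an
intersection-stable generator of the Borel sets.\<close>

lemma weak_limit_unique_cantor2: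
  assumes Q: "weak_limit cantor_top2 z Q F" and Q': "weak_limit cantor_top2 z Q' F" and F: "F \<noteq> bot"
  shows "Q = Q'"
proof (rule measure_eqI_generator_eq[OF Int_stable_rectangles, where \<Omega> = UNIV and A = "\<lambda>_. UNIV"])
  have pr: "prob_space Q" "prob_space Q'" and
    se: "sets Q = sigma_sets UNIV rectangles" "sets Q' = sigma_sets UNIV rectangles"
    using Q Q' by (auto simp: weak_limit_def prob_measures_def simp flip: sets_haar2_borel sets_haar2)
  interpret Q: prob_space Q by fact
  interpret Q': prob_space Q' by fact
  show "sets Q = sigma_sets UNIV rectangles" "sets Q' = sigma_sets UNIV rectangles" by fact+
  show "emeasure Q UNIV \<noteq> \<infinity>" by (simp add: Q.emeasure_eq_measure)
  fix X assume "X \<in> rectangles"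
  then have X: "openin cantor_top2 X" "openin cantor_top2 (topspace cantor_top2 - X)"
    using clopen_rectangle by (auto simp: Compl_eq_Diff_UNIV)
  have "measure Q X = measure Q' X"
    using tendsto_unique[OF F weak_limit_clopen[OF Q X] weak_limit_clopen[OF Q' X]] .
  then show "emeasure Q X = emeasure Q' X"
    by (simp add: Q.emeasure_eq_measure Q'.emeasure_eq_measure)
qed (use UNIV_rectangles in auto)

section \<open>The profile and the cost\<close>

text \<open>The zero of the profile in the half \<open>{t. t 0 = i}\<close> (coordinates are counted from 0 from here on): \<open>0\<close> for
\<open>i = 0\<close> and \<open>t0\<close> for \<open>i = 1\<close>. The cylinders \<open>cyl n (point i)\<close> shrink to it.\<close>

definition point :: "bit \<Rightarrow> cantor" where
  "point i = (\<lambda>k. if k = 0 then i else 0)"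

text \<open>The constant value of the profile on the shell \<open>cyl (n - 1) (point i) - cyl n (point i)\<close>.\<close>

definition shell_value :: "real \<Rightarrow> bit \<Rightarrow> nat \<Rightarrow> real" where
  "shell_value a i n = alpha n * (if i = 0 then 1 else Lfac a n)"

lemma coord_1 [simp]: "coord t 1 = t 0" "coord t (Suc 0) = t 0"
  by (simp_all add: coord_def)

lemma point_0: "point 0 = 0" and point_1: "point 1 = t0"
  by (simp_all add: point_def t0_def fun_eq_iff)

lemma point_first [simp]: "point i 0 = i"
  by (simp add: point_def)

lemma cyl_1_point: "cyl (Suc 0) (point i) = {t. t 0 = i}"
  by (simp add: cyl_def)

lemma range_point: "t \<in> {0, t0} \<longleftrightarrow> t = point (t 0)"
proof
  assume "t = point (t 0)"
  then show "t \<in> {0, t0}"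
    by (cases "t 0") (simp_all add: point_0 point_1)
qed (auto simp: point_def t0_def fun_eq_iff)

lemma alpha_pos: "0 < alpha n"
  by (simp add: alpha_def)

lemma alpha_antimono: "m \<le> n \<Longrightarrow> alpha n \<le> alpha m"
  by (simp add: alpha_def power_increasing)

lemma alpha_le_half_power: "alpha n \<le> (1/2) ^ n"
proof -
  have "(2 :: real) ^ n \<le> exp (2 ^ n)"
    using exp_ge_add_one_self[of "2 ^ n :: real"] by linarith
  then have "inverse (exp (2 ^ n)) \<le> inverse ((2 :: real) ^ n)"
    by (intro le_imp_inverse_le) auto
  then show ?thesis by (simp add: alpha_def exp_minus power_one_over inverse_eq_divide)
qed

lemma alpha_tendsto_0: "alpha \<longlonglongrightarrow> 0"
proof (rule tendsto_sandwich[OF _ _ tendsto_const])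
  show "(\<lambda>n. (1/2 :: real) ^ n) \<longlonglongrightarrow> 0" by (rule LIMSEQ_realpow_zero) auto
qed (use alpha_pos alpha_le_half_power less_imp_le in \<open>auto intro!: always_eventually\<close>)

lemma Lfac_bounds:
  assumes "0 < a" "a < 1"
  shows "1 - a \<le> Lfac a n" "Lfac a n \<le> 2"
  using assms by (auto simp: Lfac_def)

lemma shell_value_bounds:
  assumes "0 < a" "a < 1"
  shows "(1 - a) * alpha n \<le> shell_value a i n" "shell_value a i n \<le> 2 * alpha n"
proof -
  have "1 - a \<le> (if i = 0 then 1 else Lfac a n)" "(if i = 0 then 1 else Lfac a n) \<le> 2"
    using Lfac_bounds[OF assms, of n] assms by auto
  then show "(1 - a) * alpha n \<le> shell_value a i n" "shell_value a i n \<le> 2 * alpha n"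
    unfolding shell_value_def using alpha_pos[of n]
    by (simp_all add: mult.commute mult_right_mono mult_left_mono)
qed

lemma Wfun_point [simp]: "Wfun a (point i) = 0"
  using range_point[of "point i"] by (simp add: Wfun_def)

lemma Wfun_shell:
  assumes "1 \<le> n" "t \<in> cyl n (point i)" "t \<notin> cyl (Suc n) (point i)"
  shows "Wfun a t = shell_value a i (Suc n)"
proof -
  have t: "t k = point i k" if "k < n" for k
    using assms(2) that by (auto simp: cyl_def)
  have n: "t n \<noteq> point i n"
  proof
    assume "t n = point i n"
    then have "t \<in> cyl (Suc n) (point i)" using t by (auto simp: cyl_def less_Suc_eq)
    then show False using assms(3) by simp
  qed
  have t0: "t 0 = i" using t[of 0] assms(1) by simp
  then have "t \<notin> {0, t0}" unfolding range_point using n by auto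
  moreover have "mfirst t = Suc n"
    unfolding mfirst_def
  proof (rule Least_equality)
    show "2 \<le> Suc n \<and> coord t (Suc n) = 1"
      using n assms(1) by (simp add: coord_def point_def)
    fix k assume k: "2 \<le> k \<and> coord t k = 1"
    show "Suc n \<le> k"
    proof (rule ccontr)
      assume "\<not> Suc n \<le> k"
      then have "t (k - 1) = point i (k - 1)" using k by (intro t) auto
      then show False using k by (simp add: coord_def point_def)
    qed
  qed
  ultimately show ?thesis using t0 by (simp add: Wfun_def shell_value_def)
qed

lemma shell_ex:
  assumes "t 0 = i" "t \<noteq> point i"
  obtains n where "1 \<le> n" "t \<in> cyl n (point i)" "t \<notin> cyl (Suc n) (point i)"
proof -
  obtain k where "t k \<noteq> point i k" using assms(2) by auto
  define n where "n = (LEAST k. t k \<noteq> point i k)"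
  have n: "t n \<noteq> point i n" unfolding n_def by (rule LeastI) fact
  have less: "t k = point i k" if "k < n" for k
    using not_less_Least[of k "\<lambda>k. t k \<noteq> point i k"] that unfolding n_def by blast
  have "n \<noteq> 0"
  proof
    assume "n = 0"
    then show False using n assms(1) by simp
  qed
  show ?thesis
  proof (rule that[of n])
    show "1 \<le> n" using \<open>n \<noteq> 0\<close> by simp
    show "t \<in> cyl n (point i)" using less by (auto simp: cyl_def)
    show "t \<notin> cyl (Suc n) (point i)" using n by (auto simp: cyl_def)
  qed
qed

context
  fixes a :: real
  assumes a: "0 < a" "a < 1"
begin

lemma Wfun_upper:
  assumes "1 \<le> n" "t \<in> cyl n (point i)"
  shows "0 \<le> Wfun a t" "Wfun a t \<le> 2 * alpha (Suc n)"
proof -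
  have "0 \<le> Wfun a t \<and> Wfun a t \<le> 2 * alpha (Suc n)"
  proof (cases "t = point i")
    case True
    then show ?thesis using alpha_pos[of "Suc n"] by simp
  next
    case False
    have "t 0 = i" using assms by (auto simp: cyl_def)
    then obtain m where m: "1 \<le> m" "t \<in> cyl m (point i)" "t \<notin> cyl (Suc m) (point i)"
      using shell_ex False by blast
    have "n \<le> m"
    proof (rule ccontr)
      assume "\<not> n \<le> m"
      then have "cyl n (point i) \<subseteq> cyl (Suc m) (point i)" by (intro cyl_mono) auto
      then show False using assms m by auto
    qed
    have W: "Wfun a t = shell_value a i (Suc m)" by (rule Wfun_shell[OF m])
    have "alpha (Suc m) \<le> alpha (Suc n)" using \<open>n \<le> m\<close> by (intro alpha_antimono) auto
    moreover have "0 \<le> (1 - a) * alpha (Suc m)" using a alpha_pos[of "Suc m"] by simp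
    ultimately show ?thesis
      unfolding W using shell_value_bounds[OF a, where n = "Suc m" and i = i] by linarith
  qed
  then show "0 \<le> Wfun a t" "Wfun a t \<le> 2 * alpha (Suc n)" by auto
qed

lemma Wfun_lower:
  assumes "t 0 = i" "t \<notin> cyl n (point i)"
  shows "(1 - a) * alpha n \<le> Wfun a t"
proof -
  have "t \<noteq> point i" using assms(2) by auto
  then obtain m where m: "1 \<le> m" "t \<in> cyl m (point i)" "t \<notin> cyl (Suc m) (point i)"
    using shell_ex assms(1) by blast
  have "Suc m \<le> n"
  proof (rule ccontr)
    assume "\<not> Suc m \<le> n"
    then have "cyl m (point i) \<subseteq> cyl n (point i)" by (intro cyl_mono) auto
    then show False using assms m by auto
  qed
  then have "(1 - a) * alpha n \<le> (1 - a) * alpha (Suc m)"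
    using a by (intro mult_left_mono alpha_antimono) auto
  also have "\<dots> \<le> Wfun a t"
    unfolding Wfun_shell[OF m] by (rule shell_value_bounds(1)[OF a])
  finally show ?thesis .
qed

lemma Wfun_nonneg: "0 \<le> Wfun a t"
  using Wfun_upper(1)[of 1 t "t 0"] by (simp add: cyl_1_point)

lemma Wfun_le_2: "Wfun a t \<le> 2"
proof -
  have "Wfun a t \<le> 2 * alpha 2"
    using Wfun_upper(2)[of 1 t "t 0"] by (simp add: cyl_1_point numeral_2_eq_2)
  also have "\<dots> \<le> 2" by (simp add: alpha_def)
  finally show ?thesis .
qed

lemma Wfun_pos:
  assumes "t \<notin> {0, t0}" shows "0 < Wfun a t"
proof -
  obtain n where n: "1 \<le> n" "t \<in> cyl n (point (t 0))" "t \<notin> cyl (Suc n) (point (t 0))"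
    using shell_ex[of t "t 0"] assms unfolding range_point by auto
  have "0 < (1 - a) * alpha (Suc n)" using a alpha_pos[of "Suc n"] by simp
  also have "\<dots> \<le> Wfun a t" by (rule Wfun_lower[OF refl n(3)])
  finally show ?thesis .
qed

text \<open>For points that share their first coordinate: either both lie in the cylinder around the zero of the profile, where the profile is at most
\<open>2 \<alpha>\<^sub>n\<^sub>+\<^sub>1\<close>, or they lie in the same shell, where it is constant.\<close>

lemma Wfun_modulus:
  assumes "s \<in> cyl n t" shows "\<bar>Wfun a s - Wfun a t\<bar> \<le> 2 * (1/2) ^ n"
proof (cases "n = 0")
  case True
  then show ?thesis
    using Wfun_nonneg[of s] Wfun_nonneg[of t] Wfun_le_2[of s] Wfun_le_2[of t] by (auto simp: abs_le_iff)
next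
  case False
  then have n: "1 \<le> n" by simp
  have st: "s k = t k" if "k < n" for k using assms that by (auto simp: cyl_def)
  define i where "i = t 0"
  show ?thesis
  proof (cases "t \<in> cyl n (point i)")
    case True
    then have "s \<in> cyl n (point i)" using st by (auto simp: cyl_def)
    then have "\<bar>Wfun a s - Wfun a t\<bar> \<le> 2 * alpha (Suc n)"
      using Wfun_upper[OF n True] Wfun_upper[OF n, of s i] by (auto simp: abs_le_iff)
    also have "alpha (Suc n) \<le> (1/2) ^ Suc n" by (rule alpha_le_half_power)
    also have "2 * (1/2 :: real) ^ Suc n \<le> 2 * (1/2) ^ n" by simp
    finally show ?thesis by simp
  next
    case False
    then have "t \<noteq> point i" by auto
    then obtain m where m: "1 \<le> m" "t \<in> cyl m (point i)" "t \<notin> cyl (Suc m) (point i)"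
      using shell_ex i_def by blast
    have "Suc m \<le> n"
    proof (rule ccontr)
      assume "\<not> Suc m \<le> n"
      then have "cyl m (point i) \<subseteq> cyl n (point i)" by (intro cyl_mono) auto
      then show False using False m by auto
    qed
    then have "s \<in> cyl k (point i) \<longleftrightarrow> t \<in> cyl k (point i)" if "k \<le> Suc m" for k
      using st that by (auto simp: cyl_def)
    then have "s \<in> cyl m (point i)" "s \<notin> cyl (Suc m) (point i)" using m by auto
    then have "Wfun a s = Wfun a t" using Wfun_shell m by metis
    then show ?thesis by simp
  qed
qed

lemma measurable_Wfun [measurable]: "Wfun a \<in> borel_measurable haar"
proof (rule continuous_measurable_cantor)
  show "continuous_map cantor_top euclideanreal (Wfun a)"
    unfolding continuous_map openin_cantor
  proof (intro conjI allI impI ballI)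
    fix U :: "real set" and x assume U: "openin euclideanreal U" and x: "x \<in> {x \<in> topspace cantor_top. Wfun a x \<in> U}"
    then obtain e where e: "0 < e" "\<And>y. dist y (Wfun a x) < e \<Longrightarrow> y \<in> U"
      by (auto simp: open_dist)
    obtain n where n: "(1/2 :: real) ^ n < e / 2"
      using real_arch_pow_inv[of "e/2" "1/2"] e(1) by auto
    have "Wfun a y \<in> U" if "y \<in> cyl n x" for y
      using Wfun_modulus[OF that] n by (intro e(2)) (simp add: dist_real_def)
    then show "\<exists>n. cyl n x \<subseteq> {x \<in> topspace cantor_top. Wfun a x \<in> U}"
      by (intro exI[of _ n]) auto
  qed auto
qed

end

lemma diff_eq_iff: "(y :: cantor) - x = t \<longleftrightarrow> y = x + t"
  unfolding cantor_diff_eq_add by (metis cantor_add_add)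

lemma cyl_diff:
  assumes "x' \<in> cyl n x" "y' \<in> cyl n y" shows "y' - x' \<in> cyl n (y - x)"
  using assms by (auto simp: cyl_def)

lemma measurable_gam [measurable]: "gam \<beta> \<in> borel_measurable haar"
  unfolding gam_def coord_1 by measurable

lemma measurable_cantor_cost:
  assumes "0 < a" "a < 1" shows "cantor_cost a \<beta> \<in> borel_measurable (haar \<Otimes>\<^sub>M haar)"
proof -
  note measurable_Wfun[OF assms, measurable]
  show ?thesis unfolding cantor_cost_def by measurable
qed

context
  fixes a \<beta> :: real
  assumes a: "0 < a" "a < 1" and \<beta>: "0 < \<beta>"
begin

lemma gam_bounds: "0 < gam \<beta> x" "gam \<beta> x \<le> max 1 \<beta>"
  using \<beta> by (auto simp: gam_def)

lemma cantor_cost_bounds: "0 \<le> cantor_cost a \<beta> z" "cantor_cost a \<beta> z \<le> 2 * max 1 \<beta>"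
proof -
  obtain x y where z: "z = (x, y)" by (cases z)
  show "0 \<le> cantor_cost a \<beta> z"
    using gam_bounds(1)[of x] Wfun_nonneg[OF a] by (simp add: z cantor_cost_def)
  have "gam \<beta> x * Wfun a (y - x) \<le> max 1 \<beta> * 2"
    using gam_bounds[of x] Wfun_nonneg[OF a] Wfun_le_2[OF a] by (intro mult_mono) auto
  then show "cantor_cost a \<beta> z \<le> 2 * max 1 \<beta>" by (simp add: z cantor_cost_def)
qed

lemma cantor_cost_modulus:
  assumes "x' \<in> cyl n x" "y' \<in> cyl n y"
  shows "\<bar>cantor_cost a \<beta> (x, y) - cantor_cost a \<beta> (x', y')\<bar> \<le> 2 * max 1 \<beta> * (1/2) ^ n"
proof (cases "n = 0")
  case True
  then show ?thesis
    using cantor_cost_bounds[of "(x, y)"] cantor_cost_bounds[of "(x', y')"] by (auto simp: abs_le_iff)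
next
  case False
  then have "gam \<beta> x' = gam \<beta> x" using assms by (auto simp: gam_def cyl_def)
  then have "\<bar>cantor_cost a \<beta> (x, y) - cantor_cost a \<beta> (x', y')\<bar>
      = gam \<beta> x * \<bar>Wfun a (y' - x') - Wfun a (y - x)\<bar>"
    using gam_bounds(1)[of x]
    by (simp add: cantor_cost_def abs_mult abs_minus_commute flip: right_diff_distrib)
  also have "\<dots> \<le> max 1 \<beta> * (2 * (1/2) ^ n)"
    using gam_bounds[of x] Wfun_modulus[OF a cyl_diff[OF assms]] by (intro mult_mono) auto
  finally show ?thesis by (simp add: mult_ac)
qed

text \<open>Distances are zero or powers of \<open>1/2\<close>, so the modulus of continuity over cylinders is a Lipschitz bound;
the shift between \<open>(1/2) ^ n\<close> and the distance \<open>(1/2) ^ Suc n\<close> doubles the constant.\<close>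

lemma bounded_Lipschitz_cantor_cost: "bounded_Lipschitz_cost cantor_metric (cantor_cost a \<beta>)"
  unfolding bounded_Lipschitz_cost_def mspace_cantor_metric mdist_cantor_metric
proof (intro conjI exI ballI)
  show "0 \<le> cantor_cost a \<beta> z" for z by (rule cantor_cost_bounds)
  show "bounded (cantor_cost a \<beta> ` (UNIV \<times> UNIV))"
    unfolding bounded_iff using cantor_cost_bounds
    by (intro exI[of _ "2 * max 1 \<beta>"]) (simp del: times_divide_eq_right)
  fix x y x' y'
  let ?d = "max (cantor_dist x x') (cantor_dist y y')"
  have dist_power: "cantor_dist s t = 0 \<or> (\<exists>n. cantor_dist s t = (1/2) ^ Suc n)" for s t
  proof (cases "s = t")
    case False
    define m where "m = (LEAST k. 1 \<le> k \<and> coord s k \<noteq> coord t k)"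
    obtain i where "s i \<noteq> t i" using False by auto
    then have "1 \<le> Suc i \<and> coord s (Suc i) \<noteq> coord t (Suc i)" by (simp add: coord_def)
    then have "1 \<le> m \<and> coord s m \<noteq> coord t m"
      unfolding m_def by (rule LeastI)
    then have "cantor_dist s t = (1/2) ^ Suc (m - 1)"
      using False by (simp add: cantor_dist_def m_def)
    then show ?thesis by blast
  qed (simp add: cantor_dist_def)
  have zero: "s = t" if "cantor_dist s t \<le> 0" for s t
  proof (rule ccontr)
    assume "s \<noteq> t"
    then have "0 < cantor_dist s t" by (simp add: cantor_dist_def)
    then show False using that by simp
  qed
  have cyl: "t \<in> cyl n s" if "cantor_dist s t \<le> (1/2) ^ Suc n" for s t n
  proof -
    have "t k = s k" if "k < n" for k
      using \<open>cantor_dist s t \<le> _\<close>[unfolded cantor_dist_le, rule_format, of "Suc k"] that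
      by (simp add: coord_def)
    then show ?thesis by (simp add: cyl_def)
  qed
  have "?d = cantor_dist x x' \<or> ?d = cantor_dist y y'"
    by (simp add: max_def)
  then have "?d = 0 \<or> (\<exists>n. ?d = (1/2) ^ Suc n)"
    using dist_power[of x x'] dist_power[of y y'] by (elim disjE) (simp_all only: simp_thms)
  then consider "?d = 0" | n where "?d = (1/2) ^ Suc n"
    by blast
  then show "\<bar>cantor_cost a \<beta> (x, y) - cantor_cost a \<beta> (x', y')\<bar> \<le> 4 * max 1 \<beta> * ?d"
  proof cases
    case 1
    then have "cantor_dist x x' \<le> 0" "cantor_dist y y' \<le> 0"
      by (metis max.cobounded1, metis max.cobounded2)
    then show ?thesis using zero[of x x'] zero[of y y'] 1 by simp
  next
    case (2 n)
    then have "cantor_dist x x' \<le> (1/2) ^ Suc n" "cantor_dist y y' \<le> (1/2) ^ Suc n"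
      by (metis max.cobounded1, metis max.cobounded2)
    from cantor_cost_modulus[OF this[THEN cyl]] show ?thesis
      unfolding 2 by simp
  qed
qed

end

section \<open>Singularity of the optimal plans\<close>

lemma measurable_shift [measurable]: "(\<lambda>x. (x, x + t)) \<in> measurable haar (haar \<Otimes>\<^sub>M haar)"
  by measurable

lemma graph_coupling_in_couplings: "graph_coupling t \<in> couplings haar haar"
  unfolding couplings_def graph_coupling_def
  by (simp add: distr_distr comp_def haar_translate)

lemma sets_zero_cost: "{z. snd z - fst z \<in> {0, t0}} \<in> sets (haar \<Otimes>\<^sub>M haar)"
proof -
  have "{t} \<in> sets haar" for t using null_singleton_haar[of t] by blast
  from sets.Un[OF this[of 0] this[of t0]] have [measurable]: "{0, t0} \<in> sets haar" by (simp add: insert_commute)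
  have "{z \<in> space (haar \<Otimes>\<^sub>M haar). snd z - fst z \<in> {0, t0}} \<in> sets (haar \<Otimes>\<^sub>M haar)"
    by measurable
  then show ?thesis by (simp add: space_pair_measure)
qed

lemma null_zero_cost: "{z. snd z - fst z \<in> {0, t0}} \<in> null_sets (haar \<Otimes>\<^sub>M haar)"
proof -
  have "emeasure (haar \<Otimes>\<^sub>M haar) {z. snd z - fst z \<in> {0, t0}} =
      (\<integral>\<^sup>+x. emeasure haar (Pair x -` {z. snd z - fst z \<in> {0, t0}}) \<partial>haar)"
    using haar.emeasure_pair_measure_alt[OF sets_zero_cost] .
  also have "\<dots> = (\<integral>\<^sup>+x. 0 \<partial>haar)"
  proof (rule nn_integral_cong)
    fix x :: cantor
    have "Pair x -` {z. snd z - fst z \<in> {0, t0}} = {x} \<union> {x + t0}"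
      by (auto simp: diff_eq_iff)
    also have "\<dots> \<in> null_sets haar" by (intro null_sets.Un null_singleton_haar)
    finally show "emeasure haar (Pair x -` {z. snd z - fst z \<in> {0, t0}}) = 0" by (rule null_setsD1)
  qed
  finally show ?thesis using sets_zero_cost by (simp add: null_sets_def)
qed

text \<open>The diagonal coupling has cost zero, so an optimal plan lives on the zero set of the cost. That set is
the union of two graphs, and a graph is null for the product measure since points are null.\<close>

lemma optimal_plan_singular:
  assumes a: "0 < a" "a < 1" and \<beta>: "0 < \<beta>" and P: "optimal_plan (cantor_cost a \<beta>) haar P"
  shows "mutually_singular P (haar \<Otimes>\<^sub>M haar)"
proof -
  let ?C = "cantor_cost a \<beta>" and ?D = "{z :: cantor \<times> cantor. snd z - fst z \<in> {0, t0}}"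
  note measurable_cantor_cost[OF a, measurable]
  have Pc: "P \<in> couplings haar haar" using P by (auto simp: optimal_plan_def is_arg_min_def)
  then have sP [measurable_cong]: "sets P = sets (haar \<Otimes>\<^sub>M haar)" by (auto simp: couplings_def)
  interpret P: prob_space P using prob_space_coupling[OF prob_space_haar Pc] .
  have "(\<integral>z. ?C z \<partial>graph_coupling 0) = 0"
  proof -
    have "x + 0 - x = point 0" for x :: cantor by (simp add: point_0)
    then have zero: "?C (x, x + 0) = 0" for x by (simp only: cantor_cost_def case_prod_conv Wfun_point mult_zero_right)
    show ?thesis
      unfolding graph_coupling_def
      by (subst integral_distr[OF measurable_shift measurable_cantor_cost[OF a]]) (simp only: zero, simp)
  qed
  then have "(\<integral>z. ?C z \<partial>P) \<le> 0"
    using P graph_coupling_in_couplings[of 0]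
    by (auto simp: optimal_plan_def is_arg_min_def not_less)
  moreover have "0 \<le> (\<integral>z. ?C z \<partial>P)"
    using cantor_cost_bounds[OF a \<beta>] by simp
  ultimately have "(\<integral>z. ?C z \<partial>P) = 0" by simp
  moreover have "integrable P ?C"
    by (rule P.integrable_const_bound[where B = "2 * max 1 \<beta>"])
      (use cantor_cost_bounds[OF a \<beta>] in auto)
  ultimately have "AE z in P. ?C z = 0"
    using cantor_cost_bounds(1)[OF a \<beta>] by (subst (asm) integral_nonneg_eq_0_iff_AE) auto
  then have "AE z in P. z \<in> ?D"
  proof eventually_elim
    case (elim z)
    show ?case
    proof (rule ccontr)
      assume "z \<notin> ?D"
      then have "0 < Wfun a (snd z - fst z)" by (intro Wfun_pos[OF a]) auto
      then have "0 < ?C z" using gam_bounds(1)[OF a \<beta>, of "fst z"] by (simp add: cantor_cost_def split_beta)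
      then show False using elim by simp
    qed
  qed
  then have "emeasure P (- ?D) = 0"
  proof (rule AE_E)
    fix N assume N: "{z \<in> space P. \<not> z \<in> ?D} \<subseteq> N" "emeasure P N = 0" "N \<in> sets P"
    have "space P = UNIV" using sets_eq_imp_space_eq[OF sP] by (simp add: space_pair_measure)
    then have "- ?D \<subseteq> N" using N(1) by auto
    then show "emeasure P (- ?D) = 0" using emeasure_eq_0[OF N(3,2)] by simp
  qed
  moreover have "- ?D \<in> sets (haar \<Otimes>\<^sub>M haar)"
    using sets.compl_sets[OF sets_zero_cost] by (simp add: space_pair_measure Compl_eq_Diff_UNIV)
  moreover have "space (haar \<Otimes>\<^sub>M haar) - (- ?D) = ?D" by (simp add: space_pair_measure)
  ultimately show ?thesis
    unfolding mutually_singular_def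
    by (intro conjI bexI[of _ "- ?D"] sP) (simp_all only: null_setsD1[OF null_zero_cost])
qed

section \<open>Partition functions and Gibbs averages\<close>

abbreviation (input) half :: "bit \<Rightarrow> cantor set" where
  "half i \<equiv> {t. t 0 = i}"

text \<open>The Boltzmann factor of the profile at inverse temperature \<open>\<kappa> / \<epsilon>\<close>. The parameter \<open>\<kappa>\<close> stands for the
values \<open>1\<close> and \<open>\<beta>\<close> of \<open>\<gamma>\<close>, so that one function covers the integrals \<open>I\<close> and \<open>J\<close>.\<close>

definition boltz :: "real \<Rightarrow> real \<Rightarrow> real \<Rightarrow> cantor \<Rightarrow> real" where
  "boltz a \<kappa> \<epsilon> t = exp (- \<kappa> * Wfun a t / \<epsilon>)"

definition partition_fn :: "real \<Rightarrow> real \<Rightarrow> bit \<Rightarrow> real \<Rightarrow> real" where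
  "partition_fn a \<kappa> i \<epsilon> = (LINT t:half i|haar. boltz a \<kappa> \<epsilon> t)"

lemma I_int_partition_fn: "I_int a i \<epsilon> = partition_fn a 1 i \<epsilon>"
  and J_int_partition_fn: "J_int a \<beta> i \<epsilon> = partition_fn a \<beta> i \<epsilon>"
  by (simp_all add: I_int_def J_int_def partition_fn_def boltz_def)

lemma half_sets [measurable]: "half i \<in> sets haar"
  using sets_cyl[of "Suc 0" "point i"] by (simp only: cyl_1_point)

lemma cyl_subset_half: "1 \<le> n \<Longrightarrow> cyl n (point i) \<subseteq> half i"
  using cyl_mono[of "Suc 0" n "point i"] by (simp add: cyl_1_point)

lemma set_integral_const_haar: "A \<in> sets haar \<Longrightarrow> (LINT t:A|haar. c) = measure haar A * (c :: real)"
  unfolding set_lebesgue_integral_def by simp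

lemma set_integrable_const_haar: "A \<in> sets haar \<Longrightarrow> set_integrable haar A (\<lambda>_. c :: real)"
  unfolding set_integrable_def
  by (rule haar.integrable_const_bound[where B = "\<bar>c\<bar>"]) (auto simp: indicator_def)

context
  fixes a \<kappa> :: real
  assumes a: "0 < a" "a < 1" and \<kappa>: "0 < \<kappa>"
begin

lemma measurable_boltz [measurable]: "boltz a \<kappa> \<epsilon> \<in> borel_measurable haar"
proof -
  note measurable_Wfun[OF a, measurable]
  show ?thesis unfolding boltz_def by measurable
qed

lemma boltz_pos: "0 < boltz a \<kappa> \<epsilon> t"
  by (simp add: boltz_def)

lemma boltz_le_1:
  assumes "0 < \<epsilon>" shows "boltz a \<kappa> \<epsilon> t \<le> 1"
  using \<kappa> assms Wfun_nonneg[OF a, of t] by (simp add: boltz_def)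

lemma boltz_ge:
  assumes "0 < \<epsilon>" "Wfun a t \<le> v" shows "exp (- \<kappa> * v / \<epsilon>) \<le> boltz a \<kappa> \<epsilon> t"
  using \<kappa> assms by (simp add: boltz_def divide_right_mono mult_left_mono)

lemma boltz_le:
  assumes "0 < \<epsilon>" "v \<le> Wfun a t" shows "boltz a \<kappa> \<epsilon> t \<le> exp (- \<kappa> * v / \<epsilon>)"
  using \<kappa> assms by (simp add: boltz_def divide_right_mono mult_left_mono)

lemma set_integrable_boltz:
  assumes "0 < \<epsilon>" "A \<in> sets haar" "h \<in> borel_measurable haar" "\<And>t. \<bar>h t\<bar> \<le> B"
  shows "set_integrable haar A (\<lambda>t. h t * boltz a \<kappa> \<epsilon> t)"
  unfolding set_integrable_def
proof (rule haar.integrable_const_bound[where B = B])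
  note assms(2,3)[measurable]
  have "\<bar>h t * boltz a \<kappa> \<epsilon> t\<bar> \<le> B * 1" for t
    unfolding abs_mult using assms(4)[of t] boltz_pos[of \<epsilon> t] boltz_le_1[OF assms(1), of t]
    by (intro mult_mono) auto
  moreover have "0 \<le> B" using assms(4)[of undefined] by linarith
  ultimately show "AE t in haar. norm (indicator A t *\<^sub>R (h t * boltz a \<kappa> \<epsilon> t)) \<le> B"
    by (intro AE_I2) (auto simp: indicator_def)
  show "(\<lambda>t. indicator A t *\<^sub>R (h t * boltz a \<kappa> \<epsilon> t)) \<in> borel_measurable haar" by measurable
qed

lemma set_integrable_boltz1:
  assumes "0 < \<epsilon>" "A \<in> sets haar"
  shows "set_integrable haar A (boltz a \<kappa> \<epsilon>)"
  using set_integrable_boltz[OF assms, of "\<lambda>_. 1" 1] by simp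

lemma boltz_integral_bounds:
  assumes \<epsilon>: "0 < \<epsilon>" and A: "A \<in> sets haar" and v: "\<And>t. t \<in> A \<Longrightarrow> v \<le> Wfun a t"
    and u: "\<And>t. t \<in> A \<Longrightarrow> Wfun a t \<le> u"
  shows "measure haar A * exp (- \<kappa> * u / \<epsilon>) \<le> (LINT t:A|haar. boltz a \<kappa> \<epsilon> t)"
    "(LINT t:A|haar. boltz a \<kappa> \<epsilon> t) \<le> measure haar A * exp (- \<kappa> * v / \<epsilon>)"
  unfolding set_integral_const_haar[OF A, symmetric]
  by (intro set_integral_mono set_integrable_boltz1 set_integrable_const_haar boltz_ge boltz_le
      A \<epsilon> u v; assumption)+

lemma partition_fn_lower:
  assumes \<epsilon>: "0 < \<epsilon>" and N: "1 \<le> N"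
  shows "(1/2) ^ N * exp (- \<kappa> * (2 * alpha (Suc N)) / \<epsilon>) \<le> partition_fn a \<kappa> i \<epsilon>"
proof -
  have "(1/2) ^ N * exp (- \<kappa> * (2 * alpha (Suc N)) / \<epsilon>)
      \<le> (LINT t:cyl N (point i)|haar. boltz a \<kappa> \<epsilon> t)"
    unfolding measure_cyl[of N "point i", symmetric]
    by (rule boltz_integral_bounds(1)[OF \<epsilon>, where v = 0])
      (use Wfun_upper[OF a N] in auto)
  also have "\<dots> \<le> partition_fn a \<kappa> i \<epsilon>"
    unfolding partition_fn_def set_lebesgue_integral_def
    using cyl_subset_half[OF N, of i] less_imp_le[OF boltz_pos]
    by (intro integral_mono set_integrable_boltz1[OF \<epsilon>, unfolded set_integrable_def])
      (auto simp: indicator_def)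
  finally show ?thesis .
qed

lemma partition_fn_pos: "0 < \<epsilon> \<Longrightarrow> 0 < partition_fn a \<kappa> i \<epsilon>"
  by (rule less_le_trans[OF _ partition_fn_lower[of \<epsilon> 1]]) auto

lemma far_integral_upper:
  assumes \<epsilon>: "0 < \<epsilon>"
  shows "(LINT t:half i - cyl n (point i)|haar. boltz a \<kappa> \<epsilon> t) \<le> exp (- \<kappa> * ((1 - a) * alpha n) / \<epsilon>)"
proof -
  let ?A = "half i - cyl n (point i)"
  have "(LINT t:?A|haar. boltz a \<kappa> \<epsilon> t) \<le> measure haar ?A * exp (- \<kappa> * ((1 - a) * alpha n) / \<epsilon>)"
    by (rule boltz_integral_bounds(2)[OF \<epsilon>, where u = 2]) (use Wfun_lower[OF a] Wfun_le_2[OF a] in auto)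
  also have "\<dots> \<le> 1 * exp (- \<kappa> * ((1 - a) * alpha n) / \<epsilon>)"
    by (intro mult_right_mono) auto
  finally show ?thesis by simp
qed

text \<open>Outside \<open>cyl n (point i)\<close> the profile is at least \<open>(1 - a) \<alpha>\<^sub>n\<close>, whereas it is at most \<open>2 \<alpha>\<^sub>M\<^sub>+\<^sub>1\<close> on the
smaller cylinder of length \<open>M\<close>. For large \<open>M\<close> the first number wins, and the ratio of the two masses
is exponentially small in \<open>1 / \<epsilon>\<close>.\<close>

lemma far_mass_vanishes:
  assumes e: "\<And>k. 0 < e k" "e \<longlonglongrightarrow> 0"
  shows "(\<lambda>k. (LINT t:half i - cyl n (point i)|haar. boltz a \<kappa> (e k) t) / partition_fn a \<kappa> i (e k)) \<longlonglongrightarrow> 0"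
proof -
  have pos: "0 < (1 - a) * alpha n / 2" using a alpha_pos[of n] by simp
  (* then alpha N is less than half of the lower bound for the profile outside the cylinder *)
  obtain N where N: "(1/2) ^ N < (1 - a) * alpha n / 2"
    using real_arch_pow_inv[OF pos, of "1/2"] by auto
  define M where "M = Suc N"
  define c where "c = (1 - a) * alpha n - 2 * alpha (Suc M)"
  have "alpha (Suc M) \<le> alpha N" unfolding M_def by (intro alpha_antimono) auto
  then have c: "0 < c" unfolding c_def using N alpha_le_half_power[of N] by linarith
  have "(\<lambda>k. 2 ^ M * exp (- \<kappa> * c / e k)) \<longlonglongrightarrow> 2 ^ M * 0"
  proof (intro tendsto_intros)
    have "e k \<noteq> 0" for k using e(1)[of k] by simp
    then have "filterlim e (at_right 0) sequentially"
      using e by (simp add: filterlim_at)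
    then have "filterlim (\<lambda>k. inverse (e k)) at_top sequentially"
      by (rule filterlim_compose[OF filterlim_inverse_at_top_right])
    then have "filterlim (\<lambda>k. (\<kappa> * c) * inverse (e k)) at_top sequentially"
      using \<kappa> c by (intro filterlim_tendsto_pos_mult_at_top[OF tendsto_const]) auto
    then have "filterlim (\<lambda>k. - ((\<kappa> * c) * inverse (e k))) at_bot sequentially"
      by (simp add: filterlim_uminus_at_bot)
    then have "(\<lambda>k. exp (- ((\<kappa> * c) * inverse (e k)))) \<longlonglongrightarrow> 0"
      by (rule filterlim_compose[OF exp_at_bot])
    then show "(\<lambda>k. exp (- \<kappa> * c / e k)) \<longlonglongrightarrow> 0" by (simp add: divide_inverse)
  qed
  then have lim: "(\<lambda>k. 2 ^ M * exp (- \<kappa> * c / e k)) \<longlonglongrightarrow> 0" by simp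
  show ?thesis
  proof (rule tendsto_sandwich[OF _ _ tendsto_const lim])
    show "\<forall>\<^sub>F k in sequentially. 0 \<le>
      (LINT t:half i - cyl n (point i)|haar. boltz a \<kappa> (e k) t) / partition_fn a \<kappa> i (e k)"
      using partition_fn_pos[OF e(1)] less_imp_le[OF boltz_pos]
      by (intro always_eventually allI divide_nonneg_pos)
        (auto simp: set_lebesgue_integral_def intro!: integral_nonneg)
    show "\<forall>\<^sub>F k in sequentially.
      (LINT t:half i - cyl n (point i)|haar. boltz a \<kappa> (e k) t) / partition_fn a \<kappa> i (e k)
        \<le> 2 ^ M * exp (- \<kappa> * c / e k)"
    proof (intro always_eventually allI)
      fix k
      have "(LINT t:half i - cyl n (point i)|haar. boltz a \<kappa> (e k) t) / partition_fn a \<kappa> i (e k)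
        \<le> exp (- \<kappa> * ((1 - a) * alpha n) / e k) / ((1/2) ^ M * exp (- \<kappa> * (2 * alpha (Suc M)) / e k))"
        using far_integral_upper[OF e(1)] partition_fn_lower[OF e(1), of M k i]
        by (intro frac_le) (auto simp: M_def)
      also have "\<dots> = 2 ^ M * (exp (- \<kappa> * ((1 - a) * alpha n) / e k) / exp (- \<kappa> * (2 * alpha (Suc M)) / e k))"
        by (simp add: power_one_over)
      also have "\<dots> = 2 ^ M * exp (- \<kappa> * c / e k)"
        unfolding exp_diff[symmetric] c_def using e(1)[of k] by (simp add: field_simps)
      finally show "(LINT t:half i - cyl n (point i)|haar. boltz a \<kappa> (e k) t) / partition_fn a \<kappa> i (e k)
        \<le> 2 ^ M * exp (- \<kappa> * c / e k)" .
    qed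
  qed
qed

text \<open>The normalised Boltzmann measure on a half concentrates at the zero of the profile, so averages of a
function continuous at that point converge to its value there.\<close>

lemma gibbs_average_tendsto:
  fixes h :: "cantor \<Rightarrow> real"
  assumes e: "\<And>k. 0 < e k" "e \<longlonglongrightarrow> 0"
    and h [measurable]: "h \<in> borel_measurable haar" and B: "\<And>t. \<bar>h t\<bar> \<le> B"
    and cont: "\<And>\<eta>. 0 < \<eta> \<Longrightarrow> \<exists>n. \<forall>t\<in>cyl n (point i). \<bar>h t - h (point i)\<bar> \<le> \<eta>"
  shows "(\<lambda>k. (LINT t:half i|haar. h t * boltz a \<kappa> (e k) t) / partition_fn a \<kappa> i (e k))
    \<longlonglongrightarrow> h (point i)"
proof (rule LIMSEQ_I)
  fix r :: real assume r: "0 < r"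
  let ?p = "point i"
  have B0: "0 \<le> B" using B[of undefined] by linarith
  obtain n0 where n0: "\<forall>t\<in>cyl n0 ?p. \<bar>h t - h ?p\<bar> \<le> r / 3"
    using cont[of "r / 3"] r by auto
  define n where "n = Suc n0"
  have n: "\<bar>h t - h ?p\<bar> \<le> r / 3" if "t \<in> cyl n ?p" for t
    using n0 that cyl_mono[of n0 n ?p] by (auto simp: n_def)
  let ?far = "\<lambda>k. LINT t:half i - cyl n ?p|haar. boltz a \<kappa> (e k) t"
  (* the far part enters with the factor 2 * B, and 2 * B * (r / (6 * B + 3)) is at most r / 3 *)
  have "\<forall>\<^sub>F k in sequentially. \<bar>?far k / partition_fn a \<kappa> i (e k)\<bar> < r / (6 * B + 3)"
    using tendstoD[OF far_mass_vanishes[OF e], of "r / (6 * B + 3)"] r B0 by simp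
  then obtain k0 where k0: "\<And>k. k \<ge> k0 \<Longrightarrow> \<bar>?far k / partition_fn a \<kappa> i (e k)\<bar> < r / (6 * B + 3)"
    unfolding eventually_sequentially by blast
  show "\<exists>k0. \<forall>k\<ge>k0. norm ((LINT t:half i|haar. h t * boltz a \<kappa> (e k) t) / partition_fn a \<kappa> i (e k) - h ?p) < r"
  proof (intro exI allI impI)
    fix k assume k: "k \<ge> k0"
    let ?f = "boltz a \<kappa> (e k)" and ?Z = "partition_fn a \<kappa> i (e k)"
    have Z: "0 < ?Z" using partition_fn_pos[OF e(1)] .
    have hm: "(\<lambda>t. h t - h ?p) \<in> borel_measurable haar" by measurable
    have hb: "\<bar>h t - h ?p\<bar> \<le> 2 * B" for t
      using B[of ?p] B[of t] by linarith
    note hp = hm hb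
    have pw: "\<bar>indicator (half i) t *\<^sub>R ((h t - h ?p) * ?f t)\<bar>
        \<le> r / 3 * (indicator (half i) t *\<^sub>R ?f t) + 2 * B * (indicator (half i - cyl n ?p) t *\<^sub>R ?f t)" for t
    proof (cases "t \<in> half i")
      case True
      have f: "0 \<le> ?f t" using boltz_pos[of "e k" t] by simp
      show ?thesis
      proof (cases "t \<in> cyl n ?p")
        case c: True
        then show ?thesis
          using True f mult_right_mono[OF n[OF c] f] by (simp add: abs_mult)
      next
        case c: False
        have "\<bar>h t - h ?p\<bar> * ?f t \<le> 2 * B * ?f t" by (intro mult_right_mono hp f)
        moreover have "0 \<le> r / 3 * ?f t" using r f by simp
        ultimately show ?thesis using True c f by (simp add: abs_mult)
      qed
    qed simp
    have far: "half i - cyl n ?p \<in> sets haar" by measurable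
    note int1 = set_integrable_boltz1[OF e(1)[of k] half_sets, unfolded set_integrable_def]
    note int2 = set_integrable_boltz1[OF e(1)[of k] far, unfolded set_integrable_def]
    note int3 = set_integrable_boltz[OF e(1)[of k] half_sets hp, unfolded set_integrable_def]
    have "\<bar>LINT t:half i|haar. (h t - h ?p) * ?f t\<bar> \<le>
      (\<integral>t. \<bar>indicator (half i) t *\<^sub>R ((h t - h ?p) * ?f t)\<bar> \<partial>haar)"
      unfolding set_lebesgue_integral_def by (rule integral_abs_bound)
    also have "\<dots> \<le> (\<integral>t. r / 3 * (indicator (half i) t *\<^sub>R ?f t) + 2 * B * (indicator (half i - cyl n ?p) t *\<^sub>R ?f t) \<partial>haar)"
      using int1 int2 int3 pw
      by (intro integral_mono integrable_abs Bochner_Integration.integrable_add integrable_mult_right) auto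
    also have "\<dots> = r / 3 * ?Z + 2 * B * ?far k"
      unfolding partition_fn_def set_lebesgue_integral_def
      using int1 int2 by (simp only: Bochner_Integration.integral_add integrable_mult_right integral_mult_right_zero)
    finally have bound: "\<bar>LINT t:half i|haar. (h t - h ?p) * ?f t\<bar> \<le> r / 3 * ?Z + 2 * B * ?far k" .
    have "(LINT t:half i|haar. (h t - h ?p) * ?f t) = (LINT t:half i|haar. h t * ?f t) - h ?p * ?Z"
    proof -
      have "set_integrable haar (half i) (\<lambda>t. h t * ?f t)"
        by (rule set_integrable_boltz[OF e(1) half_sets h B])
      moreover have "set_integrable haar (half i) (\<lambda>t. h ?p * ?f t)"
        by (rule set_integrable_boltz[OF e(1) half_sets, of _ "\<bar>h ?p\<bar>"]) auto
      ultimately show ?thesis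
        unfolding partition_fn_def left_diff_distrib
        by (subst set_integral_diff) auto
    qed
    then have "\<bar>(LINT t:half i|haar. h t * ?f t) / ?Z - h ?p\<bar> = \<bar>LINT t:half i|haar. (h t - h ?p) * ?f t\<bar> / ?Z"
      using Z by (simp add: field_simps abs_div_pos[symmetric] flip: abs_divide)
    also have "\<dots> \<le> (r / 3 * ?Z + 2 * B * ?far k) / ?Z"
      using bound Z by (intro divide_right_mono) auto
    also have "\<dots> = r / 3 + 2 * B * (?far k / ?Z)" using Z by (simp add: field_simps)
    also have "\<dots> \<le> r / 3 + 2 * B * (r / (6 * B + 3))"
      using k0[OF k] B0 by (intro add_left_mono mult_left_mono) (auto dest: abs_less_iff[THEN iffD1] simp del: abs_divide)
    also have "2 * B * (r / (6 * B + 3)) \<le> r / 3"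
      using B0 r by (simp add: field_simps)
    finally show "norm ((LINT t:half i|haar. h t * ?f t) / ?Z - h ?p) < r" using r by simp
  qed
qed

end

section \<open>The Gibbs plan\<close>

text \<open>Density of \<open>t = y - x\<close> given \<open>x\<close>: choose the half of \<open>t\<close> with probabilities \<open>w\<close> and \<open>1 - w\<close>, then draw \<open>t\<close>
from the normalised Boltzmann measure on that half.\<close>

definition gibbs_kernel :: "real \<Rightarrow> real \<Rightarrow> real \<Rightarrow> cantor \<Rightarrow> cantor \<Rightarrow> real" where
  "gibbs_kernel a \<beta> \<epsilon> x t = boltz a (gam \<beta> x) \<epsilon> t *
     ((if t 0 = 0 then weight a \<beta> \<epsilon> else 1 - weight a \<beta> \<epsilon>) / partition_fn a (gam \<beta> x) (t 0) \<epsilon>)"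

definition gibbs_plan :: "real \<Rightarrow> real \<Rightarrow> real \<Rightarrow> (cantor \<times> cantor) measure" where
  "gibbs_plan a \<beta> \<epsilon> = density (haar \<Otimes>\<^sub>M haar) (\<lambda>z. gibbs_kernel a \<beta> \<epsilon> (fst z) (snd z - fst z))"

lemma sets_gibbs_plan [simp, measurable_cong]: "sets (gibbs_plan a \<beta> \<epsilon>) = sets (haar \<Otimes>\<^sub>M haar)"
  by (simp add: gibbs_plan_def)

lemma nn_integral_translate:
  assumes [measurable]: "g \<in> borel_measurable haar"
  shows "(\<integral>\<^sup>+y. g y \<partial>haar) = (\<integral>\<^sup>+t. g (x + t) \<partial>haar)"
proof -
  have "(\<integral>\<^sup>+y. g y \<partial>haar) = (\<integral>\<^sup>+y. g y \<partial>distr haar haar (\<lambda>t. t + x))"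
    by (simp only: haar_translate)
  also have "\<dots> = (\<integral>\<^sup>+t. g (t + x) \<partial>haar)"
    by (subst nn_integral_distr) auto
  finally show ?thesis by (simp only: add.commute)
qed

lemma integral_translate:
  fixes g :: "cantor \<Rightarrow> real"
  assumes [measurable]: "g \<in> borel_measurable haar"
  shows "(\<integral>y. g y \<partial>haar) = (\<integral>t. g (x + t) \<partial>haar)"
proof -
  have "(\<integral>y. g y \<partial>haar) = (\<integral>y. g y \<partial>distr haar haar (\<lambda>t. t + x))"
    by (simp only: haar_translate)
  also have "\<dots> = (\<integral>t. g (t + x) \<partial>haar)"
    by (subst integral_distr) auto
  finally show ?thesis by (simp only: add.commute)
qed

text \<open>Every function of two bits is given by a finite table.\<close>

lemma measurable_two_bits:
  fixes c :: "bit \<Rightarrow> bit \<Rightarrow> real"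
  assumes u: "u \<in> measurable M (count_space UNIV)" and v: "v \<in> measurable M (count_space UNIV)"
  shows "(\<lambda>z. c (u z) (v z)) \<in> borel_measurable M"
proof -
  have eq: "c (u z) (v z) = (if u z = 0 then if v z = 0 then c 0 0 else c 0 1
      else if v z = 0 then c 1 0 else c 1 1)" for z
    by (cases "u z"; cases "v z") simp_all
  have zero: "{z \<in> space M. x z = 0} \<in> sets M" if "x \<in> measurable M (count_space UNIV)" for x :: "'a \<Rightarrow> bit"
    using measurable_sets[OF that, of "{0}"] by (simp add: vimage_def Int_def conj_commute)
  show ?thesis unfolding eq
    by (intro measurable_If zero u v borel_measurable_const)
qed

lemma measurable_first_coords:
  fixes c :: "bit \<Rightarrow> bit \<Rightarrow> real"
  assumes f: "f \<in> measurable M haar" and g: "g \<in> measurable M haar"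
  shows "(\<lambda>z. c (f z 0) (g z 0)) \<in> borel_measurable M"
  by (rule measurable_two_bits[OF measurable_compose[OF f measurable_haar_coord]
        measurable_compose[OF g measurable_haar_coord]])

lemma translate_diff: "(x + t :: cantor) - x = t" "y - (y + t :: cantor) = t"
  unfolding diff_eq_iff by (simp_all add: add.assoc)

context
  fixes a \<beta> :: real
  assumes a: "0 < a" "a < 1" and \<beta>: "0 < \<beta>"
begin

lemma gam_pos: "0 < gam \<beta> x"
  using gam_bounds(1)[OF a \<beta>] .

lemmas Z_pos = partition_fn_pos[OF a gam_pos]

lemma weight_bounds:
  assumes "0 < \<epsilon>" shows "0 < weight a \<beta> \<epsilon>" "weight a \<beta> \<epsilon> < 1"
proof -
  define A where "A = sqrt (I_int a 0 \<epsilon> * J_int a \<beta> 0 \<epsilon>)"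
  define B where "B = sqrt (I_int a 1 \<epsilon> * J_int a \<beta> 1 \<epsilon>)"
  have "0 < A" "0 < B"
    unfolding A_def B_def I_int_partition_fn J_int_partition_fn
    using partition_fn_pos[OF a zero_less_one assms] partition_fn_pos[OF a \<beta> assms] by simp_all
  then show "0 < weight a \<beta> \<epsilon>" "weight a \<beta> \<epsilon> < 1"
    unfolding weight_def Let_def A_def[symmetric] B_def[symmetric] by simp_all
qed

text \<open>The weight is defined so that the symmetric doubly stochastic matrix with entries \<open>w\<close> and \<open>1 - w\<close> has the
same cross-ratio as the matrix of partition functions. This is what turns the Gibbs kernel into a
density of product form.\<close>

lemma weight_balance:
  assumes "0 < \<epsilon>"
  shows "(weight a \<beta> \<epsilon>)\<^sup>2 * (partition_fn a 1 1 \<epsilon> * partition_fn a \<beta> 1 \<epsilon>)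
    = (1 - weight a \<beta> \<epsilon>)\<^sup>2 * (partition_fn a 1 0 \<epsilon> * partition_fn a \<beta> 0 \<epsilon>)"
proof -
  define A where "A = sqrt (I_int a 0 \<epsilon> * J_int a \<beta> 0 \<epsilon>)"
  define B where "B = sqrt (I_int a 1 \<epsilon> * J_int a \<beta> 1 \<epsilon>)"
  have P: "0 < partition_fn a 1 i \<epsilon> * partition_fn a \<beta> i \<epsilon>" for i
    using partition_fn_pos[OF a zero_less_one assms] partition_fn_pos[OF a \<beta> assms] by simp
  have AB: "0 < A" "0 < B"
    unfolding A_def B_def I_int_partition_fn J_int_partition_fn real_sqrt_gt_0_iff by (rule P)+
  have sq: "partition_fn a 1 0 \<epsilon> * partition_fn a \<beta> 0 \<epsilon> = A\<^sup>2"
    "partition_fn a 1 1 \<epsilon> * partition_fn a \<beta> 1 \<epsilon> = B\<^sup>2"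
    unfolding A_def B_def I_int_partition_fn J_int_partition_fn
    by (rule real_sqrt_pow2[OF less_imp_le[OF P], symmetric])+
  have w: "weight a \<beta> \<epsilon> = A / (A + B)" by (simp only: weight_def Let_def A_def B_def)
  then have "1 - weight a \<beta> \<epsilon> = B / (A + B)" using AB by (simp add: field_simps)
  then show ?thesis unfolding sq w by (simp add: power_divide)
qed

lemma kernel_nonneg: "0 < \<epsilon> \<Longrightarrow> 0 \<le> gibbs_kernel a \<beta> \<epsilon> x t"
  unfolding gibbs_kernel_def
  using weight_bounds[of \<epsilon>] Z_pos[of \<epsilon> x "t 0"] boltz_pos[of a "gam \<beta> x" \<epsilon> t] gam_pos[of x]
  by (auto simp: boltz_def)

lemma measurable_kernel:
  assumes f: "f \<in> measurable M haar" and g: "g \<in> measurable M haar"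
  shows "(\<lambda>z. gibbs_kernel a \<beta> \<epsilon> (f z) (g z)) \<in> borel_measurable M"
proof -
  have "(\<lambda>z. gam \<beta> (f z)) \<in> borel_measurable M" "(\<lambda>z. Wfun a (g z)) \<in> borel_measurable M"
    using measurable_compose[OF f measurable_gam] measurable_compose[OF g measurable_Wfun[OF a]] .
  then have b: "(\<lambda>z. boltz a (gam \<beta> (f z)) \<epsilon> (g z)) \<in> borel_measurable M"
    unfolding boltz_def by measurable
  have "(\<lambda>z. (if g z 0 = 0 then weight a \<beta> \<epsilon> else 1 - weight a \<beta> \<epsilon>) /
      partition_fn a (if f z 0 = 0 then 1 else \<beta>) (g z 0) \<epsilon>) \<in> borel_measurable M"
    by (rule measurable_first_coords[OF f g, where c = "\<lambda>b i. (if i = 0 then weight a \<beta> \<epsilon> else 1 - weight a \<beta> \<epsilon>) /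
      partition_fn a (if b = 0 then 1 else \<beta>) i \<epsilon>"])
  from borel_measurable_times[OF b this] show ?thesis
    unfolding gibbs_kernel_def by (simp only: gam_def coord_1)
qed

lemma kernel_split:
  "h t * gibbs_kernel a \<beta> \<epsilon> x t =
     weight a \<beta> \<epsilon> * (indicator (half 0) t *\<^sub>R (h t * boltz a (gam \<beta> x) \<epsilon> t) / partition_fn a (gam \<beta> x) 0 \<epsilon>) +
     (1 - weight a \<beta> \<epsilon>) * (indicator (half 1) t *\<^sub>R (h t * boltz a (gam \<beta> x) \<epsilon> t) / partition_fn a (gam \<beta> x) 1 \<epsilon>)"
  by (cases "t 0") (simp_all add: gibbs_kernel_def)

lemma kernel_integral:
  assumes \<epsilon>: "0 < \<epsilon>" and h: "h \<in> borel_measurable haar" and B: "\<And>t. \<bar>h t\<bar> \<le> B"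
  shows "integrable haar (\<lambda>t. h t * gibbs_kernel a \<beta> \<epsilon> x t)"
    "(\<integral>t. h t * gibbs_kernel a \<beta> \<epsilon> x t \<partial>haar) =
      weight a \<beta> \<epsilon> * ((LINT t:half 0|haar. h t * boltz a (gam \<beta> x) \<epsilon> t) / partition_fn a (gam \<beta> x) 0 \<epsilon>) +
      (1 - weight a \<beta> \<epsilon>) * ((LINT t:half 1|haar. h t * boltz a (gam \<beta> x) \<epsilon> t) / partition_fn a (gam \<beta> x) 1 \<epsilon>)"
proof -
  have int: "integrable haar (\<lambda>t. indicator (half i) t *\<^sub>R (h t * boltz a (gam \<beta> x) \<epsilon> t))" for i
    using set_integrable_boltz[OF a gam_pos \<epsilon> half_sets h B] unfolding set_integrable_def .
  show "integrable haar (\<lambda>t. h t * gibbs_kernel a \<beta> \<epsilon> x t)"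
    unfolding kernel_split
    by (intro Bochner_Integration.integrable_add integrable_mult_right integrable_divide int)
  show "(\<integral>t. h t * gibbs_kernel a \<beta> \<epsilon> x t \<partial>haar) =
      weight a \<beta> \<epsilon> * ((LINT t:half 0|haar. h t * boltz a (gam \<beta> x) \<epsilon> t) / partition_fn a (gam \<beta> x) 0 \<epsilon>) +
      (1 - weight a \<beta> \<epsilon>) * ((LINT t:half 1|haar. h t * boltz a (gam \<beta> x) \<epsilon> t) / partition_fn a (gam \<beta> x) 1 \<epsilon>)"
    unfolding kernel_split set_lebesgue_integral_def
    by (subst Bochner_Integration.integral_add)
      (intro integrable_mult_right integrable_divide int, intro integrable_mult_right integrable_divide int,
       simp only: integral_mult_right_zero integral_divide_zero)
qed

lemma kernel_mass:
  assumes \<epsilon>: "0 < \<epsilon>"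
  shows "integrable haar (gibbs_kernel a \<beta> \<epsilon> x)" "(\<integral>t. gibbs_kernel a \<beta> \<epsilon> x t \<partial>haar) = 1"
proof -
  have one: "(\<lambda>_ :: cantor. 1 :: real) \<in> borel_measurable haar" "\<And>t :: cantor. \<bar>1 :: real\<bar> \<le> 1" by auto
  show "integrable haar (gibbs_kernel a \<beta> \<epsilon> x)"
    using kernel_integral(1)[OF \<epsilon> one] by simp
  show "(\<integral>t. gibbs_kernel a \<beta> \<epsilon> x t \<partial>haar) = 1"
    using kernel_integral(2)[OF \<epsilon> one, of x] Z_pos[OF \<epsilon>, of x 0] Z_pos[OF \<epsilon>, of x 1]
    by (simp add: partition_fn_def[symmetric])
qed

lemma nn_kernel_mass:
  assumes \<epsilon>: "0 < \<epsilon>"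
  shows "(\<integral>\<^sup>+t. gibbs_kernel a \<beta> \<epsilon> x t \<partial>haar) = 1"
  using kernel_mass[OF \<epsilon>, of x] kernel_nonneg[OF \<epsilon>] by (subst nn_integral_eq_integral) auto

text \<open>Given \<open>y\<close>, the first coordinate of \<open>x = y + t\<close> is constant for \<open>t\<close> in each half. The total mass is again
\<open>w + (1 - w)\<close>, now with the partition functions of \<open>y\<close> and of \<open>y + t0\<close>; hence the second marginal is
Haar measure as well.\<close>

lemma nn_kernel_mass_transposed:
  assumes \<epsilon>: "0 < \<epsilon>"
  shows "(\<integral>\<^sup>+t. gibbs_kernel a \<beta> \<epsilon> (y + t) t \<partial>haar) = 1"
proof -
  let ?w = "weight a \<beta> \<epsilon>"
  have split: "gibbs_kernel a \<beta> \<epsilon> (y + t) t =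
     ?w * (indicator (half 0) t *\<^sub>R boltz a (gam \<beta> y) \<epsilon> t / partition_fn a (gam \<beta> y) 0 \<epsilon>) +
     (1 - ?w) * (indicator (half 1) t *\<^sub>R boltz a (gam \<beta> (y + t0)) \<epsilon> t / partition_fn a (gam \<beta> (y + t0)) 1 \<epsilon>)" for t
    by (cases "t 0") (simp_all add: gibbs_kernel_def gam_def t0_def)
  have int: "integrable haar (\<lambda>t. indicator (half i) t *\<^sub>R boltz a (gam \<beta> x) \<epsilon> t)" for i x
    using set_integrable_boltz1[OF a gam_pos \<epsilon> half_sets] unfolding set_integrable_def .
  have "integrable haar (\<lambda>t. gibbs_kernel a \<beta> \<epsilon> (y + t) t)"
    unfolding split
    by (intro Bochner_Integration.integrable_add integrable_mult_right integrable_divide int)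
  moreover have "(\<integral>t. gibbs_kernel a \<beta> \<epsilon> (y + t) t \<partial>haar) =
      ?w * (partition_fn a (gam \<beta> y) 0 \<epsilon> / partition_fn a (gam \<beta> y) 0 \<epsilon>) +
      (1 - ?w) * (partition_fn a (gam \<beta> (y + t0)) 1 \<epsilon> / partition_fn a (gam \<beta> (y + t0)) 1 \<epsilon>)"
    unfolding split partition_fn_def set_lebesgue_integral_def
    by (subst Bochner_Integration.integral_add)
      (intro integrable_mult_right integrable_divide int, intro integrable_mult_right integrable_divide int,
       simp only: integral_mult_right_zero integral_divide_zero)
  moreover have "\<dots> = 1"
    using Z_pos[OF \<epsilon>, of y 0] Z_pos[OF \<epsilon>, of "y + t0" 1] by simp
  ultimately show ?thesis
    using kernel_nonneg[OF \<epsilon>] by (subst nn_integral_eq_integral) auto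
qed

lemma gibbs_plan_coupling:
  assumes \<epsilon>: "0 < \<epsilon>"
  shows "gibbs_plan a \<beta> \<epsilon> \<in> couplings haar haar"
proof -
  let ?K = "\<lambda>x y. gibbs_kernel a \<beta> \<epsilon> x (y - x)"
  note measurable_kernel[measurable]
  have fst: "distr (gibbs_plan a \<beta> \<epsilon>) haar fst = haar"
  proof (rule measure_eqI)
    fix A assume "A \<in> sets (distr (gibbs_plan a \<beta> \<epsilon>) haar fst)"
    then have A [measurable]: "A \<in> sets haar" by simp
    have [simp]: "fst -` A \<in> sets (haar \<Otimes>\<^sub>M haar)"
      using measurable_sets[OF measurable_fst A, of haar] by (simp add: space_pair_measure)
    have "emeasure (distr (gibbs_plan a \<beta> \<epsilon>) haar fst) A =
        emeasure (gibbs_plan a \<beta> \<epsilon>) (fst -` A \<inter> space (gibbs_plan a \<beta> \<epsilon>))"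
      by (rule emeasure_distr) auto
    also have "\<dots> = (\<integral>\<^sup>+z. ennreal (?K (fst z) (snd z)) * indicator A (fst z) \<partial>(haar \<Otimes>\<^sub>M haar))"
      unfolding gibbs_plan_def
      by (subst emeasure_density) (auto intro!: nn_integral_cong simp: space_pair_measure indicator_def)
    also have "\<dots> = (\<integral>\<^sup>+x. \<integral>\<^sup>+y. ennreal (?K x y) * indicator A x \<partial>haar \<partial>haar)"
      by (subst haar.nn_integral_fst[symmetric]) auto
    also have "\<dots> = (\<integral>\<^sup>+x. indicator A x \<partial>haar)"
    proof (rule nn_integral_cong)
      fix x
      have "(\<integral>\<^sup>+y. ennreal (?K x y) * indicator A x \<partial>haar) = (\<integral>\<^sup>+y. ennreal (?K x y) \<partial>haar) * indicator A x"
        by (subst nn_integral_multc) auto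
      also have "(\<integral>\<^sup>+y. ennreal (?K x y) \<partial>haar) = (\<integral>\<^sup>+t. ennreal (?K x (x + t)) \<partial>haar)"
        by (rule nn_integral_translate) measurable
      also have "\<dots> = 1" unfolding translate_diff by (rule nn_kernel_mass[OF \<epsilon>])
      finally show "(\<integral>\<^sup>+y. ennreal (?K x y) * indicator A x \<partial>haar) = indicator A x" by (simp only: mult_1_left)
    qed
    finally show "emeasure (distr (gibbs_plan a \<beta> \<epsilon>) haar fst) A = emeasure haar A" by simp
  qed simp
  have snd: "distr (gibbs_plan a \<beta> \<epsilon>) haar snd = haar"
  proof (rule measure_eqI)
    fix A assume "A \<in> sets (distr (gibbs_plan a \<beta> \<epsilon>) haar snd)"
    then have A [measurable]: "A \<in> sets haar" by simp
    have [simp]: "snd -` A \<in> sets (haar \<Otimes>\<^sub>M haar)"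
      using measurable_sets[OF measurable_snd A, of haar] by (simp add: space_pair_measure)
    have "emeasure (distr (gibbs_plan a \<beta> \<epsilon>) haar snd) A =
        emeasure (gibbs_plan a \<beta> \<epsilon>) (snd -` A \<inter> space (gibbs_plan a \<beta> \<epsilon>))"
      by (rule emeasure_distr) auto
    also have "\<dots> = (\<integral>\<^sup>+z. ennreal (?K (fst z) (snd z)) * indicator A (snd z) \<partial>(haar \<Otimes>\<^sub>M haar))"
      unfolding gibbs_plan_def
      by (subst emeasure_density) (auto intro!: nn_integral_cong simp: space_pair_measure indicator_def)
    also have "\<dots> = (\<integral>\<^sup>+y. \<integral>\<^sup>+x. ennreal (?K x y) * indicator A y \<partial>haar \<partial>haar)"
      by (subst haar2.nn_integral_snd[symmetric]) auto
    also have "\<dots> = (\<integral>\<^sup>+y. indicator A y \<partial>haar)"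
    proof (rule nn_integral_cong)
      fix y
      have "(\<integral>\<^sup>+x. ennreal (?K x y) * indicator A y \<partial>haar) = (\<integral>\<^sup>+x. ennreal (?K x y) \<partial>haar) * indicator A y"
        by (subst nn_integral_multc) auto
      also have "(\<integral>\<^sup>+x. ennreal (?K x y) \<partial>haar) = (\<integral>\<^sup>+t. ennreal (?K (y + t) y) \<partial>haar)"
        by (rule nn_integral_translate) measurable
      also have "\<dots> = 1" unfolding translate_diff by (rule nn_kernel_mass_transposed[OF \<epsilon>])
      finally show "(\<integral>\<^sup>+x. ennreal (?K x y) * indicator A y \<partial>haar) = indicator A y" by (simp only: mult_1_left)
    qed
    finally show "emeasure (distr (gibbs_plan a \<beta> \<epsilon>) haar snd) A = emeasure haar A" by simp
  qed simp
  show ?thesis unfolding couplings_def using fst snd by simp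
qed

text \<open>The normalising factors depend on the first coordinates of \<open>x\<close> and \<open>y\<close> only. They form a table
\<open>c00, c01, c10, c11\<close>, and a positive two by two table is a product of a row factor and a column factor
exactly if \<open>c00 * c11 = c01 * c10\<close>, which is the balance identity of the weight.\<close>

lemma gibbs_plan_exponential_form:
  assumes \<epsilon>: "0 < \<epsilon>"
  obtains \<phi> \<psi> p q where "\<phi> \<in> borel_measurable haar" "\<And>x. \<bar>\<phi> x\<bar> \<le> p"
    "\<psi> \<in> borel_measurable haar" "\<And>y. \<bar>\<psi> y\<bar> \<le> q"
    "\<And>x y. gibbs_kernel a \<beta> \<epsilon> x (y - x) = exp (\<phi> x + \<psi> y - cantor_cost a \<beta> (x, y) / \<epsilon>)"
proof -
  define w where "w = weight a \<beta> \<epsilon>"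
  have w: "0 < w" "0 < 1 - w" using weight_bounds[OF \<epsilon>] by (auto simp: w_def)
  define c00 where "c00 = w / partition_fn a 1 0 \<epsilon>"
  define c01 where "c01 = (1 - w) / partition_fn a 1 1 \<epsilon>"
  define c10 where "c10 = (1 - w) / partition_fn a \<beta> 1 \<epsilon>"
  define c11 where "c11 = w / partition_fn a \<beta> 0 \<epsilon>"
  have Z: "0 < partition_fn a 1 i \<epsilon>" "0 < partition_fn a \<beta> i \<epsilon>" for i
    using partition_fn_pos[OF a zero_less_one \<epsilon>] partition_fn_pos[OF a \<beta> \<epsilon>] by auto
  have c: "0 < c00" "0 < c01" "0 < c10" "0 < c11"
    using w Z by (simp_all add: c00_def c01_def c10_def c11_def)
  have "w\<^sup>2 * (partition_fn a 1 1 \<epsilon> * partition_fn a \<beta> 1 \<epsilon>) = (1 - w)\<^sup>2 * (partition_fn a 1 0 \<epsilon> * partition_fn a \<beta> 0 \<epsilon>)"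
    using weight_balance[OF \<epsilon>] by (simp add: w_def)
  then have "c00 * c11 = c10 * c01"
    unfolding c00_def c01_def c10_def c11_def using Z[of 0] Z[of 1]
    by (simp add: divide_simps power2_eq_square) (simp add: mult_ac)
  then have bal: "c10 / c00 * c01 = c11" using c by (simp add: field_simps)
  define \<phi> :: "cantor \<Rightarrow> real" where "\<phi> x = (if x 0 = 0 then 0 else ln (c10 / c00))" for x
  define \<psi> :: "cantor \<Rightarrow> real" where "\<psi> y = (if y 0 = 0 then ln c00 else ln c01)" for y
  show ?thesis
  proof
    show "\<phi> \<in> borel_measurable haar" "\<psi> \<in> borel_measurable haar"
      unfolding \<phi>_def \<psi>_def by measurable
    show "\<bar>\<phi> x\<bar> \<le> \<bar>ln (c10 / c00)\<bar>" for x by (simp add: \<phi>_def)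
    show "\<bar>\<psi> y\<bar> \<le> max \<bar>ln c00\<bar> \<bar>ln c01\<bar>" for y by (simp add: \<psi>_def)
    fix x y :: cantor
    let ?b = "boltz a (gam \<beta> x) \<epsilon> (y - x)"
    have "exp (\<phi> x + \<psi> y - cantor_cost a \<beta> (x, y) / \<epsilon>) = exp (\<phi> x) * exp (\<psi> y) * ?b"
      by (simp add: boltz_def cantor_cost_def exp_add exp_diff exp_minus field_simps)
    also have "exp (\<phi> x) * exp (\<psi> y) =
        (if x 0 = 0 then if y 0 = 0 then c00 else c01 else if y 0 = 0 then c10 else c11)"
      using c bal by (auto simp: \<phi>_def \<psi>_def)
    also have "\<dots> * ?b = gibbs_kernel a \<beta> \<epsilon> x (y - x)"
      by (cases "x 0"; cases "y 0")
        (simp_all add: gibbs_kernel_def gam_def c00_def c01_def c10_def c11_def w_def)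
    finally show "gibbs_kernel a \<beta> \<epsilon> x (y - x) = exp (\<phi> x + \<psi> y - cantor_cost a \<beta> (x, y) / \<epsilon>)" by simp
  qed
qed

lemma entropic_minimiser_eq_gibbs_plan:
  assumes \<epsilon>: "0 < \<epsilon>"
  shows "entropic_minimiser (cantor_cost a \<beta>) haar \<epsilon> = gibbs_plan a \<beta> \<epsilon>"
proof -
  obtain \<phi> \<psi> p q where *: "\<phi> \<in> borel_measurable haar" "\<And>x. \<bar>\<phi> x\<bar> \<le> p"
    "\<psi> \<in> borel_measurable haar" "\<And>y. \<bar>\<psi> y\<bar> \<le> q"
    and K: "\<And>x y. gibbs_kernel a \<beta> \<epsilon> x (y - x) = exp (\<phi> x + \<psi> y - cantor_cost a \<beta> (x, y) / \<epsilon>)"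
    using gibbs_plan_exponential_form[OF \<epsilon>] by metis
  show ?thesis
  proof (rule entropic_minimiser_gibbs[OF prob_space_haar \<epsilon> measurable_cantor_cost[OF a] _ *])
    show "\<bar>cantor_cost a \<beta> z\<bar> \<le> 2 * max 1 \<beta>" for z
      using cantor_cost_bounds[OF a \<beta>, of z] by linarith
    show "gibbs_plan a \<beta> \<epsilon> = density (haar \<Otimes>\<^sub>M haar)
        (\<lambda>z. exp (\<phi> (fst z) + \<psi> (snd z) - cantor_cost a \<beta> z / \<epsilon>))"
      unfolding gibbs_plan_def K by simp
    show "gibbs_plan a \<beta> \<epsilon> \<in> couplings haar haar" by (rule gibbs_plan_coupling[OF \<epsilon>])
  qed
qed

lemma gibbs_plan_integral:
  assumes \<epsilon>: "0 < \<epsilon>" and f [measurable]: "f \<in> borel_measurable (haar \<Otimes>\<^sub>M haar)"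
    and B: "\<And>z. \<bar>f z\<bar> \<le> B"
  shows "(\<integral>z. f z \<partial>gibbs_plan a \<beta> \<epsilon>) =
    (\<integral>x. \<integral>t. f (x, x + t) * gibbs_kernel a \<beta> \<epsilon> x t \<partial>haar \<partial>haar)"
proof -
  note measurable_kernel[measurable]
  interpret G: prob_space "gibbs_plan a \<beta> \<epsilon>"
    by (rule prob_space_coupling[OF prob_space_haar gibbs_plan_coupling[OF \<epsilon>]])
  have int: "integrable (haar \<Otimes>\<^sub>M haar) (\<lambda>z. f z * gibbs_kernel a \<beta> \<epsilon> (fst z) (snd z - fst z))"
  proof -
    have "integrable (gibbs_plan a \<beta> \<epsilon>) f"
      by (rule G.integrable_const_bound[where B = B]) (use B in auto)
    then show ?thesis
      unfolding gibbs_plan_def using kernel_nonneg[OF \<epsilon>]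
      by (subst (asm) integrable_density) (auto simp: mult.commute)
  qed
  have "(\<integral>z. f z \<partial>gibbs_plan a \<beta> \<epsilon>) =
      (\<integral>z. f z * gibbs_kernel a \<beta> \<epsilon> (fst z) (snd z - fst z) \<partial>(haar \<Otimes>\<^sub>M haar))"
    unfolding gibbs_plan_def using kernel_nonneg[OF \<epsilon>]
    by (subst integral_density) (auto simp: mult.commute)
  also have "\<dots> = (\<integral>x. \<integral>y. f (x, y) * gibbs_kernel a \<beta> \<epsilon> x (y - x) \<partial>haar \<partial>haar)"
    using haar2.integral_fst'[OF int] by simp
  also have "\<dots> = (\<integral>x. \<integral>t. f (x, x + t) * gibbs_kernel a \<beta> \<epsilon> x (x + t - x) \<partial>haar \<partial>haar)"
    by (intro Bochner_Integration.integral_cong refl integral_translate) measurable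
  finally show ?thesis by (simp only: translate_diff)
qed

end

section \<open>Weak limits of the Gibbs plans\<close>

lemma nn_integral_mix_measure:
  assumes "f \<in> borel_measurable M" and N: "sets N = sets M"
  shows "(\<integral>\<^sup>+x. f x \<partial>mix_measure w M N) = ennreal w * (\<integral>\<^sup>+x. f x \<partial>M) + ennreal (1 - w) * (\<integral>\<^sup>+x. f x \<partial>N)"
  using assms(1)
proof (induction rule: borel_measurable_induct)
  case (cong f g)
  have sp: "space (mix_measure w M N) = space M" "space N = space M"
    by (rule sets_eq_imp_space_eq[OF sets_mix_measure] sets_eq_imp_space_eq[OF N])+
  have "(\<integral>\<^sup>+x. f x \<partial>L) = (\<integral>\<^sup>+x. g x \<partial>L)" if "space L = space M" for L
    using cong(3) that by (intro nn_integral_cong) auto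
  from this[OF sp(1)] this[OF sp(2)] this[of M] show ?case using cong(4) by simp
next
  case (set A)
  then show ?case using N by (simp add: emeasure_mix_measure[OF N])
next
  case (mult u c)
  then show ?case using N
    by (simp add: nn_integral_cmult measurable_cong_sets[OF sets_mix_measure refl] measurable_cong_sets[OF N refl] distrib_left mult_ac)
next
  case (add u v)
  then show ?case using N
    by (simp add: nn_integral_add measurable_cong_sets[OF sets_mix_measure refl] measurable_cong_sets[OF N refl] distrib_left add_ac)
next
  case (seq U)
  have conv: "(\<integral>\<^sup>+x. (SUP i. U i) x \<partial>L) = (SUP i. \<integral>\<^sup>+x. U i x \<partial>L)" if "sets L = sets M" for L
    unfolding SUP_apply using seq that
    by (intro nn_integral_monotone_convergence_SUP) (simp_all add: measurable_cong_sets[OF that refl])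
  have inc: "incseq (\<lambda>i. \<integral>\<^sup>+x. U i x \<partial>L)" for L
    using \<open>incseq U\<close> by (auto simp: incseq_def le_fun_def intro!: nn_integral_mono)
  have incc: "incseq (\<lambda>i. c * (\<integral>\<^sup>+x. U i x \<partial>L))" for L c
    using inc[of L] by (auto simp: incseq_def intro!: mult_left_mono)
  show ?case
    unfolding conv[OF sets_mix_measure] conv[OF N] conv[OF refl] seq.IH SUP_mult_left_ennreal
    by (rule ennreal_SUP_add[OF incc incc])
qed

lemma integral_mix_measure:
  fixes f :: "'a \<Rightarrow> real"
  assumes M: "prob_space M" and N: "prob_space N" "sets N = sets M" and w: "0 \<le> w" "w \<le> 1"
    and f [measurable]: "f \<in> borel_measurable M" and B: "\<And>x. \<bar>f x\<bar> \<le> B"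
  shows "prob_space (mix_measure w M N)"
    "(\<integral>x. f x \<partial>mix_measure w M N) = w * (\<integral>x. f x \<partial>M) + (1 - w) * (\<integral>x. f x \<partial>N)"
proof -
  interpret M: prob_space M by fact
  interpret N: prob_space N by fact
  have spN: "space N = space M" using sets_eq_imp_space_eq[OF N(2)] .
  have spL: "space (mix_measure w M N) = space M" using sets_eq_imp_space_eq[OF sets_mix_measure] .
  have "emeasure (mix_measure w M N) (space M) = ennreal w * 1 + ennreal (1 - w) * 1"
    using emeasure_mix_measure[OF N(2), of "space M" w] M.emeasure_space_1 N.emeasure_space_1 by (simp add: spN)
  also have "\<dots> = 1" using w by (simp flip: ennreal_plus)
  finally show P: "prob_space (mix_measure w M N)" by (intro prob_spaceI) (simp add: spL)
  note N(2)[measurable_cong] sets_mix_measure[of w M N, measurable_cong]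
  (* the shift by B makes the integrand nonnegative *)
  define g where "g x = f x + B" for x
  have g [measurable]: "g \<in> borel_measurable M" unfolding g_def by measurable
  have g0: "0 \<le> g x" for x using B[of x] by (simp add: g_def)
  have gB: "\<bar>g x\<bar> \<le> 2 * B" for x using B[of x] by (simp add: g_def)
  have int: "integrable L f" "integrable L g" and intf: "(\<integral>x. f x \<partial>L) = (\<integral>x. g x \<partial>L) - B"
    if "prob_space L" and s: "sets L = sets M" for L
  proof -
    interpret K: prob_space L by fact
    note s[measurable_cong]
    show "integrable L f" by (rule K.integrable_const_bound[where B = B]) (use B in auto)
    show "integrable L g" by (rule K.integrable_const_bound[where B = "2 * B"]) (use gB in auto)
    show "(\<integral>x. f x \<partial>L) = (\<integral>x. g x \<partial>L) - B"
      using \<open>integrable L f\<close> by (simp add: g_def K.prob_space)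
  qed
  have nn: "(\<integral>\<^sup>+x. ennreal (g x) \<partial>L) = ennreal (\<integral>x. g x \<partial>L)" if "prob_space L" "sets L = sets M" for L
    by (rule nn_integral_eq_integral[OF int(2)[OF that]]) (simp add: g0)
  have pos: "0 \<le> (\<integral>x. g x \<partial>L)" for L by (simp add: g0)
  have "(\<lambda>x. ennreal (g x)) \<in> borel_measurable M" by measurable
  from nn_integral_mix_measure[OF this N(2), of w]
  have "ennreal (\<integral>x. g x \<partial>mix_measure w M N) = ennreal (w * (\<integral>x. g x \<partial>M) + (1 - w) * (\<integral>x. g x \<partial>N))"
    using w pos unfolding nn[OF P sets_mix_measure] nn[OF M refl] nn[OF N]
    by (simp add: ennreal_plus ennreal_mult)
  then have "(\<integral>x. g x \<partial>mix_measure w M N) = w * (\<integral>x. g x \<partial>M) + (1 - w) * (\<integral>x. g x \<partial>N)"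
    using w pos by (subst (asm) ennreal_inj) auto
  then show "(\<integral>x. f x \<partial>mix_measure w M N) = w * (\<integral>x. f x \<partial>M) + (1 - w) * (\<integral>x. f x \<partial>N)"
    unfolding intf[OF P sets_mix_measure] intf[OF M refl] intf[OF N] by (simp add: algebra_simps)
qed

lemma prob_space_graph_coupling: "prob_space (graph_coupling t)"
  unfolding graph_coupling_def by (rule haar.prob_space_distr) measurable

lemma sets_graph_coupling [simp]: "sets (graph_coupling t) = sets (haar \<Otimes>\<^sub>M haar)"
  by (simp add: graph_coupling_def)

lemma P_mix_integral:
  fixes f :: "cantor \<times> cantor \<Rightarrow> real"
  assumes w: "0 \<le> w" "w \<le> 1" and f [measurable]: "f \<in> borel_measurable (haar \<Otimes>\<^sub>M haar)"
    and B: "\<And>z. \<bar>f z\<bar> \<le> B"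
  shows "P_mix w \<in> prob_measures cantor_top2"
    "(\<integral>z. f z \<partial>P_mix w) = (\<integral>x. w * f (x, x) + (1 - w) * f (x, x + t0) \<partial>haar)"
proof -
  have f': "f \<in> borel_measurable (graph_coupling 0)"
    using f by (simp only: measurable_cong_sets[OF sets_graph_coupling refl])
  have se: "sets (graph_coupling t0) = sets (graph_coupling 0)" by simp
  note mix = integral_mix_measure[OF prob_space_graph_coupling prob_space_graph_coupling se w f' B]
  show "P_mix w \<in> prob_measures cantor_top2"
    using mix(1) by (simp add: P_mix_def prob_measures_def sets_haar2_borel)
  have graph: "(\<integral>z. f z \<partial>graph_coupling t) = (\<integral>x. f (x, x + t) \<partial>haar)" for t
    unfolding graph_coupling_def by (rule integral_distr) measurable
  have int: "integrable haar (\<lambda>x. f (x, x + t))" for t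
    by (rule haar.integrable_const_bound[where B = B]) (use B in auto)
  show "(\<integral>z. f z \<partial>P_mix w) = (\<integral>x. w * f (x, x) + (1 - w) * f (x, x + t0) \<partial>haar)"
    unfolding P_mix_def mix(2) graph using int[of 0] int[of t0] by simp
qed

text \<open>A clopen set whose mass under the Gibbs plan is the scalar weight; it lets the weight be read off
from a weak limit.\<close>

definition same_half :: "(cantor \<times> cantor) set" where
  "same_half = {z. fst z 0 = snd z 0}"

lemma same_half_clopen:
  "openin cantor_top2 same_half" "openin cantor_top2 (topspace cantor_top2 - same_half)"
  unfolding openin_cantor2 same_half_def
  by (auto simp: cyl_def intro!: exI[of _ "Suc 0"])

context
  fixes a \<beta> :: real
  assumes a: "0 < a" "a < 1" and \<beta>: "0 < \<beta>"
begin

text \<open>For fixed \<open>x\<close> the inner integral is \<open>w\<close> times a Gibbs average over one half plus \<open>1 - w\<close> times a Gibbs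
average over the other; these averages converge to \<open>f(x, x)\<close> and \<open>f(x, x + t0)\<close>, and dominated
convergence handles the integral over \<open>x\<close>.\<close>

lemma gibbs_plan_weak_limit:
  assumes e: "\<And>k. 0 < e k" "e \<longlonglongrightarrow> 0" and w: "(\<lambda>k. weight a \<beta> (e k)) \<longlonglongrightarrow> w"
  shows "weak_limit cantor_top2 (\<lambda>k. gibbs_plan a \<beta> (e k)) (P_mix w) sequentially"
  unfolding weak_limit_def
proof (intro conjI allI impI)
  have w01: "0 \<le> w" "w \<le> 1"
    by (rule LIMSEQ_le_const[OF w] LIMSEQ_le_const2[OF w],
        use weight_bounds[OF a \<beta> e(1)] less_imp_le in blast)+
  show "P_mix w \<in> prob_measures cantor_top2"
    by (rule P_mix_integral(1)[OF w01, of "\<lambda>_. 0" 0]) auto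
  fix f assume f: "continuous_map cantor_top2 euclideanreal f \<and> bounded (f ` topspace cantor_top2)"
  then have fm [measurable]: "f \<in> borel_measurable (haar \<Otimes>\<^sub>M haar)"
    by (intro continuous_measurable_cantor2) simp
  obtain B where B: "\<And>z. \<bar>f z\<bar> \<le> B"
    using f by (auto simp: bounded_iff)
  note measurable_kernel[OF a \<beta>, measurable]
  have sm: "(\<lambda>t. f (x, x + t)) \<in> borel_measurable haar" for x by measurable
  have pointwise: "(\<lambda>k. \<integral>t. f (x, x + t) * gibbs_kernel a \<beta> (e k) x t \<partial>haar)
      \<longlonglongrightarrow> w * f (x, x) + (1 - w) * f (x, x + t0)" for x
  proof -
    have cont: "\<exists>n. \<forall>t\<in>cyl n (point i). \<bar>f (x, x + t) - f (x, x + point i)\<bar> \<le> \<eta>"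
      if \<eta>: "0 < \<eta>" for i \<eta>
    proof -
      let ?z = "(x, x + point i)"
      have "openin cantor_top2 {z \<in> topspace cantor_top2. f z \<in> ball (f ?z) \<eta>}"
        using f by (intro openin_continuous_map_preimage[of _ euclideanreal]) auto
      from this[unfolded openin_cantor2, rule_format, of ?z]
      obtain n where n: "cyl n x \<times> cyl n (x + point i) \<subseteq> {z. f z \<in> ball (f ?z) \<eta>}"
        using \<eta> by auto
      have "\<bar>f (x, x + t) - f ?z\<bar> \<le> \<eta>" if "t \<in> cyl n (point i)" for t
      proof -
        have "x + t \<in> cyl n (x + point i)" using that by (simp add: cyl_def)
        then have "(x, x + t) \<in> cyl n x \<times> cyl n (x + point i)" by simp
        from subsetD[OF n this] have "(x, x + t) \<in> {z. f z \<in> ball (f ?z) \<eta>}" .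
        then show ?thesis by (simp add: dist_real_def abs_minus_commute)
      qed
      then show ?thesis by blast
    qed
    have avg: "(\<lambda>k. (LINT t:half i|haar. f (x, x + t) * boltz a (gam \<beta> x) (e k) t)
        / partition_fn a (gam \<beta> x) i (e k)) \<longlonglongrightarrow> f (x, x + point i)" for i
      by (rule gibbs_average_tendsto[OF a gam_pos[OF a \<beta>] e sm B cont])
    have "(\<lambda>k. \<integral>t. f (x, x + t) * gibbs_kernel a \<beta> (e k) x t \<partial>haar)
      \<longlonglongrightarrow> w * f (x, x + point 0) + (1 - w) * f (x, x + point 1)"
      unfolding kernel_integral(2)[OF a \<beta> e(1) sm B]
      by (intro tendsto_intros w avg)
    then show ?thesis by (simp add: point_0 point_1)
  qed
  have "(\<lambda>k. \<integral>x. \<integral>t. f (x, x + t) * gibbs_kernel a \<beta> (e k) x t \<partial>haar \<partial>haar)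
     \<longlonglongrightarrow> (\<integral>x. w * f (x, x) + (1 - w) * f (x, x + t0) \<partial>haar)"
  proof (rule integral_dominated_convergence[where w = "\<lambda>_. B"])
    show "AE x in haar. norm (\<integral>t. f (x, x + t) * gibbs_kernel a \<beta> (e k) x t \<partial>haar) \<le> B" for k
    proof (rule AE_I2)
      fix x
      have int: "integrable haar (gibbs_kernel a \<beta> (e k) x)" by (rule kernel_mass(1)[OF a \<beta> e(1)])
      have "\<bar>\<integral>t. f (x, x + t) * gibbs_kernel a \<beta> (e k) x t \<partial>haar\<bar>
          \<le> (\<integral>t. \<bar>f (x, x + t) * gibbs_kernel a \<beta> (e k) x t\<bar> \<partial>haar)"
        by (rule integral_abs_bound)
      also have "\<dots> \<le> (\<integral>t. B * gibbs_kernel a \<beta> (e k) x t \<partial>haar)"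
        using kernel_integral(1)[OF a \<beta> e(1) sm B] int B kernel_nonneg[OF a \<beta> e(1)]
        by (intro integral_mono integrable_abs integrable_mult_right) (auto simp: abs_mult intro!: mult_right_mono)
      also have "\<dots> = B" using kernel_mass(2)[OF a \<beta> e(1)] by simp
      finally show "norm (\<integral>t. f (x, x + t) * gibbs_kernel a \<beta> (e k) x t \<partial>haar) \<le> B" by simp
    qed
    show "AE x in haar. (\<lambda>k. \<integral>t. f (x, x + t) * gibbs_kernel a \<beta> (e k) x t \<partial>haar)
        \<longlonglongrightarrow> w * f (x, x) + (1 - w) * f (x, x + t0)"
      by (intro AE_I2 pointwise)
    show "integrable haar (\<lambda>_. B)" by simp
    show "(\<lambda>x. w * f (x, x) + (1 - w) * f (x, x + t0)) \<in> borel_measurable haar" by measurable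
    show "(\<lambda>x. \<integral>t. f (x, x + t) * gibbs_kernel a \<beta> (e k) x t \<partial>haar) \<in> borel_measurable haar" for k
    proof (rule haar.borel_measurable_lebesgue_integral)
      have "(\<lambda>z. f (fst z, fst z + snd z) * gibbs_kernel a \<beta> (e k) (fst z) (snd z)) \<in> borel_measurable (haar \<Otimes>\<^sub>M haar)"
        by measurable
      then show "(\<lambda>(x, t). f (x, x + t) * gibbs_kernel a \<beta> (e k) x t) \<in> borel_measurable (haar \<Otimes>\<^sub>M haar)"
        by (simp only: split_beta')
    qed
  qed
  then show "(\<lambda>k. \<integral>z. f z \<partial>gibbs_plan a \<beta> (e k)) \<longlonglongrightarrow> (\<integral>z. f z \<partial>P_mix w)"
    unfolding gibbs_plan_integral[OF a \<beta> e(1) fm B] P_mix_integral(2)[OF w01 fm B] .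
qed

lemma gibbs_plan_same_half:
  assumes \<epsilon>: "0 < \<epsilon>"
  shows "(\<integral>z. indicator same_half z \<partial>gibbs_plan a \<beta> \<epsilon>) = weight a \<beta> \<epsilon>"
proof -
  have m: "indicator same_half \<in> borel_measurable (haar \<Otimes>\<^sub>M haar)"
    using openin_cantor2_sets[OF same_half_clopen(1)] by (rule borel_measurable_indicator)
  have ind: "indicator same_half (x, x + t) = (indicator (half 0) t :: real)" for x t
    by (cases "x 0"; cases "t 0") (simp_all add: same_half_def)
  have "(\<integral>z. indicator same_half z \<partial>gibbs_plan a \<beta> \<epsilon>) =
      (\<integral>x. \<integral>t. indicator (half 0) t * gibbs_kernel a \<beta> \<epsilon> x t \<partial>haar \<partial>haar)"
    by (subst gibbs_plan_integral[OF a \<beta> \<epsilon> m, of 1]) (simp_all add: ind)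
  also have "\<dots> = (\<integral>x. weight a \<beta> \<epsilon> \<partial>haar)"
  proof (rule Bochner_Integration.integral_cong[OF refl])
    fix x
    let ?Z = "partition_fn a (gam \<beta> x) 0 \<epsilon>"
    have "(LINT t:half 0|haar. indicator (half 0) t * boltz a (gam \<beta> x) \<epsilon> t) = ?Z"
      unfolding partition_fn_def by (rule set_lebesgue_integral_cong) auto
    moreover have "(LINT t:half 1|haar. indicator (half 0) t * boltz a (gam \<beta> x) \<epsilon> t) = (LINT t:half 1|haar. 0)"
      by (rule set_lebesgue_integral_cong) auto
    ultimately show "(\<integral>t. indicator (half 0) t * gibbs_kernel a \<beta> \<epsilon> x t \<partial>haar) = weight a \<beta> \<epsilon>"
      using kernel_integral(2)[OF a \<beta> \<epsilon>, of "indicator (half 0)" 1 x] Z_pos[OF a \<beta> \<epsilon>, of x 0]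
      by (simp add: set_lebesgue_integral_def)
  qed
  finally show ?thesis using haar.prob_space by simp
qed

end

section \<open>Cluster sets of continuous scalar families\<close>

text \<open>Being a cluster point along some decreasing sequence is the same as being approached at arbitrarily
small parameters: the sequence is chosen recursively, each term below the previous one.\<close>

lemma Clust_LIMSEQ_iff:
  fixes w :: "real \<Rightarrow> real"
  shows "x \<in> Clust LIMSEQ w \<longleftrightarrow> (\<forall>\<delta>>0. \<exists>\<epsilon>. 0 < \<epsilon> \<and> \<epsilon> < \<delta> \<and> \<bar>w \<epsilon> - x\<bar> < \<delta>)"
proof
  assume "x \<in> Clust LIMSEQ w"
  then obtain e where e: "\<And>n. 0 < e n" "e \<longlonglongrightarrow> 0" "(\<lambda>n. w (e n)) \<longlonglongrightarrow> x"
    unfolding Clust_def by blast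
  show "\<forall>\<delta>>0. \<exists>\<epsilon>. 0 < \<epsilon> \<and> \<epsilon> < \<delta> \<and> \<bar>w \<epsilon> - x\<bar> < \<delta>"
  proof (intro allI impI)
    fix \<delta> :: real assume \<delta>: "0 < \<delta>"
    have "\<forall>\<^sub>F n in sequentially. e n < \<delta> \<and> \<bar>w (e n) - x\<bar> < \<delta>"
      using tendstoD[OF e(2) \<delta>] tendstoD[OF e(3) \<delta>]
      by eventually_elim (auto simp: dist_real_def)
    then obtain n where "e n < \<delta>" "\<bar>w (e n) - x\<bar> < \<delta>"
      by (auto simp: eventually_sequentially)
    then show "\<exists>\<epsilon>. 0 < \<epsilon> \<and> \<epsilon> < \<delta> \<and> \<bar>w \<epsilon> - x\<bar> < \<delta>" using e(1) by blast
  qed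
next
  assume R: "\<forall>\<delta>>0. \<exists>\<epsilon>. 0 < \<epsilon> \<and> \<epsilon> < \<delta> \<and> \<bar>w \<epsilon> - x\<bar> < \<delta>"
  define pick where "pick \<delta> = (SOME \<epsilon>. 0 < \<epsilon> \<and> \<epsilon> < \<delta> \<and> \<bar>w \<epsilon> - x\<bar> < \<delta>)" for \<delta>
  have pick: "0 < pick \<delta> \<and> pick \<delta> < \<delta> \<and> \<bar>w (pick \<delta>) - x\<bar> < \<delta>" if "0 < \<delta>" for \<delta>
    unfolding pick_def by (rule someI_ex) (use R that in blast)
  define e where "e = rec_nat (pick 1) (\<lambda>n r. pick (min r (inverse (real (Suc (Suc n))))))"
  have e0: "e 0 = pick 1" and eS: "e (Suc n) = pick (min (e n) (inverse (real (Suc (Suc n)))))" for n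
    by (simp_all add: e_def)
  have pos: "0 < e n" for n
  proof (induction n)
    case 0
    then show ?case using pick[of 1] by (simp add: e0)
  next
    case (Suc n)
    then show ?case using pick[of "min (e n) (inverse (real (Suc (Suc n))))"] by (simp add: eS)
  qed
  have small: "e n < inverse (real (Suc n)) \<and> \<bar>w (e n) - x\<bar> < inverse (real (Suc n))" for n
  proof (cases n)
    case 0
    then show ?thesis using pick[of 1] by (simp add: e0)
  next
    case (Suc m)
    have "0 < min (e m) (inverse (real (Suc (Suc m))))" using pos[of m] by simp
    from pick[OF this] show ?thesis unfolding Suc eS by auto
  qed
  have dec: "decseq e"
  proof (rule decseq_SucI)
    fix n
    have "0 < min (e n) (inverse (real (Suc (Suc n))))" using pos[of n] by simp
    from pick[OF this] show "e (Suc n) \<le> e n" unfolding eS by auto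
  qed
  have inv: "(\<lambda>n. inverse (real (Suc n))) \<longlonglongrightarrow> 0" by (rule LIMSEQ_inverse_real_of_nat)
  have "e \<longlonglongrightarrow> 0"
    by (rule tendsto_sandwich[OF _ _ tendsto_const inv])
      (use pos small less_imp_le in \<open>blast intro: always_eventually\<close>)+
  moreover have "(\<lambda>n. w (e n)) \<longlonglongrightarrow> x"
  proof (rule LIM_zero_cancel, rule tendsto_rabs_zero_cancel)
    show "(\<lambda>n. \<bar>w (e n) - x\<bar>) \<longlonglongrightarrow> 0"
      by (rule tendsto_sandwich[OF _ _ tendsto_const inv])
        (use small less_imp_le in \<open>auto intro!: always_eventually\<close>)
  qed
  ultimately show "x \<in> Clust LIMSEQ w" unfolding Clust_def using pos dec by blast
qed

text \<open>The cluster set is closed and bounded. It is also connected: between parameters where \<open>w\<close> is close to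
two cluster points, the intermediate value theorem produces a parameter at which \<open>w\<close> takes any
prescribed value in between.\<close>

lemma Clust_interval:
  fixes w :: "real \<Rightarrow> real"
  assumes cont: "continuous_on {0<..} w" and b: "\<And>\<epsilon>. 0 < \<epsilon> \<Longrightarrow> 0 \<le> w \<epsilon> \<and> w \<epsilon> \<le> 1"
    and xy: "x \<in> Clust LIMSEQ w" "y \<in> Clust LIMSEQ w" "x < y"
  shows "\<exists>l u. 0 \<le> l \<and> l < u \<and> u \<le> 1 \<and> Clust LIMSEQ w = {l..u}"
proof -
  let ?S = "Clust LIMSEQ w"
  have bounds: "?S \<subseteq> {0..1}"
  proof
    fix z assume z: "z \<in> ?S"
    have "0 \<le> z + \<delta>" "z \<le> 1 + \<delta>" if \<delta>: "0 < \<delta>" for \<delta>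
    proof -
      obtain \<epsilon> where "0 < \<epsilon>" "\<bar>w \<epsilon> - z\<bar> < \<delta>" using z[unfolded Clust_LIMSEQ_iff, rule_format, OF \<delta>] by blast
      then show "0 \<le> z + \<delta>" "z \<le> 1 + \<delta>" using b[of \<epsilon>] by linarith+
    qed
    then have "0 \<le> z" "z \<le> 1" by (auto intro: field_le_epsilon)
    then show "z \<in> {0..1}" by simp
  qed
  have "closed ?S"
    unfolding closed_sequential_limits
  proof (intro allI impI, elim conjE)
    fix s l assume s: "\<forall>n. s n \<in> ?S" "s \<longlonglongrightarrow> l"
    show "l \<in> ?S" unfolding Clust_LIMSEQ_iff
    proof (intro allI impI)
      fix \<delta> :: real assume \<delta>: "0 < \<delta>"
      then have "0 < \<delta> / 2" by simp
      from tendstoD[OF s(2) this] obtain n where n: "\<bar>s n - l\<bar> < \<delta> / 2"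
        by (auto simp: eventually_sequentially dist_real_def)
      obtain \<epsilon> where "0 < \<epsilon>" "\<epsilon> < \<delta> / 2" "\<bar>w \<epsilon> - s n\<bar> < \<delta> / 2"
        using s(1)[rule_format, of n, unfolded Clust_LIMSEQ_iff, rule_format, OF \<open>0 < \<delta> / 2\<close>] by blast
      then show "\<exists>\<epsilon>. 0 < \<epsilon> \<and> \<epsilon> < \<delta> \<and> \<bar>w \<epsilon> - l\<bar> < \<delta>"
        using n \<delta> by (intro exI[of _ \<epsilon>]) linarith
    qed
  qed
  then have "compact ?S"
    using bounds bounded_subset[OF bounded_closed_interval] by (auto simp: compact_eq_bounded_closed)
  moreover have "connected ?S"
    unfolding is_interval_connected_1[symmetric] is_interval_1
  proof (intro ballI allI impI)
    fix p q z assume pq: "p \<in> ?S" "q \<in> ?S" "p \<le> z \<and> z \<le> q"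
    show "z \<in> ?S"
    proof (cases "z = p \<or> z = q")
      case False
      then have z: "p < z" "z < q" using pq by auto
      show ?thesis unfolding Clust_LIMSEQ_iff
      proof (intro allI impI)
        fix \<delta> :: real assume \<delta>: "0 < \<delta>"
        have m: "0 < min \<delta> (z - p)" "0 < min \<delta> (q - z)" using \<delta> z by auto
        obtain \<epsilon>1 where 1: "0 < \<epsilon>1" "\<epsilon>1 < min \<delta> (z - p)" "\<bar>w \<epsilon>1 - p\<bar> < min \<delta> (z - p)"
          using pq(1)[unfolded Clust_LIMSEQ_iff, rule_format, OF m(1)] by blast
        obtain \<epsilon>2 where 2: "0 < \<epsilon>2" "\<epsilon>2 < min \<delta> (q - z)" "\<bar>w \<epsilon>2 - q\<bar> < min \<delta> (q - z)"
          using pq(2)[unfolded Clust_LIMSEQ_iff, rule_format, OF m(2)] by blast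
        have "connected {0<..<\<delta>}" by simp
        moreover have "continuous_on {0<..<\<delta>} w" by (rule continuous_on_subset[OF cont]) auto
        ultimately have "connected (w ` {0<..<\<delta>})" by (rule connected_continuous_image[rotated])
        then have "is_interval (w ` {0<..<\<delta>})" by (simp add: is_interval_connected_1)
        moreover have "w \<epsilon>1 \<in> w ` {0<..<\<delta>}" "w \<epsilon>2 \<in> w ` {0<..<\<delta>}" using 1 2 by auto
        moreover have "w \<epsilon>1 \<le> z" "z \<le> w \<epsilon>2" using 1 2 by linarith+
        ultimately have "z \<in> w ` {0<..<\<delta>}" unfolding is_interval_1 by blast
        then show "\<exists>\<epsilon>. 0 < \<epsilon> \<and> \<epsilon> < \<delta> \<and> \<bar>w \<epsilon> - z\<bar> < \<delta>" using \<delta> by auto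
      qed
    qed (use pq in auto)
  qed
  ultimately obtain l u where S: "?S = {l..u}"
    using connected_compact_interval_1[of ?S] by (auto simp: cbox_interval)
  then have "l < u" using xy by auto
  moreover have "l \<in> ?S" "u \<in> ?S" using \<open>l < u\<close> S by auto
  then have "0 \<le> l" "u \<le> 1" using bounds by auto
  ultimately show ?thesis using S by blast
qed

section \<open>Oscillation of the scalar weight\<close>

context
  fixes a \<kappa> :: real
  assumes a: "0 < a" "a < 1" and \<kappa>: "0 < \<kappa>"
begin

lemma continuous_partition_fn: "continuous_on {0<..} (partition_fn a \<kappa> i)"
  unfolding continuous_on_sequentially
proof (intro allI impI ballI, elim conjE)
  fix e :: "nat \<Rightarrow> real" and l :: real assume l: "l \<in> {0<..}" and e: "\<forall>n. e n \<in> {0<..}" "e \<longlonglongrightarrow> l"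
  note measurable_boltz[OF a \<kappa>, measurable]
  have "(\<lambda>n. \<integral>t. indicator (half i) t *\<^sub>R boltz a \<kappa> (e n) t \<partial>haar)
      \<longlonglongrightarrow> (\<integral>t. indicator (half i) t *\<^sub>R boltz a \<kappa> l t \<partial>haar)"
  proof (rule integral_dominated_convergence[where w = "\<lambda>_. 1"])
    show "AE t in haar. (\<lambda>n. indicator (half i) t *\<^sub>R boltz a \<kappa> (e n) t) \<longlonglongrightarrow> indicator (half i) t *\<^sub>R boltz a \<kappa> l t"
      unfolding boltz_def using l e by (intro AE_I2 tendsto_intros) auto
    show "AE t in haar. norm (indicator (half i) t *\<^sub>R boltz a \<kappa> (e n) t) \<le> 1" for n
      using e(1) boltz_le_1[OF a \<kappa>] boltz_pos[OF a \<kappa>]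
      by (intro AE_I2) (simp add: indicator_def less_imp_le)
  qed auto
  then show "(partition_fn a \<kappa> i \<circ> e) \<longlonglongrightarrow> partition_fn a \<kappa> i l"
    by (simp add: comp_def partition_fn_def set_lebesgue_integral_def)
qed

text \<open>At \<open>\<epsilon> = \<alpha>\<^sub>m\<^sub>+\<^sub>1\<close> the half splits into the complement of \<open>cyl m\<close>, the shell between \<open>cyl m\<close> and
\<open>cyl (Suc m)\<close>, and the inner cylinder. The last two have mass \<open>2\<close> to the power \<open>-(m+1)\<close> each. On the
shell the Boltzmann factor is exactly \<open>exp (- \<kappa> * L)\<close>. Because \<open>\<alpha>\<close> decays doubly exponentially, it is
negligible on the complement and close to 1 on the inner cylinder.\<close>

lemma scaled_partition_fn_bounds:
  fixes i :: bit
  assumes m: "1 \<le> m"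
  defines "L \<equiv> if i = 0 then 1 else Lfac a (Suc m)"
  shows "exp (- \<kappa> * L) + exp (- \<kappa> * (2 * alpha (Suc m))) \<le> 2 ^ Suc m * partition_fn a \<kappa> i (alpha (Suc m))"
    and "2 ^ Suc m * partition_fn a \<kappa> i (alpha (Suc m)) \<le> 2 ^ Suc m * exp (- (\<kappa> * (1 - a)) * 2 ^ m) + exp (- \<kappa> * L) + 1"
proof -
  let ?e = "alpha (Suc m)" and ?T = "\<lambda>n. cyl n (point i)"
  let ?I = "\<lambda>A. LINT t:A|haar. boltz a \<kappa> ?e t"
  have e: "0 < ?e" by (rule alpha_pos)
  have T: "?T (Suc m) \<subseteq> ?T m" "?T m \<subseteq> half i"
    by (auto intro!: cyl_mono subsetD[OF cyl_subset_half[OF m]])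
  note int = set_integrable_boltz1[OF a \<kappa> e]
  have "half i = (half i - ?T m) \<union> ((?T m - ?T (Suc m)) \<union> ?T (Suc m))" using T by auto
  then have "partition_fn a \<kappa> i ?e = ?I ((half i - ?T m) \<union> ((?T m - ?T (Suc m)) \<union> ?T (Suc m)))"
    unfolding partition_fn_def by (rule arg_cong)
  also have "\<dots> = ?I (half i - ?T m) + ?I ((?T m - ?T (Suc m)) \<union> ?T (Suc m))"
    by (rule set_integral_Un) (use T in \<open>auto intro!: int\<close>)
  also have "?I ((?T m - ?T (Suc m)) \<union> ?T (Suc m)) = ?I (?T m - ?T (Suc m)) + ?I (?T (Suc m))"
    by (rule set_integral_Un) (auto intro!: int)
  finally have split: "partition_fn a \<kappa> i ?e =
      ?I (half i - ?T m) + (?I (?T m - ?T (Suc m)) + ?I (?T (Suc m)))" .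
  have shell: "?I (?T m - ?T (Suc m)) = (1/2) ^ Suc m * exp (- \<kappa> * L)"
  proof -
    have "?I (?T m - ?T (Suc m)) = (LINT t:?T m - ?T (Suc m)|haar. exp (- \<kappa> * L))"
    proof (rule set_lebesgue_integral_cong)
      show "?T m - ?T (Suc m) \<in> sets haar" by auto
      show "\<forall>t. t \<in> ?T m - ?T (Suc m) \<longrightarrow> boltz a \<kappa> ?e t = exp (- \<kappa> * L)"
        using Wfun_shell[OF m] e by (auto simp: boltz_def shell_value_def L_def)
    qed
    also have "\<dots> = measure haar (?T m - ?T (Suc m)) * exp (- \<kappa> * L)"
      by (rule set_integral_const_haar) auto
    also have "measure haar (?T m - ?T (Suc m)) = (1/2) ^ m - (1/2) ^ Suc m"
      using T(1) by (subst haar.finite_measure_Diff) (auto simp: measure_cyl)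
    also have "\<dots> = (1/2) ^ Suc m" by simp
    finally show ?thesis .
  qed
  (* doubling the exponent: alpha (Suc n) is the square of alpha n *)
  have "alpha (Suc (Suc m)) / ?e = ?e"
    by (simp add: alpha_def exp_diff[symmetric])
  then have "- \<kappa> * (2 * alpha (Suc (Suc m))) / ?e = - \<kappa> * (2 * ?e)"
    by (simp only: times_divide_eq_right[symmetric])
  moreover have "measure haar (?T (Suc m)) * exp (- \<kappa> * (2 * alpha (Suc (Suc m))) / ?e) \<le> ?I (?T (Suc m))"
    by (rule boltz_integral_bounds(1)[OF a \<kappa> e sets_cyl, where v = 0])
      (use Wfun_upper[OF a, of "Suc m" _ i] in auto)
  ultimately have core_lower: "(1/2) ^ Suc m * exp (- \<kappa> * (2 * ?e)) \<le> ?I (?T (Suc m))"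
    by (simp only: measure_cyl)
  have core_upper: "?I (?T (Suc m)) \<le> (1/2) ^ Suc m"
    using boltz_integral_bounds(2)[OF a \<kappa> e sets_cyl, of "Suc m" "point i" 0 2]
      Wfun_nonneg[OF a] Wfun_le_2[OF a] by (simp add: measure_cyl)
  have far_lower: "0 \<le> ?I (half i - ?T m)"
    unfolding set_lebesgue_integral_def using less_imp_le[OF boltz_pos[OF a \<kappa>]]
    by (intro Bochner_Integration.integral_nonneg) (auto simp: indicator_def)
  have far_upper: "?I (half i - ?T m) \<le> exp (- (\<kappa> * (1 - a)) * 2 ^ m)"
  proof -
    have "2 ^ m \<le> exp ((2 :: real) ^ m)" using exp_ge_add_one_self[of "2 ^ m :: real"] by linarith
    also have "\<dots> = alpha m / ?e" by (simp add: alpha_def exp_diff[symmetric])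
    finally have "\<kappa> * (1 - a) * 2 ^ m \<le> \<kappa> * (1 - a) * (alpha m / ?e)"
      using a \<kappa> by (intro mult_left_mono) auto
    then have "exp (- \<kappa> * ((1 - a) * alpha m) / ?e) \<le> exp (- (\<kappa> * (1 - a)) * 2 ^ m)" by simp
    then show ?thesis using far_integral_upper[OF a \<kappa> e, of i m] by linarith
  qed
  have half_pow: "2 ^ Suc m * ((1/2) ^ Suc m * x) = x" for x :: real
    by (simp add: power_one_over)
  have "2 ^ Suc m * (0 + ((1/2) ^ Suc m * exp (- \<kappa> * L) + (1/2) ^ Suc m * exp (- \<kappa> * (2 * ?e))))
      \<le> 2 ^ Suc m * partition_fn a \<kappa> i ?e"
    unfolding split shell by (intro mult_left_mono add_mono far_lower core_lower order_refl) auto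
  then show "exp (- \<kappa> * L) + exp (- \<kappa> * (2 * ?e)) \<le> 2 ^ Suc m * partition_fn a \<kappa> i ?e"
    by (simp only: distrib_left half_pow add_0)
  have "2 ^ Suc m * partition_fn a \<kappa> i ?e \<le>
      2 ^ Suc m * (exp (- (\<kappa> * (1 - a)) * 2 ^ m) + ((1/2) ^ Suc m * exp (- \<kappa> * L) + (1/2) ^ Suc m * 1))"
    unfolding split shell mult_1_right by (intro mult_left_mono add_mono far_upper core_upper order_refl) auto
  then show "2 ^ Suc m * partition_fn a \<kappa> i ?e \<le> 2 ^ Suc m * exp (- (\<kappa> * (1 - a)) * 2 ^ m) + exp (- \<kappa> * L) + 1"
    by (simp only: distrib_left half_pow add.assoc)
qed

lemma scaled_partition_fn_tendsto:
  fixes r :: "nat \<Rightarrow> nat"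
  assumes r: "strict_mono r" "\<And>k. 1 \<le> r k" and L: "\<And>k. (if i = 0 then 1 else Lfac a (Suc (r k))) = L"
  shows "(\<lambda>k. 2 ^ Suc (r k) * partition_fn a \<kappa> i (alpha (Suc (r k)))) \<longlonglongrightarrow> 1 + exp (- \<kappa> * L)"
proof (rule tendsto_sandwich)
  have rt: "filterlim r at_top sequentially" by (rule filterlim_subseq[OF r(1)])
  from filterlim_compose[OF LIMSEQ_Suc[OF alpha_tendsto_0] rt] have al: "(\<lambda>k. alpha (Suc (r k))) \<longlonglongrightarrow> 0" .
  have "(\<lambda>k. exp (- \<kappa> * L) + exp (- \<kappa> * (2 * alpha (Suc (r k))))) \<longlonglongrightarrow> exp (- \<kappa> * L) + exp (- \<kappa> * (2 * 0))"
    by (intro tendsto_intros al)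
  then show "(\<lambda>k. exp (- \<kappa> * L) + exp (- \<kappa> * (2 * alpha (Suc (r k))))) \<longlonglongrightarrow> 1 + exp (- \<kappa> * L)"
    by (simp add: add.commute)
  define c where "c = \<kappa> * (1 - a)"
  have c: "0 < c" using a \<kappa> by (simp add: c_def)
  have "filterlim (\<lambda>m. (2 :: real) ^ m) at_top sequentially"
    by (rule filterlim_at_top_mono[OF filterlim_real_sequentially])
      (auto intro!: always_eventually less_imp_le of_nat_less_two_power)
  then have "filterlim (\<lambda>m. c * 2 ^ m) at_top sequentially"
    by (rule filterlim_tendsto_pos_mult_at_top[OF tendsto_const c])
  from filterlim_compose[OF tendsto_power_div_exp_0[of 1] this]
  have "(\<lambda>m. (c * 2 ^ m) ^ 1 / exp (c * 2 ^ m)) \<longlonglongrightarrow> 0" .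
  from filterlim_compose[OF this rt]
  have "(\<lambda>k. (2 / c) * ((c * 2 ^ r k) ^ 1 / exp (c * 2 ^ r k)) + exp (- \<kappa> * L) + 1) \<longlonglongrightarrow> (2 / c) * 0 + exp (- \<kappa> * L) + 1"
    by (intro tendsto_intros)
  moreover have "(2 / c) * ((c * 2 ^ r k) ^ 1 / exp (c * 2 ^ r k)) = 2 ^ Suc (r k) * exp (- c * 2 ^ r k)" for k
    using c by (simp add: exp_minus field_simps)
  ultimately show "(\<lambda>k. 2 ^ Suc (r k) * exp (- (\<kappa> * (1 - a)) * 2 ^ r k) + exp (- \<kappa> * L) + 1) \<longlonglongrightarrow> 1 + exp (- \<kappa> * L)"
    by (simp add: c_def add.commute)
  show "\<forall>\<^sub>F k in sequentially. exp (- \<kappa> * L) + exp (- \<kappa> * (2 * alpha (Suc (r k)))) \<le> 2 ^ Suc (r k) * partition_fn a \<kappa> i (alpha (Suc (r k)))"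
    by (intro always_eventually allI scaled_partition_fn_bounds(1)[OF r(2), where i = i, unfolded L])
  show "\<forall>\<^sub>F k in sequentially. 2 ^ Suc (r k) * partition_fn a \<kappa> i (alpha (Suc (r k))) \<le> 2 ^ Suc (r k) * exp (- (\<kappa> * (1 - a)) * 2 ^ r k) + exp (- \<kappa> * L) + 1"
    by (intro always_eventually allI scaled_partition_fn_bounds(2)[OF r(2), where i = i, unfolded L])
qed

end

context
  fixes a \<beta> :: real
  assumes a: "0 < a" "a < 1" and \<beta>: "0 < \<beta>"
begin

lemma continuous_weight: "continuous_on {0<..} (weight a \<beta>)"
proof -
  have "continuous_on {0<..} (\<lambda>\<epsilon>. sqrt (partition_fn a 1 0 \<epsilon> * partition_fn a \<beta> 0 \<epsilon>) /
      (sqrt (partition_fn a 1 0 \<epsilon> * partition_fn a \<beta> 0 \<epsilon>) + sqrt (partition_fn a 1 1 \<epsilon> * partition_fn a \<beta> 1 \<epsilon>)))"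
  proof (intro continuous_intros continuous_partition_fn[OF a] \<beta> zero_less_one ballI)
    fix \<epsilon> :: real assume "\<epsilon> \<in> {0<..}"
    then have "0 < sqrt (partition_fn a 1 i \<epsilon> * partition_fn a \<beta> i \<epsilon>)" for i
      using partition_fn_pos[OF a zero_less_one] partition_fn_pos[OF a \<beta>] by simp
    from add_pos_pos[OF this[of 0] this[of 1]]
    show "sqrt (partition_fn a 1 0 \<epsilon> * partition_fn a \<beta> 0 \<epsilon>) + sqrt (partition_fn a 1 1 \<epsilon> * partition_fn a \<beta> 1 \<epsilon>) \<noteq> 0"
      by simp
  qed
  then show ?thesis
    by (simp only: weight_def[abs_def] Let_def I_int_partition_fn J_int_partition_fn)
qed

text \<open>The weight is invariant under scaling all four integrals by \<open>2 ^ Suc (r k)\<close>. Along subsequences of fixed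
parity the factor \<open>L\<close> is constant and the scaled integrals converge, which gives the two limits.\<close>

lemma weight_tendsto:
  fixes r :: "nat \<Rightarrow> nat"
  assumes r: "strict_mono r" "\<And>k. 1 \<le> r k" and L: "\<And>k. Lfac a (Suc (r k)) = 1 + c"
  shows "(\<lambda>k. weight a \<beta> (alpha (Suc (r k)))) \<longlonglongrightarrow> limit_weight \<beta> c"
proof -
  define Z where "Z \<kappa> i k = 2 ^ Suc (r k) * partition_fn a \<kappa> i (alpha (Suc (r k)))" for \<kappa> i k
  have Z0: "Z \<kappa> 0 \<longlonglongrightarrow> 1 + exp (- \<kappa> * 1)" and Z1: "Z \<kappa> 1 \<longlonglongrightarrow> 1 + exp (- \<kappa> * (1 + c))" if "0 < \<kappa>" for \<kappa>
    unfolding Z_def by (rule scaled_partition_fn_tendsto[OF a that r]; simp add: L)+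
  have scale: "sqrt (Z 1 i k * Z \<beta> i k) = 2 ^ Suc (r k) *
      sqrt (I_int a i (alpha (Suc (r k))) * J_int a \<beta> i (alpha (Suc (r k))))" for i k
  proof -
    have "Z 1 i k * Z \<beta> i k = (2 ^ Suc (r k))\<^sup>2 *
        (I_int a i (alpha (Suc (r k))) * J_int a \<beta> i (alpha (Suc (r k))))"
      by (simp only: Z_def I_int_partition_fn J_int_partition_fn power2_eq_square mult_ac)
    then show ?thesis by (simp only: real_sqrt_mult real_sqrt_abs) simp
  qed
  have w: "weight a \<beta> (alpha (Suc (r k))) =
     sqrt (Z 1 0 k * Z \<beta> 0 k) / (sqrt (Z 1 0 k * Z \<beta> 0 k) + sqrt (Z 1 1 k * Z \<beta> 1 k))" for k
    unfolding scale weight_def Let_def distrib_left[symmetric]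
    by (rule mult_divide_mult_cancel_left[symmetric]) simp
  have pos: "0 < sqrt ((1 + exp x) * (1 + exp y))" for x y :: real
    using exp_gt_zero[of x] exp_gt_zero[of y] by (simp add: add_pos_pos)
  have "(\<lambda>k. sqrt (Z 1 0 k * Z \<beta> 0 k) / (sqrt (Z 1 0 k * Z \<beta> 0 k) + sqrt (Z 1 1 k * Z \<beta> 1 k)))
     \<longlonglongrightarrow> sqrt ((1 + exp (- 1 * 1)) * (1 + exp (- \<beta> * 1))) /
       (sqrt ((1 + exp (- 1 * 1)) * (1 + exp (- \<beta> * 1))) +
        sqrt ((1 + exp (- 1 * (1 + c))) * (1 + exp (- \<beta> * (1 + c)))))"
    by (intro tendsto_intros Z0 Z1 zero_less_one \<beta>) (use add_pos_pos[OF pos pos] in \<open>metis less_irrefl\<close>)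
  then show ?thesis unfolding w limit_weight_def by simp
qed

lemma limit_weight_in_Clust:
  fixes r :: "nat \<Rightarrow> nat"
  assumes r: "strict_mono r" "\<And>k. 1 \<le> r k" and L: "\<And>k. Lfac a (Suc (r k)) = 1 + c"
  shows "limit_weight \<beta> c \<in> Clust LIMSEQ (weight a \<beta>)"
  unfolding Clust_def
proof (intro CollectI exI conjI allI)
  show "(\<lambda>k. weight a \<beta> (alpha (Suc (r k)))) \<longlonglongrightarrow> limit_weight \<beta> c" by (rule weight_tendsto[OF r L])
  show "0 < alpha (Suc (r k))" for k by (rule alpha_pos)
  show "decseq (\<lambda>k. alpha (Suc (r k)))"
    using r(1) by (intro decseq_SucI alpha_antimono) (simp add: strict_mono_def less_imp_le)
  from filterlim_compose[OF LIMSEQ_Suc[OF alpha_tendsto_0] filterlim_subseq[OF r(1)]]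
  show "(\<lambda>k. alpha (Suc (r k))) \<longlonglongrightarrow> 0" .
qed

lemma limit_weights_in_Clust:
  "limit_weight \<beta> a \<in> Clust LIMSEQ (weight a \<beta>)" "limit_weight \<beta> (- a) \<in> Clust LIMSEQ (weight a \<beta>)"
  by (rule limit_weight_in_Clust[where r = "\<lambda>k. 2 * k + 1"] limit_weight_in_Clust[where r = "\<lambda>k. 2 * k + 2"];
      simp add: strict_mono_def Lfac_def)+

text \<open>The two limits differ only in the second term of the denominator, which decreases with \<open>c\<close>.\<close>

lemma limit_weight_less: "limit_weight \<beta> (- a) < limit_weight \<beta> a"
proof -
  define N where "N = sqrt ((1 + exp (- 1)) * (1 + exp (- \<beta>)))"
  define D where "D c = sqrt ((1 + exp (- (1 + c))) * (1 + exp (- \<beta> * (1 + c))))" for c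
  have pos: "0 < sqrt ((1 + exp x) * (1 + exp y))" for x y :: real
    using exp_gt_zero[of x] exp_gt_zero[of y] by (simp add: add_pos_pos)
  have "(1 + exp (- (1 + a))) * (1 + exp (- \<beta> * (1 + a))) < (1 + exp (- (1 - a))) * (1 + exp (- \<beta> * (1 - a)))"
    using a \<beta> by (intro mult_strict_mono add_strict_left_mono) (auto intro: add_pos_nonneg)
  then have "D a < D (- a)" by (simp add: D_def)
  then have "N / (N + D (- a)) < N / (N + D a)"
    using pos by (intro divide_strict_left_mono mult_pos_pos add_pos_pos) (auto simp: N_def D_def)
  then show ?thesis by (simp add: limit_weight_def N_def D_def)
qed

lemma Clust_weight_interval:
  "\<exists>l u. 0 \<le> l \<and> l < u \<and> u \<le> 1 \<and> Clust LIMSEQ (weight a \<beta>) = {l..u}"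
  using continuous_weight weight_bounds[OF a \<beta>] limit_weights_in_Clust limit_weight_less
  by (intro Clust_interval[where x = "limit_weight \<beta> (- a)" and y = "limit_weight \<beta> a"]) (auto intro: less_imp_le)

section \<open>Cluster points of the entropic minimisers\<close>

abbreviation (input) minimiser :: "real \<Rightarrow> (cantor \<times> cantor) measure" where
  "minimiser \<equiv> entropic_minimiser (cantor_cost a \<beta>) haar"

lemma weight_tendsto_of_weak_limit:
  assumes Q: "weak_limit cantor_top2 (\<lambda>i. minimiser (e i)) Q F" and e: "\<forall>\<^sub>F i in F. 0 < e i"
  shows "((\<lambda>i. weight a \<beta> (e i)) \<longlongrightarrow> measure Q same_half) F"
proof -
  have "((\<lambda>i. \<integral>z. indicator same_half z \<partial>minimiser (e i)) \<longlongrightarrow> measure Q same_half) F"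
    by (rule weak_limit_clopen[OF Q same_half_clopen])
  moreover have "\<forall>\<^sub>F i in F. (\<integral>z. indicator same_half z \<partial>minimiser (e i)) = weight a \<beta> (e i)"
    using e
  proof eventually_elim
    case (elim i)
    then show ?case
      by (simp only: entropic_minimiser_eq_gibbs_plan[OF a \<beta>] gibbs_plan_same_half[OF a \<beta>])
  qed
  ultimately show ?thesis by (rule Lim_transform_eventually)
qed

text \<open>The weight is the mass of \<open>same_half\<close>, so it converges along any sequence on which the minimisers
converge; conversely, convergence of the weight to \<open>w\<close> forces the minimisers to converge to
\<open>P_mix w\<close>.\<close>

lemma Clust_minimiser:
  "Clust (\<lambda>z Q. weak_limit cantor_top2 z Q sequentially) minimiser = P_mix ` Clust LIMSEQ (weight a \<beta>)"
proof (intro set_eqI iffI)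
  fix Q assume "Q \<in> Clust (\<lambda>z Q. weak_limit cantor_top2 z Q sequentially) minimiser"
  then obtain e where e: "\<And>n. 0 < e n" "decseq e" "e \<longlonglongrightarrow> 0"
    and Q: "weak_limit cantor_top2 (\<lambda>n. minimiser (e n)) Q sequentially"
    unfolding Clust_def by blast
  define w where "w = measure Q same_half"
  have w: "(\<lambda>n. weight a \<beta> (e n)) \<longlonglongrightarrow> w"
    unfolding w_def by (rule weight_tendsto_of_weak_limit[OF Q]) (simp add: e(1))
  have "weak_limit cantor_top2 (\<lambda>n. minimiser (e n)) (P_mix w) sequentially"
    unfolding entropic_minimiser_eq_gibbs_plan[OF a \<beta> e(1)] by (rule gibbs_plan_weak_limit[OF a \<beta> e(1,3) w])
  then have "Q = P_mix w" using weak_limit_unique_cantor2[OF Q] by simp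
  moreover have "w \<in> Clust LIMSEQ (weight a \<beta>)" unfolding Clust_def using e w by blast
  ultimately show "Q \<in> P_mix ` Clust LIMSEQ (weight a \<beta>)" by blast
next
  fix Q assume "Q \<in> P_mix ` Clust LIMSEQ (weight a \<beta>)"
  then obtain w e where e: "\<And>n. 0 < e n" "decseq e" "e \<longlonglongrightarrow> 0"
    and w: "(\<lambda>n. weight a \<beta> (e n)) \<longlonglongrightarrow> w" and Q: "Q = P_mix w"
    unfolding Clust_def by blast
  have "weak_limit cantor_top2 (\<lambda>n. minimiser (e n)) Q sequentially"
    unfolding entropic_minimiser_eq_gibbs_plan[OF a \<beta> e(1)] Q by (rule gibbs_plan_weak_limit[OF a \<beta> e(1,3) w])
  then show "Q \<in> Clust (\<lambda>z Q. weak_limit cantor_top2 z Q sequentially) minimiser"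
    unfolding Clust_def using e by blast
qed

lemma minimiser_not_convergent:
  "\<not> (\<exists>Q. weak_limit cantor_top2 minimiser Q (at_right 0))"
proof
  assume "\<exists>Q. weak_limit cantor_top2 minimiser Q (at_right 0)"
  then obtain Q where Q: "weak_limit cantor_top2 minimiser Q (at_right 0)" ..
  have lim: "(weight a \<beta> \<longlongrightarrow> measure Q same_half) (at_right 0)"
    by (rule weight_tendsto_of_weak_limit[where e = "\<lambda>\<epsilon>. \<epsilon>", OF Q]) (simp add: eventually_at_right_less)
  have "w = measure Q same_half" if wC: "w \<in> Clust LIMSEQ (weight a \<beta>)" for w
  proof -
    obtain e where e: "\<And>n. 0 < e n" "e \<longlonglongrightarrow> 0" and w: "(\<lambda>n. weight a \<beta> (e n)) \<longlonglongrightarrow> w"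
      using wC unfolding Clust_def by blast
    have "e n \<noteq> 0" for n using e(1)[of n] by simp
    then have "filterlim e (at_right 0) sequentially" using e by (simp add: filterlim_at)
    from LIMSEQ_unique[OF w filterlim_compose[OF lim this]] show ?thesis .
  qed
  from this[OF limit_weights_in_Clust(1)] this[OF limit_weights_in_Clust(2)] limit_weight_less
  show False by simp
qed

end

theorem theorem1p2:
  shows "(\<exists>(X :: cantor metric) (\<mu> :: cantor measure) (C :: cantor \<times> cantor \<Rightarrow> real).
            compact_space (mtopology_of X) \<and>
            \<mu> \<in> prob_measures (mtopology_of X) \<and> atomless \<mu> \<and>
            bounded_Lipschitz_cost X C \<and>
            \<not> (\<exists>Q. weak_limit (prod_topology (mtopology_of X) (mtopology_of X))
                     (entropic_minimiser C \<mu>) Q (at_right 0)) \<and>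
            (\<forall>P. optimal_plan C \<mu> P \<longrightarrow> mutually_singular P (\<mu> \<Otimes>\<^sub>M \<mu>)))
       \<and> (\<forall>a \<beta> :: real. 0 < a \<and> a < 1 \<and> 0 < \<beta> \<and> \<beta> \<noteq> 1 \<longrightarrow>
            (let \<W> = Clust LIMSEQ (weight a \<beta>);
                 G2 = prod_topology (mtopology_of cantor_metric) (mtopology_of cantor_metric)
             in Clust (\<lambda>z Q. weak_limit G2 z Q sequentially)
                      (entropic_minimiser (cantor_cost a \<beta>) haar) = P_mix ` \<W> \<and>
                (\<exists>l u. 0 \<le> l \<and> l < u \<and> u \<le> 1 \<and> \<W> = {l..u}) \<and>
                limit_weight \<beta> a \<in> \<W> \<and> limit_weight \<beta> (- a) \<in> \<W> \<and>
                limit_weight \<beta> (- a) < limit_weight \<beta> a))"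
proof (intro conjI)
  (* any admissible pair of parameters gives the example *)
  have a: "0 < (1/2 :: real)" "(1/2 :: real) < 1" and \<beta>: "0 < (2 :: real)" by simp_all
  show "\<exists>(X :: cantor metric) (\<mu> :: cantor measure) (C :: cantor \<times> cantor \<Rightarrow> real).
            compact_space (mtopology_of X) \<and>
            \<mu> \<in> prob_measures (mtopology_of X) \<and> atomless \<mu> \<and>
            bounded_Lipschitz_cost X C \<and>
            \<not> (\<exists>Q. weak_limit (prod_topology (mtopology_of X) (mtopology_of X))
                     (entropic_minimiser C \<mu>) Q (at_right 0)) \<and>
            (\<forall>P. optimal_plan C \<mu> P \<longrightarrow> mutually_singular P (\<mu> \<Otimes>\<^sub>M \<mu>))"
    by (rule exI[of _ cantor_metric], rule exI[of _ haar], rule exI[of _ "cantor_cost (1/2) 2"],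
        intro conjI allI impI compact_space_cantor haar_prob_measure atomless_haar
          bounded_Lipschitz_cantor_cost[OF a \<beta>] minimiser_not_convergent[OF a \<beta>] optimal_plan_singular[OF a \<beta>])
  show "\<forall>a \<beta> :: real. 0 < a \<and> a < 1 \<and> 0 < \<beta> \<and> \<beta> \<noteq> 1 \<longrightarrow>
            (let \<W> = Clust LIMSEQ (weight a \<beta>);
                 G2 = prod_topology (mtopology_of cantor_metric) (mtopology_of cantor_metric)
             in Clust (\<lambda>z Q. weak_limit G2 z Q sequentially)
                      (entropic_minimiser (cantor_cost a \<beta>) haar) = P_mix ` \<W> \<and>
                (\<exists>l u. 0 \<le> l \<and> l < u \<and> u \<le> 1 \<and> \<W> = {l..u}) \<and>
                limit_weight \<beta> a \<in> \<W> \<and> limit_weight \<beta> (- a) \<in> \<W> \<and>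
                limit_weight \<beta> (- a) < limit_weight \<beta> a)"
  proof (intro allI impI, elim conjE)
    fix a \<beta> :: real assume a: "0 < a" "a < 1" and \<beta>: "0 < \<beta>"
    show "let \<W> = Clust LIMSEQ (weight a \<beta>);
                 G2 = prod_topology (mtopology_of cantor_metric) (mtopology_of cantor_metric)
             in Clust (\<lambda>z Q. weak_limit G2 z Q sequentially)
                      (entropic_minimiser (cantor_cost a \<beta>) haar) = P_mix ` \<W> \<and>
                (\<exists>l u. 0 \<le> l \<and> l < u \<and> u \<le> 1 \<and> \<W> = {l..u}) \<and>
                limit_weight \<beta> a \<in> \<W> \<and> limit_weight \<beta> (- a) \<in> \<W> \<and>
                limit_weight \<beta> (- a) < limit_weight \<beta> a"
      unfolding Let_def
      by (intro conjI Clust_minimiser[OF a \<beta>] Clust_weight_interval[OF a \<beta>]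
          limit_weights_in_Clust[OF a \<beta>] limit_weight_less[OF a \<beta>])
  qed
qed

end
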